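(* Let $(\mathfrak{g},[~,~],\alpha)$ be a (multiplicative) Hom-Lie algebra. Define degree $0$ bilinear maps $$\rho:C^{\bullet+1}_{\mathrm{Hom}}(\mathfrak{g},\mathfrak{g})\times C^\bullet_{\mathrm{Hom}}(\mathfrak{g},\mathfrak{g})\to C^\bullet_{\mathrm{Hom}}(\mathfrak{g},\mathfrak{g}),\quad \rho(P)(E):=i_PE,$$ $$\psi:C^\bullet_{\mathrm{Hom}}(\mathfrak{g},\mathfrak{g})\times C^{\bullet+1}_{\mathrm{Hom}}(\mathfrak{g},\mathfrak{g})\to C^{\bullet+1}_{\mathrm{Hom}}(\mathfrak{g},\mathfrak{g}),\quad \psi(E)(P):=[E,P]_{\mathsf{FN}}.$$ Then the quadruple $\big((C^{\bullet+1}_{\mathrm{Hom}}(\mathfrak{g},\mathfrak{g}),[~,~]_{\mathsf{NR}}),(C^\bullet_{\mathrm{Hom}}(\mathfrak{g},\mathfrak{g}),[~,~]_{\mathsf{FN}}),\rho,\psi\big)$ is a matched pair of graded Lie algebras. Moreover, the corresponding bicrossed product bracket on $C^{\bullet+1}_{\mathrm{Hom}}(\mathfrak{g},\mathfrak{g})\oplus C^\bullet_{\mathrm{Hom}}(\mathfrak{g},\mathfrak{g})$ coincides with $$\llbracket(P,E),(Q,F)\rrbracket=\big([P,Q]_{\mathsf{NR}}+[E,Q]_{\mathsf{FN}}-(-1)^{mn}[F,P]_{\mathsf{FN}},\ [E,F]_{\mathsf{FN}}+i_PF-(-1)^{mn}i_QE\big),$$ for $(P,E)\in C^{m+1}_{\mathrm{Hom}}(\mathfrak{g},\mathfrak{g})\oplus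 C^m_{\mathrm{Hom}}(\mathfrak{g},\mathfrak{g})$ and $(Q,F)\in C^{n+1}_{\mathrm{Hom}}(\mathfrak{g},\mathfrak{g})\oplus C^n_{\mathrm{Hom}}(\mathfrak{g},\mathfrak{g})$.
   Context: All vector spaces and (multi)linear maps are over a field $\mathbf{k}$ of characteristic $0$. A (multiplicative) Hom-Lie algebra $(\mathfrak{g},[~,~],\alpha)$ is a vector space $\mathfrak{g}$ with a skew-symmetric bilinear map $[~,~]$ and a linear map $\alpha:\mathfrak{g}\to\mathfrak{g}$ such that $[\alpha(x),[y,z]]+[\alpha(y),[z,x]]+[\alpha(z),[x,y]]=0$ and $\alpha([x,y])=[\alpha(x),\alpha(y)]$. For $n\ge1$, $C^n_{\mathrm{Hom}}(\mathfrak{g},\mathfrak{g})=\{f:\wedge^n\mathfrak{g}\to\mathfrak{g}\mid\alpha\circ f=f\circ\alpha^{\wedge n}\}$; $C^\bullet_{\mathrm{Hom}}(\mathfrak{g},\mathfrak{g})=\bigoplus_{n\ge1}C^n_{\mathrm{Hom}}(\mathfrak{g},\mathfrak{g})$ with $C^n_{\mathrm{Hom}}$ in degree $n$, while in $C^{\bullet+1}_{\mathrm{Hom}}(\mathfrak{g},\mathfrak{g})$ the summand $C^{n+1}_{\mathrm{Hom}}$ has degree $n\ge0$. $Sh(m,n)$ is the set of $(m,n)$-shuffles. For $P\in C^m_{\mathrm{Hom}}(\mathfrak{g},\mathfrak{g})$, $Q\in C^n_{\mathrm{Hom}}(\mathfrak{g},\mathfrak{g})$: $$(i_PQ)(x_1,\ldots,x_{m+n-1})=\sum_{\sigma\in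 Sh(m,n-1)}(-1)^\sigma Q\big(P(x_{\sigma(1)},\ldots,x_{\sigma(m)}),\alpha^{m-1}x_{\sigma(m+1)},\ldots,\alpha^{m-1}x_{\sigma(m+n-1)}\big),$$ $$[P,Q]_{\mathsf{NR}}=i_PQ-(-1)^{(m-1)(n-1)}i_QP,$$ $$[P,Q]_{\mathsf{C}}(x_1,\ldots,x_{m+n})=\sum_{\sigma\in Sh(m,n)}(-1)^\sigma[\alpha^{n-1}P(x_{\sigma(1)},\ldots,x_{\sigma(m)}),\alpha^{m-1}Q(x_{\sigma(m+1)},\ldots,x_{\sigma(m+n)})],$$ $$(\delta_{\mathrm{Hom}}P)(x_1,\ldots,x_{m+1})=\sum_{i=1}^{m+1}(-1)^{i+1}[\alpha^{m-1}(x_i),P(x_1,\ldots,\widehat{x_i},\ldots,x_{m+1})]+\sum_{i<j}(-1)^{i+j}P([x_i,x_j],\alpha(x_1),\ldots,\widehat{\alpha(x_i)},\ldots,\widehat{\alpha(x_j)},\ldots,\alpha(x_{m+1})),$$ $$[P,Q]_{\mathsf{FN}}=[P,Q]_{\mathsf{C}}+(-1)^m\,i_{(\delta_{\mathrm{Hom}}P)}Q-(-1)^{(m+1)n}\,i_{(\delta_{\mathrm{Hom}}Q)}P\in C^{m+n}_{\mathrm{Hom}}(\mathfrak{g},\mathfrak{g}).$$ Both $(C^{\bullet+1}_{\mathrm{Hom}}(\mathfrak{g},\mathfrak{g}),[~,~]_{\mathsf{NR}})$ and $(C^\bullet_{\mathrm{Hom}}(\mathfrak{g},\mathfrak{g}),[~,~]_{\mathsf{FN}})$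 are graded Lie algebras. A matched pair of graded Lie algebras is a quadruple $((\mathcal{A},[~,~]_\mathcal{A}),(\mathcal{B},[~,~]_\mathcal{B}),\rho,\psi)$ of two graded Lie algebras and degree $0$ bilinear maps $\rho:\mathcal{A}\times\mathcal{B}\to\mathcal{B}$, $\psi:\mathcal{B}\times\mathcal{A}\to\mathcal{A}$ such that for all homogeneous $a,a'\in\mathcal{A}$, $b,b'\in\mathcal{B}$: $$\rho([a,a']_\mathcal{A})(b)=\rho(a)\rho(a')(b)-(-1)^{|a||a'|}\rho(a')\rho(a)(b),$$ $$\rho(a)([b,b']_\mathcal{B})=[\rho(a)b,b']_\mathcal{B}+(-1)^{|a||b|}[b,\rho(a)b']_\mathcal{B}+(-1)^{(|a|+|b|)|b'|}\rho(\psi(b')a)b-(-1)^{|a||b|}\rho(\psi(b)a)b',$$ $$\psi([b,b']_\mathcal{B})(a)=\psi(b)\psi(b')(a)-(-1)^{|b||b'|}\psi(b')\psi(b)(a),$$ $$\psi(b)([a,a']_\mathcal{A})=[\psi(b)a,a']_\mathcal{A}+(-1)^{|b||a|}[a,\psi(b)a']_\mathcal{A}+(-1)^{(|b|+|a|)|a'|}\psi(\rho(a')b)a-(-1)^{|b||a|}\psi(\rho(a)b)a'.$$ The bicrossed product of a matched pair is $\mathcal{A}\oplus\mathcal{B}$ with the graded Lie bracket, for homogeneous $(a,b),(a',b')$, $$[(a,b),(a',b')]_{\bowtie}=\big([a,a']_\mathcal{A}+\psi(b)a'-(-1)^{|b||a'|}\psi(b')a,\ [b,b']_\mathcal{B}+\rho(a)b'-(-1)^{|b||a'|}\rho(a')b\big).$$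 *)

theory Defs
  imports
    Complex_Main
    "HOL-Combinatorics.Permutations"
    "HOL-Library.Function_Algebras"
    "HOL-Library.Product_Plus"
begin

section \<open>Graded vector spaces and matched pairs of graded Lie algebras\<close>

text \<open>
  A graded vector space is given internally: a family \<open>G\<close> of independent subspaces of an ambient
  vector space, indexed by degrees in \<open>nat\<close>.  The ambient space may be larger than the direct sum
  \<open>graded_total scale G\<close>; brackets and actions are total functions on the ambient
  type of which only the values on the direct sum matter.
\<close>

definition graded_total :: "('k::field_char_0 \<Rightarrow> 'a::ab_group_add \<Rightarrow> 'a) \<Rightarrow> (nat \<Rightarrow> 'a set) \<Rightarrow> 'a set"
  where "graded_total scale G = module.span scale (\<Union>n. G n)"

definition hom_component ::
    "('k::field_char_0 \<Rightarrow> 'a::ab_group_add \<Rightarrow> 'a) \<Rightarrow> (nat \<Rightarrow> 'a set) \<Rightarrow> nat \<Rightarrow> 'a \<Rightarrow> 'a"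
  where "hom_component scale G n x =
    (THE y. y \<in> G n \<and> x - y \<in> module.span scale (\<Union>i\<in>- {n}. G i))"

locale graded_vector_space = vector_space scale
  for scale :: "'k::field_char_0 \<Rightarrow> 'a::ab_group_add \<Rightarrow> 'a" +
  fixes G :: "nat \<Rightarrow> 'a set"
  assumes subspace_degree: "subspace (G n)"
    and independent_degrees:
      "finite I \<Longrightarrow> (\<And>i. i \<in> I \<Longrightarrow> x i \<in> G i) \<Longrightarrow> (\<Sum>i\<in>I. x i) = 0 \<Longrightarrow> i \<in> I \<Longrightarrow> x i = 0"

definition bilinear_on ::
    "('k::field_char_0 \<Rightarrow> 'a::ab_group_add \<Rightarrow> 'a) \<Rightarrow> ('k \<Rightarrow> 'b::ab_group_add \<Rightarrow> 'b) \<Rightarrow>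
     ('k \<Rightarrow> 'c::ab_group_add \<Rightarrow> 'c) \<Rightarrow> 'a set \<Rightarrow> 'b set \<Rightarrow> ('a \<Rightarrow> 'b \<Rightarrow> 'c) \<Rightarrow> bool"
  where "bilinear_on sA sB sC U V f \<longleftrightarrow>
    (\<forall>x\<in>U. \<forall>x'\<in>U. \<forall>y\<in>V. f (x + x') y = f x y + f x' y) \<and>
    (\<forall>x\<in>U. \<forall>y\<in>V. \<forall>y'\<in>V. f x (y + y') = f x y + f x y') \<and>
    (\<forall>c. \<forall>x\<in>U. \<forall>y\<in>V. f (sA c x) y = sC c (f x y)) \<and>
    (\<forall>c. \<forall>x\<in>U. \<forall>y\<in>V. f x (sB c y) = sC c (f x y))"

locale graded_lie_algebra = graded_vector_space scale G
  for scale :: "'k::field_char_0 \<Rightarrow> 'a::ab_group_add \<Rightarrow> 'a" and G :: "nat \<Rightarrow> 'a set" +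
  fixes br :: "'a \<Rightarrow> 'a \<Rightarrow> 'a"
  assumes bilinear_br:
      "bilinear_on scale scale scale (graded_total scale G) (graded_total scale G) br"
    and degree_br: "x \<in> G m \<Longrightarrow> y \<in> G n \<Longrightarrow> br x y \<in> G (m + n)"
    and skew_br: "x \<in> G m \<Longrightarrow> y \<in> G n \<Longrightarrow> br x y = - scale ((- 1) ^ (m * n)) (br y x)"
    and jacobi_br: "x \<in> G m \<Longrightarrow> y \<in> G n \<Longrightarrow> z \<in> G p \<Longrightarrow>
      br x (br y z) = br (br x y) z + scale ((- 1) ^ (m * n)) (br y (br x z))"

locale matched_pair =
  A: graded_lie_algebra sA GA brA + B: graded_lie_algebra sB GB brB
  for sA :: "'k::field_char_0 \<Rightarrow> 'a::ab_group_add \<Rightarrow> 'a" and GA :: "nat \<Rightarrow> 'a set"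
    and brA :: "'a \<Rightarrow> 'a \<Rightarrow> 'a"
    and sB :: "'k \<Rightarrow> 'b::ab_group_add \<Rightarrow> 'b" and GB :: "nat \<Rightarrow> 'b set"
    and brB :: "'b \<Rightarrow> 'b \<Rightarrow> 'b" +
  fixes \<rho> :: "'a \<Rightarrow> 'b \<Rightarrow> 'b" and \<psi> :: "'b \<Rightarrow> 'a \<Rightarrow> 'a"
  assumes bilinear_rho: "bilinear_on sA sB sB (graded_total sA GA) (graded_total sB GB) \<rho>"
    and bilinear_psi: "bilinear_on sB sA sA (graded_total sB GB) (graded_total sA GA) \<psi>"
    and degree_rho: "a \<in> GA m \<Longrightarrow> b \<in> GB n \<Longrightarrow> \<rho> a b \<in> GB (m + n)"
    and degree_psi: "b \<in> GB m \<Longrightarrow> a \<in> GA n \<Longrightarrow> \<psi> b a \<in> GA (m + n)"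
    and rho_bracket: "a \<in> GA m \<Longrightarrow> a' \<in> GA m' \<Longrightarrow> b \<in> GB n \<Longrightarrow>
      \<rho> (brA a a') b = \<rho> a (\<rho> a' b) - sB ((- 1) ^ (m * m')) (\<rho> a' (\<rho> a b))"
    and rho_compat: "a \<in> GA m \<Longrightarrow> b \<in> GB n \<Longrightarrow> b' \<in> GB n' \<Longrightarrow>
      \<rho> a (brB b b') =
        brB (\<rho> a b) b' + sB ((- 1) ^ (m * n)) (brB b (\<rho> a b'))
        + sB ((- 1) ^ ((m + n) * n')) (\<rho> (\<psi> b' a) b)
        - sB ((- 1) ^ (m * n)) (\<rho> (\<psi> b a) b')"
    and psi_bracket: "b \<in> GB n \<Longrightarrow> b' \<in> GB n' \<Longrightarrow> a \<in> GA m \<Longrightarrow>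
      \<psi> (brB b b') a = \<psi> b (\<psi> b' a) - sA ((- 1) ^ (n * n')) (\<psi> b' (\<psi> b a))"
    and psi_compat: "b \<in> GB n \<Longrightarrow> a \<in> GA m \<Longrightarrow> a' \<in> GA m' \<Longrightarrow>
      \<psi> b (brA a a') =
        brA (\<psi> b a) a' + sA ((- 1) ^ (n * m)) (brA a (\<psi> b a'))
        + sA ((- 1) ^ ((n + m) * m')) (\<psi> (\<rho> a' b) a)
        - sA ((- 1) ^ (n * m)) (\<psi> (\<rho> a b) a')"

text \<open>
  The bracket of the bicrossed product on homogeneous elements of degrees \<open>m\<close> and \<open>n\<close>, and its
  bilinear extension to the direct sum: the degree \<open>m\<close> part of a pair is the pair of the degree
  \<open>m\<close> parts.
\<close>

definition bicrossed_bracket_hom ::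
    "('k::field_char_0 \<Rightarrow> 'a::ab_group_add \<Rightarrow> 'a) \<Rightarrow> ('a \<Rightarrow> 'a \<Rightarrow> 'a) \<Rightarrow>
     ('k \<Rightarrow> 'b::ab_group_add \<Rightarrow> 'b) \<Rightarrow> ('b \<Rightarrow> 'b \<Rightarrow> 'b) \<Rightarrow>
     ('a \<Rightarrow> 'b \<Rightarrow> 'b) \<Rightarrow> ('b \<Rightarrow> 'a \<Rightarrow> 'a) \<Rightarrow> nat \<Rightarrow> nat \<Rightarrow> 'a \<times> 'b \<Rightarrow> 'a \<times> 'b \<Rightarrow> 'a \<times> 'b"
  where
  "bicrossed_bracket_hom sA brA sB brB \<rho> \<psi> m n =
    (\<lambda>(a, b) (a', b').
      (brA a a' + \<psi> b a' - sA ((- 1) ^ (m * n)) (\<psi> b' a),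
       brB b b' + \<rho> a b' - sB ((- 1) ^ (m * n)) (\<rho> a' b)))"

definition bicrossed_bracket ::
    "('k::field_char_0 \<Rightarrow> 'a::ab_group_add \<Rightarrow> 'a) \<Rightarrow> (nat \<Rightarrow> 'a set) \<Rightarrow> ('a \<Rightarrow> 'a \<Rightarrow> 'a) \<Rightarrow>
     ('k \<Rightarrow> 'b::ab_group_add \<Rightarrow> 'b) \<Rightarrow> (nat \<Rightarrow> 'b set) \<Rightarrow> ('b \<Rightarrow> 'b \<Rightarrow> 'b) \<Rightarrow>
     ('a \<Rightarrow> 'b \<Rightarrow> 'b) \<Rightarrow> ('b \<Rightarrow> 'a \<Rightarrow> 'a) \<Rightarrow> 'a \<times> 'b \<Rightarrow> 'a \<times> 'b \<Rightarrow> 'a \<times> 'b"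
  where "bicrossed_bracket sA GA brA sB GB brB \<rho> \<psi> u v =
    (let part = (\<lambda>w n. (hom_component sA GA n (fst w), hom_component sB GB n (snd w)))
     in \<Sum>m | part u m \<noteq> 0. \<Sum>n | part v n \<noteq> 0.
          bicrossed_bracket_hom sA brA sB brB \<rho> \<psi> m n (part u m) (part v n))"


section \<open>Hom-Lie algebras and their cochains\<close>

locale hom_lie_algebra = vector_space scale
  for scale :: "'k::field_char_0 \<Rightarrow> 'v::ab_group_add \<Rightarrow> 'v" +
  fixes br :: "'v \<Rightarrow> 'v \<Rightarrow> 'v" and \<alpha> :: "'v \<Rightarrow> 'v"
  assumes bilinear_br: "bilinear_on scale scale scale UNIV UNIV br"
    and skew_br: "br x y = - br y x"
    and linear_alpha: "Vector_Spaces.linear scale scale \<alpha>"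
    and hom_jacobi: "br (\<alpha> x) (br y z) + br (\<alpha> y) (br z x) + br (\<alpha> z) (br x y) = 0"
    and multiplicative: "\<alpha> (br x y) = br (\<alpha> x) (\<alpha> y)"

text \<open>
  An \<open>n\<close>-cochain is a function on argument lists that vanishes on all lists of length other than
  \<open>n\<close>.  A finite sum of cochains of various arities is again a function on lists, whose part of
  arity \<open>n\<close> is its restriction to the lists of length \<open>n\<close>.
\<close>

type_synonym 'v cochain = "'v list \<Rightarrow> 'v"

definition cscale :: "('k \<Rightarrow> 'v \<Rightarrow> 'v) \<Rightarrow> 'k \<Rightarrow> 'v cochain \<Rightarrow> 'v cochain"
  where "cscale scale c P = (\<lambda>xs. scale c (P xs))"

definition hom_cochains ::
    "('k::field_char_0 \<Rightarrow> 'v::ab_group_add \<Rightarrow> 'v) \<Rightarrow> ('v \<Rightarrow> 'v) \<Rightarrow> nat \<Rightarrow> 'v cochain set"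
  where "hom_cochains scale \<alpha> n = {f.
    (\<forall>xs. length xs \<noteq> n \<longrightarrow> f xs = 0) \<and>
    (\<forall>xs. \<forall>i<n. length xs = n \<longrightarrow> Vector_Spaces.linear scale scale (\<lambda>v. f (xs[i := v]))) \<and>
    (\<forall>xs. \<forall>i<n. \<forall>j<n. length xs = n \<longrightarrow> i \<noteq> j \<longrightarrow> xs ! i = xs ! j \<longrightarrow> f xs = 0) \<and>
    (\<forall>xs. length xs = n \<longrightarrow> \<alpha> (f xs) = f (map \<alpha> xs))}"

text \<open>
  The two gradings: \<open>C_gr\<close> has the \<open>n\<close>-cochains in degree \<open>n \<ge> 1\<close> and nothing in degree 0, and
  \<open>C_gr_shift\<close> has the \<open>(n + 1)\<close>-cochains in degree \<open>n \<ge> 0\<close>.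
\<close>

definition C_gr ::
    "('k::field_char_0 \<Rightarrow> 'v::ab_group_add \<Rightarrow> 'v) \<Rightarrow> ('v \<Rightarrow> 'v) \<Rightarrow> nat \<Rightarrow> 'v cochain set"
  where "C_gr scale \<alpha> n = (if n = 0 then {0} else hom_cochains scale \<alpha> n)"

definition C_gr_shift ::
    "('k::field_char_0 \<Rightarrow> 'v::ab_group_add \<Rightarrow> 'v) \<Rightarrow> ('v \<Rightarrow> 'v) \<Rightarrow> nat \<Rightarrow> 'v cochain set"
  where "C_gr_shift scale \<alpha> n = hom_cochains scale \<alpha> (n + 1)"

definition Sh :: "nat \<Rightarrow> nat \<Rightarrow> (nat \<Rightarrow> nat) set"
  where "Sh m n = {\<sigma>. \<sigma> permutes {..<m + n} \<and>
    strict_mono_on {..<m} \<sigma> \<and> strict_mono_on {m..<m + n} \<sigma>}"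

text \<open>
  The operations on cochains of arities \<open>m\<close> and \<open>n\<close> (both at least 1).  Arguments are numbered
  from 0, so a sign \<open>(- 1) ^ (i + 1)\<close> with \<open>i\<close> counted from 1 becomes \<open>(- 1) ^ i\<close>, while
  \<open>(- 1) ^ (i + j)\<close> is unchanged.  \<open>ins\<close> is \<open>i\<^sub>P Q\<close>; \<open>NR\<close>, \<open>cup\<close> and \<open>FN\<close> are the Nijenhuis-Richardson,
  cup-product and Froelicher-Nijenhuis brackets.
\<close>

definition ins ::
    "('k::field_char_0 \<Rightarrow> 'v::ab_group_add \<Rightarrow> 'v) \<Rightarrow> ('v \<Rightarrow> 'v) \<Rightarrow>
     nat \<Rightarrow> nat \<Rightarrow> 'v cochain \<Rightarrow> 'v cochain \<Rightarrow> 'v cochain"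
  where "ins scale \<alpha> m n P Q = (\<lambda>xs.
    if length xs = m + n - 1 then
      \<Sum>\<sigma>\<in>Sh m (n - 1). scale (of_int (sign \<sigma>))
        (Q (P (map (\<lambda>i. xs ! \<sigma> i) [0..<m])
            # map (\<lambda>i. (\<alpha> ^^ (m - 1)) (xs ! \<sigma> i)) [m..<m + n - 1]))
    else 0)"

definition NR ::
    "('k::field_char_0 \<Rightarrow> 'v::ab_group_add \<Rightarrow> 'v) \<Rightarrow> ('v \<Rightarrow> 'v) \<Rightarrow>
     nat \<Rightarrow> nat \<Rightarrow> 'v cochain \<Rightarrow> 'v cochain \<Rightarrow> 'v cochain"
  where "NR scale \<alpha> m n P Q =
    ins scale \<alpha> m n P Q - cscale scale ((- 1) ^ ((m - 1) * (n - 1))) (ins scale \<alpha> n m Q P)"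

definition cup ::
    "('k::field_char_0 \<Rightarrow> 'v::ab_group_add \<Rightarrow> 'v) \<Rightarrow> ('v \<Rightarrow> 'v \<Rightarrow> 'v) \<Rightarrow> ('v \<Rightarrow> 'v) \<Rightarrow>
     nat \<Rightarrow> nat \<Rightarrow> 'v cochain \<Rightarrow> 'v cochain \<Rightarrow> 'v cochain"
  where "cup scale br \<alpha> m n P Q = (\<lambda>xs.
    if length xs = m + n then
      \<Sum>\<sigma>\<in>Sh m n. scale (of_int (sign \<sigma>))
        (br ((\<alpha> ^^ (n - 1)) (P (map (\<lambda>i. xs ! \<sigma> i) [0..<m])))
            ((\<alpha> ^^ (m - 1)) (Q (map (\<lambda>i. xs ! \<sigma> i) [m..<m + n]))))
    else 0)"

definition hom_delta ::
    "('k::field_char_0 \<Rightarrow> 'v::ab_group_add \<Rightarrow> 'v) \<Rightarrow> ('v \<Rightarrow> 'v \<Rightarrow> 'v) \<Rightarrow> ('v \<Rightarrow> 'v) \<Rightarrow>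
     nat \<Rightarrow> 'v cochain \<Rightarrow> 'v cochain"
  where "hom_delta scale br \<alpha> m P = (\<lambda>xs.
    if length xs = m + 1 then
      (\<Sum>i<m + 1. scale ((- 1) ^ i) (br ((\<alpha> ^^ (m - 1)) (xs ! i)) (P (nths xs (- {i}))))) +
      (\<Sum>j<m + 1. \<Sum>i<j. scale ((- 1) ^ (i + j))
        (P (br (xs ! i) (xs ! j) # map \<alpha> (nths xs (- {i, j})))))
    else 0)"

definition FN ::
    "('k::field_char_0 \<Rightarrow> 'v::ab_group_add \<Rightarrow> 'v) \<Rightarrow> ('v \<Rightarrow> 'v \<Rightarrow> 'v) \<Rightarrow> ('v \<Rightarrow> 'v) \<Rightarrow>
     nat \<Rightarrow> nat \<Rightarrow> 'v cochain \<Rightarrow> 'v cochain \<Rightarrow> 'v cochain"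
  where "FN scale br \<alpha> m n P Q =
    cup scale br \<alpha> m n P Q
    + cscale scale ((- 1) ^ m) (ins scale \<alpha> (m + 1) n (hom_delta scale br \<alpha> m P) Q)
    - cscale scale ((- 1) ^ ((m + 1) * n)) (ins scale \<alpha> (n + 1) m (hom_delta scale br \<alpha> n Q) P)"

text \<open>
  Bilinear extension to finite sums of cochains of an operation given for each pair of arities.
\<close>

definition arity_part :: "nat \<Rightarrow> 'v::ab_group_add cochain \<Rightarrow> 'v cochain"
  where "arity_part n P = (\<lambda>xs. if length xs = n then P xs else 0)"

definition bilin_ext ::
    "(nat \<Rightarrow> nat \<Rightarrow> 'v::ab_group_add cochain \<Rightarrow> 'v cochain \<Rightarrow> 'v cochain) \<Rightarrow>
     'v cochain \<Rightarrow> 'v cochain \<Rightarrow> 'v cochain"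
  where "bilin_ext f P Q =
    (\<Sum>m | arity_part m P \<noteq> 0. \<Sum>n | arity_part n Q \<noteq> 0.
       f m n (arity_part m P) (arity_part n Q))"

end

theory Submission
  imports Defs
begin

text \<open>
Write \<open>i\<^sub>P\<close> for the insertion of a cochain \<open>P\<close>, \<open>[E, F]\<^sub>C\<close> for the cup product, \<open>\<mu>\<close> for the bracket of the
Hom-Lie algebra seen as a 2-cochain, and \<open>e\<close> for the identity map seen as a 1-cochain.

The reason for the theorem is a semidirect product.  The Nijenhuis-Richardson algebra acts on the cup
product algebra by the derivations \<open>i\<^sub>P\<close>, so that the pairs \<open>(E, P)\<close> form a graded Lie algebra with
bracket \<open>([E, F]\<^sub>C + i\<^sub>P F \<mp> i\<^sub>Q E, [P, Q]\<^sub>N\<^sub>R)\<close>.  For \<open>E\<close> of degree \<open>m\<close> put \<open>\<theta> E = (- 1)\<^sup>m \<delta> E\<close>.  The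
first component of the bracket of \<open>(E, \<theta> E)\<close> and \<open>(F, \<theta> F)\<close> is exactly \<open>[E, F]\<^sub>F\<^sub>N\<close>.  Hence, if the graph of
\<open>\<theta>\<close> is closed under the bracket, it is a copy of the Froelicher-Nijenhuis algebra, and the semidirect product is
the direct sum of this subalgebra and of the Nijenhuis-Richardson algebra \<open>{(0, P)}\<close>.  Two complementary
subalgebras always form a matched pair; the actions are read off from the mixed brackets
\<open>[(0, P), (E, \<theta> E)] = (i\<^sub>P E, \<theta> (i\<^sub>P E)) + (0, [P, \<theta> E]\<^sub>N\<^sub>R - \<theta> (i\<^sub>P E))\<close>.
So the theorem rests on two identities: \<open>theta_fn\<close> (the graph is closed) and \<open>nr_theta\<close> (the second
summand of the mixed bracket is \<open>\<mp> [E, P]\<^sub>F\<^sub>N\<close>).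

Both identities, and from them all axioms, follow formally from a few facts, which are collected in the
locale \<open>cup_insertion_algebra\<close>: the cup product is a graded Lie bracket, \<open>i\<^sub>P\<close> is a derivation of it,
\<open>i\<close> represents the commutator \<open>i\<^sub>P Q \<mp> i\<^sub>Q P\<close>, \<open>i\<^sub>P e = P\<close>, and \<open>[e, e]\<^sub>C = 2 \<mu>\<close>.  The differential is then
\<open>\<delta> = [e, -]\<^sub>C - i\<^sub>\<mu>\<close>, a sum of two derivations of the cup product, and \<open>\<delta>\<^sup>2 = 0\<close>.

The facts in the locale are identities between sums over shuffles.  A sum over shuffles splits according
to the block to which the first argument goes, which gives a Leibniz rule for the contraction with the first
argument.  Both sides of each identity obey the same Leibniz rule, so the identity follows by induction on the
argument list.  For the empty list it is evident, or it is the skew-symmetry or the Hom-Jacobi identity of the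
Hom-Lie bracket.  In these inductions only the parities of the cochains matter, and in the identities for
insertions the powers of \<open>\<alpha>\<close>, which depend on the arities, are replaced by arbitrary linear maps.
\<close>

section \<open>Signed sums over splittings of a list\<close>

text \<open>
The Koszul sign \<open>(- 1)\<^sup>k\<close> acting on an arbitrary abelian group.  Splitting on the parity of \<open>k\<close> turns every
identity with signs into one of sums and differences.
\<close>

definition sg :: "nat \<Rightarrow> 'a::ab_group_add \<Rightarrow> 'a"
  where "sg k v = (if even k then v else - v)"

lemma sg_apply: "sg k P xs = sg k (P xs)"
  by (simp add: sg_def)

lemma sg_zero [simp]: "sg k 0 = 0" "sg k v = 0 \<longleftrightarrow> v = 0"
  by (simp_all add: sg_def)

text \<open>
The sum runs over all ways of splitting a list into two subsequences, with the sign of the shuffle that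
puts the first one in front.  An element that joins the second part passes all later elements of the
first part, whence the sign in the second equation.
\<close>

fun shuffle_sum :: "('v list \<Rightarrow> 'v list \<Rightarrow> 'w::ab_group_add) \<Rightarrow> 'v list \<Rightarrow> 'w" where
  "shuffle_sum F [] = F [] []"
| "shuffle_sum F (x # xs) = shuffle_sum (\<lambda>ys zs. F (x # ys) zs) xs
     + shuffle_sum (\<lambda>ys zs. sg (length ys) (F ys (x # zs))) xs"

lemma shuffle_sum_cong:
  assumes "\<And>ys zs. length ys + length zs = length xs \<Longrightarrow> F ys zs = G ys zs"
  shows "shuffle_sum F xs = shuffle_sum G xs"
  using assms
proof (induction xs arbitrary: F G)
  case (Cons x xs)
  have "shuffle_sum (\<lambda>ys zs. F (x # ys) zs) xs = shuffle_sum (\<lambda>ys zs. G (x # ys) zs) xs"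
    by (rule Cons.IH) (simp add: Cons.prems)
  moreover have "shuffle_sum (\<lambda>ys zs. sg (length ys) (F ys (x # zs))) xs
      = shuffle_sum (\<lambda>ys zs. sg (length ys) (G ys (x # zs))) xs"
    by (rule Cons.IH) (simp add: Cons.prems)
  ultimately show ?case by simp
qed simp

lemma shuffle_sum_add:
  "shuffle_sum (\<lambda>ys zs. F ys zs + G ys zs) xs = shuffle_sum F xs + shuffle_sum G xs"
proof (induction xs arbitrary: F G)
  case (Cons x xs)
  have "(\<lambda>ys zs. sg (length ys) (F ys (x # zs) + G ys (x # zs))) =
    (\<lambda>ys zs. sg (length ys) (F ys (x # zs)) + sg (length ys) (G ys (x # zs)))"
    by (auto simp: sg_def fun_eq_iff)
  then show ?case by (simp add: Cons.IH)
qed simp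

lemma shuffle_sum_map:
  "shuffle_sum F (map g xs) = shuffle_sum (\<lambda>ys zs. F (map g ys) (map g zs)) xs"
  by (induction xs arbitrary: F) simp_all

lemma additive_0:
  fixes h :: "'a::ab_group_add \<Rightarrow> 'b::ab_group_add"
  assumes "\<And>a b. h (a + b) = h a + h b" shows "h 0 = 0"
  using assms[of 0 0] by simp

lemma additive_uminus:
  fixes h :: "'a::ab_group_add \<Rightarrow> 'b::ab_group_add"
  assumes "\<And>a b. h (a + b) = h a + h b" shows "h (- a) = - h a"
  using assms[of a "- a"] additive_0[of h] assms by (metis add.right_inverse minus_unique)

lemma additive_shuffle_sum:
  fixes h :: "'a::ab_group_add \<Rightarrow> 'b::ab_group_add"
  assumes "\<And>a b. h (a + b) = h a + h b"
  shows "h (shuffle_sum F xs) = shuffle_sum (\<lambda>ys zs. h (F ys zs)) xs"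
proof (induction xs arbitrary: F)
  case (Cons x xs)
  have "h (sg k v) = sg k (h v)" for k v
    by (simp add: sg_def additive_uminus[of h, OF assms])
  then show ?case by (simp add: assms Cons.IH)
qed simp

lemma shuffle_sum_uminus: "shuffle_sum (\<lambda>ys zs. - F ys zs) xs = - shuffle_sum F xs"
  by (rule additive_shuffle_sum[symmetric]) simp

lemma shuffle_sum_sg: "shuffle_sum (\<lambda>ys zs. sg k (F ys zs)) xs = sg k (shuffle_sum F xs)"
  by (simp add: sg_def shuffle_sum_uminus)

lemma shuffle_sum_zero: "shuffle_sum (\<lambda>ys zs. 0) xs = 0"
  by (induction xs) simp_all

section \<open>Shuffles as permutations\<close>

text \<open>
The embedding of permutations of \<open>{..<n}\<close> into permutations of \<open>{..<Suc n}\<close> that fix 0, given by the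
shift by one.
\<close>

definition lift_perm :: "(nat \<Rightarrow> nat) \<Rightarrow> nat \<Rightarrow> nat"
  where "lift_perm \<tau> i = (case i of 0 \<Rightarrow> 0 | Suc j \<Rightarrow> Suc (\<tau> j))"

text \<open>
A shuffle that maps position \<open>m\<close> to 0 is a lifted shuffle after this cycle, which contributes the
sign \<open>(- 1)\<^sup>m\<close>.
\<close>

definition cycle_to_front :: "nat \<Rightarrow> nat \<Rightarrow> nat"
  where "cycle_to_front m i = (if i < m then Suc i else if i = m then 0 else i)"

lemma lift_perm_simps [simp]: "lift_perm \<tau> 0 = 0" "lift_perm \<tau> (Suc i) = Suc (\<tau> i)"
  by (simp_all add: lift_perm_def)

lemma lift_perm_comp: "lift_perm (\<sigma> \<circ> \<tau>) = lift_perm \<sigma> \<circ> lift_perm \<tau>"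
  by (auto simp: fun_eq_iff lift_perm_def split: nat.splits)

lemma lift_perm_id: "lift_perm id = id"
  by (auto simp: fun_eq_iff lift_perm_def split: nat.splits)

lemma lift_perm_transpose: "lift_perm (transpose a b) = transpose (Suc a) (Suc b)"
  by (auto simp: fun_eq_iff lift_perm_def transpose_def split: nat.splits)

lemma lift_perm_permutes_sign:
  assumes "\<tau> permutes {..<n}"
  shows "lift_perm \<tau> permutes {..<Suc n} \<and> sign (lift_perm \<tau>) = sign \<tau>"
  using assms finite_lessThan
proof (induction rule: permutes_induct)
  case id
  then show ?case by (simp only: lift_perm_id permutes_id)
next
  case (swap a b \<tau>)
  have t: "transpose (Suc a) (Suc b) permutes {..<Suc n}"
    using swap by (intro permutes_swap_id) auto
  have t': "transpose a b permutes {..<n}"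
    using swap by (intro permutes_swap_id) auto
  have p: "permutation \<tau>" "permutation (lift_perm \<tau>)"
    using swap by (auto simp: permutation_permutes)
  show ?case
  proof
    show "lift_perm (transpose a b \<circ> \<tau>) permutes {..<Suc n}"
      unfolding lift_perm_comp lift_perm_transpose using swap t by (blast intro: permutes_compose)
    show "sign (lift_perm (transpose a b \<circ> \<tau>)) = sign (transpose a b \<circ> \<tau>)"
      unfolding lift_perm_comp lift_perm_transpose sign_compose[OF permutation_swap_id p(1)]
        sign_compose[OF permutation_swap_id p(2)] sign_swap_id using swap by simp
  qed
qed

lemma cycle_to_front_permutes_sign:
  assumes "m < n"
  shows "cycle_to_front m permutes {..<n} \<and> sign (cycle_to_front m) = (-1) ^ m"
  using assms
proof (induction m)
  case 0
  have "cycle_to_front 0 = id" by (auto simp: cycle_to_front_def fun_eq_iff)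
  then show ?case by (simp only: permutes_id sign_id power_0)
next
  case (Suc m)
  have e: "cycle_to_front (Suc m) = cycle_to_front m \<circ> transpose m (Suc m)"
    by (auto simp: cycle_to_front_def fun_eq_iff transpose_def)
  have t: "transpose m (Suc m) permutes {..<n}"
    using Suc.prems by (intro permutes_swap_id) auto
  have p: "permutation (cycle_to_front m)"
    using Suc by (auto simp: permutation_permutes)
  show ?case
  proof
    show "cycle_to_front (Suc m) permutes {..<n}"
      unfolding e using Suc t by (simp only: permutes_compose Suc_lessD)
    show "sign (cycle_to_front (Suc m)) = (- 1) ^ Suc m"
      unfolding e sign_compose[OF p permutation_swap_id] sign_swap_id using Suc by simp
  qed
qed

lemma permutes_fixing_0:
  assumes "\<pi> permutes {..<Suc n}" "\<pi> 0 = 0"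
  obtains \<tau> where "\<tau> permutes {..<n}" "\<pi> = lift_perm \<tau>"
proof -
  define \<tau> where "\<tau> i = \<pi> (Suc i) - 1" for i
  have nz: "\<pi> (Suc i) \<noteq> 0" for i
    using permutes_inj[OF assms(1)] assms(2) by (metis injD nat.distinct(1))
  have l: "\<pi> = lift_perm \<tau>"
    using nz assms(2) by (auto simp: fun_eq_iff lift_perm_def \<tau>_def split: nat.splits)
  have "\<tau> permutes {..<n}"
  proof (rule bij_imp_permutes)
    show "bij_betw \<tau> {..<n} {..<n}"
    proof -
      have "inj_on \<tau> {..<n}"
      proof (rule inj_onI)
        fix i j assume "\<tau> i = \<tau> j"
        then have "\<pi> (Suc i) = \<pi> (Suc j)"
          using nz[of i] nz[of j] unfolding \<tau>_def by arith
        then show "i = j" using injD[OF permutes_inj[OF assms(1)]] by blast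
      qed
      moreover have "\<tau> ` {..<n} \<subseteq> {..<n}"
      proof
        fix y assume "y \<in> \<tau> ` {..<n}"
        then obtain i where i: "i < n" "y = \<tau> i" by auto
        have "\<pi> (Suc i) < Suc n" using permutes_in_image[OF assms(1), of "Suc i"] i by simp
        then show "y \<in> {..<n}" using i nz[of i] by (simp add: \<tau>_def)
      qed
      ultimately show ?thesis
        by (simp add: bij_betw_def endo_inj_surj)
    qed
    show "\<tau> i = i" if "i \<notin> {..<n}" for i
      using permutes_not_in[OF assms(1), of "Suc i"] that by (simp add: \<tau>_def)
  qed
  then show thesis using that l by blast
qed

lemma lift_perm_inj: "lift_perm \<sigma> = lift_perm \<tau> \<Longrightarrow> \<sigma> = \<tau>"
  by (metis ext lift_perm_simps(2) nat.inject)

lemma cycle_to_front_comp_lift: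
  "(lift_perm \<tau> \<circ> cycle_to_front m) i = (if i < m then Suc (\<tau> i) else if i
      = m then 0 else Suc (\<tau> (i - 1)))"
  by (cases i) (auto simp: cycle_to_front_def)

lemma Sh_first:
  "{\<sigma> \<in> Sh (Suc m) n. \<sigma> 0 = 0} = lift_perm ` Sh m n"
proof (intro equalityI subsetI)
  fix \<sigma> assume "\<sigma> \<in> {\<sigma> \<in> Sh (Suc m) n. \<sigma> 0 = 0}"
  then have s: "\<sigma> permutes {..<Suc (m + n)}" "\<sigma> 0 = 0"
     "strict_mono_on {..<Suc m} \<sigma>" "strict_mono_on {Suc m..<Suc m + n} \<sigma>" by (simp_all add: Sh_def)
  then obtain \<tau> where t: "\<tau> permutes {..<m + n}" "\<sigma> = lift_perm \<tau>"
    using permutes_fixing_0 by blast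
  have "strict_mono_on {..<m} \<tau>"
    using strict_mono_onD[OF s(3), of "Suc _" "Suc _"] by (auto simp: t(2) strict_mono_on_def)
  moreover have "strict_mono_on {m..<m + n} \<tau>"
    using strict_mono_onD[OF s(4), of "Suc _" "Suc _"] by (auto simp: t(2) strict_mono_on_def)
  ultimately show "\<sigma> \<in> lift_perm ` Sh m n" using t by (auto simp: Sh_def)
next
  fix \<sigma> assume "\<sigma> \<in> lift_perm ` Sh m n"
  then obtain \<tau> where t: "\<tau> permutes {..<m + n}" "\<sigma> = lift_perm \<tau>"
    "strict_mono_on {..<m} \<tau>" "strict_mono_on {m..<m + n} \<tau>" by (auto simp: Sh_def)
  have "strict_mono_on {..<Suc m} (lift_perm \<tau>)"
  proof (rule strict_mono_onI)
    fix i j assume "i \<in> {..<Suc m}" "j \<in> {..<Suc m}" "i < j"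
    then show "lift_perm \<tau> i < lift_perm \<tau> j"
      using strict_mono_onD[OF t(3), of "i - 1" "j - 1"] by (cases i; cases j) auto
  qed
  moreover have "strict_mono_on {Suc m..<Suc m + n} (lift_perm \<tau>)"
  proof (rule strict_mono_onI)
    fix i j assume "i \<in> {Suc m..<Suc m + n}" "j \<in> {Suc m..<Suc m + n}" "i < j"
    then show "lift_perm \<tau> i < lift_perm \<tau> j"
      using strict_mono_onD[OF t(4), of "i - 1" "j - 1"] by (cases i; cases j) auto
  qed
  ultimately show "\<sigma> \<in> {\<sigma> \<in> Sh (Suc m) n. \<sigma> 0 = 0}"
    using t lift_perm_permutes_sign[OF t(1)] by (simp add: Sh_def)
qed

lemma Sh_second:
  "{\<sigma> \<in> Sh m (Suc n). \<sigma> m = 0} = (\<lambda>\<tau>. lift_perm \<tau> \<circ> cycle_to_front m) ` Sh m n"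
proof (intro equalityI subsetI)
  fix \<sigma> assume "\<sigma> \<in> {\<sigma> \<in> Sh m (Suc n). \<sigma> m = 0}"
  then have s: "\<sigma> permutes {..<Suc (m + n)}" "\<sigma> m = 0"
     "strict_mono_on {..<m} \<sigma>" "strict_mono_on {m..<m + Suc n} \<sigma>" by (simp_all add: Sh_def)
  have c: "cycle_to_front m permutes {..<Suc (m + n)}"
    using cycle_to_front_permutes_sign[of m "Suc (m + n)"] by simp
  \<comment> \<open>undoing the cycle leaves a permutation that fixes 0\<close>
  have "inv (cycle_to_front m) 0 = m"
    using permutes_inverses(2)[OF c, of m] by (simp add: cycle_to_front_def)
  then obtain \<tau> where t: "\<tau> permutes {..<m + n}" "\<sigma> \<circ> inv (cycle_to_front m) = lift_perm \<tau>"
    using permutes_fixing_0[OF permutes_compose[OF permutes_inv[OF c] s(1)]] s(2) by auto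
  have \<sigma>: "\<sigma> = lift_perm \<tau> \<circ> cycle_to_front m"
    unfolding t(2)[symmetric] using permutes_inverses(2)[OF c] by (auto simp: fun_eq_iff)
  have "strict_mono_on {..<m} \<tau>"
  proof (rule strict_mono_onI)
    fix i j assume "i \<in> {..<m}" "j \<in> {..<m}" "i < j"
    then show "\<tau> i < \<tau> j"
      using strict_mono_onD[OF s(3), of i j] unfolding \<sigma> cycle_to_front_comp_lift by auto
  qed
  moreover have "strict_mono_on {m..<m + n} \<tau>"
  proof (rule strict_mono_onI)
    fix i j assume "i \<in> {m..<m + n}" "j \<in> {m..<m + n}" "i < j"
    then show "\<tau> i < \<tau> j"
      using strict_mono_onD[OF s(4), of "Suc i" "Suc j"] unfolding \<sigma> cycle_to_front_comp_lift
          by auto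
  qed
  ultimately show "\<sigma> \<in> (\<lambda>\<tau>. lift_perm \<tau> \<circ> cycle_to_front m) ` Sh m n"
    using t \<sigma> by (auto simp: Sh_def)
next
  fix \<sigma> assume "\<sigma> \<in> (\<lambda>\<tau>. lift_perm \<tau> \<circ> cycle_to_front m) ` Sh m n"
  then obtain \<tau> where t: "\<tau> permutes {..<m + n}" "\<sigma> = lift_perm \<tau> \<circ> cycle_to_front m"
    "strict_mono_on {..<m} \<tau>" "strict_mono_on {m..<m + n} \<tau>" by (auto simp: Sh_def)
  have "strict_mono_on {..<m} \<sigma>"
  proof (rule strict_mono_onI)
    fix i j assume "i \<in> {..<m}" "j \<in> {..<m}" "i < j"
    then show "\<sigma> i < \<sigma> j"
      using strict_mono_onD[OF t(3), of i j] unfolding t(2) cycle_to_front_comp_lift by auto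
  qed
  moreover have "strict_mono_on {m..<m + Suc n} \<sigma>"
  proof (rule strict_mono_onI)
    fix i j assume "i \<in> {m..<m + Suc n}" "j \<in> {m..<m + Suc n}" "i < j"
    then show "\<sigma> i < \<sigma> j"
      using strict_mono_onD[OF t(4), of "i - 1" "j - 1"] unfolding t(2) cycle_to_front_comp_lift
          by auto
  qed
  moreover have "\<sigma> permutes {..<m + Suc n}"
    using t(2) lift_perm_permutes_sign[OF t(1)] cycle_to_front_permutes_sign[of m "Suc (m + n)"]
    by (auto intro: permutes_compose)
  moreover have "\<sigma> m = 0" by (simp add: t(2) cycle_to_front_def)
  ultimately show "\<sigma> \<in> {\<sigma> \<in> Sh m (Suc n). \<sigma> m = 0}"
    by (simp add: Sh_def)
qed

lemma finite_Sh: "finite (Sh m n)"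
  by (rule finite_subset[OF _ finite_permutations[of "{..<m + n}"]]) (auto simp: Sh_def)

text \<open>
A shuffle is increasing on both blocks, so that the position mapped to 0 is the beginning of one of them.
\<close>

lemma Sh_split:
  assumes "m + n > 0"
  shows "Sh m n = {\<sigma> \<in> Sh m n. 0 < m \<and> \<sigma> 0 = 0} \<union> {\<sigma> \<in> Sh m n. 0 < n \<and> \<sigma> m = 0}"
proof -
  have "(0 < m \<and> \<sigma> 0 = 0) \<or> (0 < n \<and> \<sigma> m = 0)" if s: "\<sigma> \<in> Sh m n" for \<sigma>
  proof -
    have "\<sigma> permutes {..<m + n}" using s by (simp add: Sh_def)
    then have "0 \<in> \<sigma> ` {..<m + n}" using assms by (simp add: permutes_image)
    then obtain k where k: "k < m + n" "\<sigma> k = 0" by auto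
    show ?thesis
    proof (cases "k < m")
      case True
      have "\<not> 0 < k"
        using s strict_mono_onD[of "{..<m}" \<sigma> 0 k] True k by (auto simp: Sh_def)
      then show ?thesis using True k by auto
    next
      case False
      have "\<sigma> m < \<sigma> k" if "m < k"
        using s strict_mono_onD[of "{m..<m + n}" \<sigma> m k] that k by (auto simp: Sh_def)
      then have "k = m" using False k by (cases "m < k") auto
      then show ?thesis using k by auto
    qed
  qed
  then show ?thesis by blast
qed

text \<open>
The recursion of \<^const>\<open>shuffle_sum\<close> is the splitting of the shuffles according to the block that
receives the first argument.
\<close>

lemma sum_Sh_eq_shuffle_sum:
  fixes F :: "'v list \<Rightarrow> 'v list \<Rightarrow> 'w::ab_group_add"
  assumes "length xs = m + n"
  shows "(\<Sum>\<sigma>\<in>Sh m n. (if sign \<sigma> = 1 then id else uminus)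
      (F (map (\<lambda>i. xs ! \<sigma> i) [0..<m]) (map (\<lambda>i. xs ! \<sigma> i) [m..<m + n]))) =
    shuffle_sum (\<lambda>ys zs. if length ys = m then F ys zs else 0) xs"
  using assms
proof (induction xs arbitrary: m n F)
  case Nil
  have "Sh 0 0 = {id}" by (auto simp: Sh_def strict_mono_on_def permutes_id)
  then show ?case using Nil by simp
next
  case (Cons x xs)
  define T where "T \<sigma> = (if sign \<sigma> = 1 then id else uminus)
      (F (map (\<lambda>i. (x # xs) ! \<sigma> i) [0..<m]) (map (\<lambda>i. (x # xs) ! \<sigma> i) [m..<m + n]))" for \<sigma>
  have "(\<Sum>\<sigma>\<in>Sh m n. T \<sigma>) = (\<Sum>\<sigma> | \<sigma> \<in> Sh m n \<and> 0 < m \<and> \<sigma> 0 = 0. T \<sigma>)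
      + (\<Sum>\<sigma> | \<sigma> \<in> Sh m n \<and> 0 < n \<and> \<sigma> m = 0. T \<sigma>)"
  proof (subst Sh_split)
    show "0 < m + n" using Cons.prems by auto
    have "\<not> (\<sigma> 0 = 0 \<and> \<sigma> m = 0)" if "\<sigma> \<in> Sh m n" "0 < m" for \<sigma>
      using that permutes_inj[of \<sigma> "{..<m + n}"] injD[of \<sigma> 0 m]
      by (cases "\<sigma> 0 = 0") (auto simp: Sh_def)
    then have "{\<sigma> \<in> Sh m n. 0 < m \<and> \<sigma> 0 = 0} \<inter> {\<sigma> \<in> Sh m n. 0 < n \<and> \<sigma> m = 0} = {}"
      by blast
    then show "sum T ({\<sigma> \<in> Sh m n. 0 < m \<and> \<sigma> 0 = 0} \<union> {\<sigma> \<in> Sh m n. 0 < n \<and> \<sigma> m = 0}) =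
        sum T {\<sigma> \<in> Sh m n. 0 < m \<and> \<sigma> 0 = 0} + sum T {\<sigma> \<in> Sh m n. 0 < n \<and> \<sigma> m = 0}"
      by (intro sum.union_disjoint) (use finite_Sh[of m n] in auto)
  qed
  also have "(\<Sum>\<sigma> | \<sigma> \<in> Sh m n \<and> 0 < m \<and> \<sigma> 0 = 0. T \<sigma>) =
      shuffle_sum (\<lambda>ys zs. if length (x # ys) = m then F (x # ys) zs else 0) xs"
  proof (cases m)
    case (Suc k)
    have "(\<Sum>\<sigma> | \<sigma> \<in> Sh m n \<and> 0 < m \<and> \<sigma> 0 = 0. T \<sigma>) = (\<Sum>\<tau>\<in>Sh k n. T (lift_perm \<tau>))"
      using Sh_first[of k n] Suc
      by (simp add: sum.reindex inj_on_def lift_perm_inj)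
    also have "\<dots> = (\<Sum>\<tau>\<in>Sh k n. (if sign \<tau> = 1 then id else uminus)
        (F (x # map (\<lambda>i. xs ! \<tau> i) [0..<k]) (map (\<lambda>i. xs ! \<tau> i) [k..<k + n])))"
    proof (rule sum.cong)
      fix \<tau> assume "\<tau> \<in> Sh k n"
      then have s: "sign (lift_perm \<tau>) = sign \<tau>"
        using lift_perm_permutes_sign[of \<tau> "k + n"] by (simp add: Sh_def)
      have 1: "map (\<lambda>i. (x # xs) ! lift_perm \<tau> i) [0..<m] = x # map (\<lambda>i. xs ! \<tau> i) [0..<k]"
        by (simp add: Suc upt_conv_Cons map_Suc_upt[symmetric] del: upt_Suc map_Suc_upt)
      have 2: "map (\<lambda>i. (x # xs) ! lift_perm \<tau> i) [m..<m + n] = map (\<lambda>i. xs ! \<tau> i) [k..<k + n]"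
        by (simp add: Suc map_Suc_upt[symmetric] del: upt_Suc map_Suc_upt)
      show "T (lift_perm \<tau>) = (if sign \<tau> = 1 then id else uminus)
        (F (x # map (\<lambda>i. xs ! \<tau> i) [0..<k]) (map (\<lambda>i. xs ! \<tau> i) [k..<k + n]))"
        unfolding T_def 1 2 s ..
    qed simp
    also have "\<dots> = shuffle_sum (\<lambda>ys zs. if length ys = k then F (x # ys) zs else 0) xs"
      using Cons.IH[of k n "\<lambda>ys. F (x # ys)"] Cons.prems Suc by simp
    finally show ?thesis by (simp add: Suc)
  qed (simp add: shuffle_sum_zero)
  also have "(\<Sum>\<sigma> | \<sigma> \<in> Sh m n \<and> 0 < n \<and> \<sigma> m = 0. T \<sigma>) =
      shuffle_sum (\<lambda>ys zs. sg (length ys) (if length ys = m then F ys (x # zs) else 0)) xs"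
  proof (cases n)
    case 0
    have "length xs < m" using 0 Cons.prems by auto
    then have "shuffle_sum (\<lambda>ys zs. sg (length ys) (if length ys = m then F ys (x # zs) else 0)) xs
      = shuffle_sum (\<lambda>ys zs. 0) xs"
      by (intro shuffle_sum_cong) auto
    then show ?thesis by (simp add: 0 shuffle_sum_zero)
  next
    case (Suc k)
    have inj: "inj_on (\<lambda>\<tau>. lift_perm \<tau> \<circ> cycle_to_front m) (Sh m k)"
    proof (rule inj_onI)
      fix \<sigma> \<tau> assume eq: "lift_perm \<sigma> \<circ> cycle_to_front m = lift_perm \<tau> \<circ> cycle_to_front m"
      have "surj (cycle_to_front m)"
        using cycle_to_front_permutes_sign[of m "Suc m"] permutes_surj by blast
      then have "lift_perm \<sigma> i = lift_perm \<tau> i" for i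
        using fun_cong[OF eq] by (metis comp_apply surjD)
      then have "lift_perm \<sigma> = lift_perm \<tau>" ..
      then show "\<sigma> = \<tau>" by (rule lift_perm_inj)
    qed
    have "(\<Sum>\<sigma> | \<sigma> \<in> Sh m n \<and> 0 < n \<and> \<sigma> m = 0. T \<sigma>) = (\<Sum>\<tau>\<in>Sh m k. T (lift_perm \<tau> \<circ> cycle_to_front
        m))"
      using Sh_second[of m k] Suc inj by (simp add: sum.reindex)
    also have "\<dots> = (\<Sum>\<tau>\<in>Sh m k. (if sign \<tau> = 1 then id else uminus)
        (sg m (F (map (\<lambda>i. xs ! \<tau> i) [0..<m]) (x # map (\<lambda>i. xs ! \<tau> i) [m..<m + k]))))"
    proof (rule sum.cong)
      fix \<tau> assume "\<tau> \<in> Sh m k"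
      then have l: "lift_perm \<tau> permutes {..<Suc (m + k)}" "sign (lift_perm \<tau>) = sign \<tau>"
        using lift_perm_permutes_sign[of \<tau> "m + k"] by (simp_all add: Sh_def)
      have c: "cycle_to_front m permutes {..<Suc m}" "sign (cycle_to_front m) = (-1) ^ m"
        using cycle_to_front_permutes_sign[of m "Suc m"] by simp_all
      have s: "sign (lift_perm \<tau> \<circ> cycle_to_front m) = sign \<tau> * (-1) ^ m"
        using l c by (subst sign_compose) (auto simp: permutation_permutes)
      have 1: "map (\<lambda>i. (x # xs) ! (lift_perm \<tau> \<circ> cycle_to_front m) i) [0..<m]
          = map (\<lambda>i. xs ! \<tau> i) [0..<m]"
        by (simp add: cycle_to_front_def)
      have "map (\<lambda>i. (x # xs) ! (lift_perm \<tau> \<circ> cycle_to_front m) i) [m..<m + n] =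
          x # map (\<lambda>i. (x # xs) ! (lift_perm \<tau> \<circ> cycle_to_front m) i) (map Suc [m..<m + k])"
        unfolding map_Suc_upt by (simp add: Suc upt_conv_Cons cycle_to_front_def del: upt_Suc)
      also have "\<dots> = x # map (\<lambda>i. xs ! \<tau> i) [m..<m + k]"
        by (simp add: cycle_to_front_def del: map_Suc_upt)
      finally have 2: "map (\<lambda>i. (x # xs) ! (lift_perm \<tau> \<circ> cycle_to_front m) i) [m..<m + n] =
          x # map (\<lambda>i. xs ! \<tau> i) [m..<m + k]" .
      show "T (lift_perm \<tau> \<circ> cycle_to_front m) = (if sign \<tau> = 1 then id else uminus)
        (sg m (F (map (\<lambda>i. xs ! \<tau> i) [0..<m]) (x # map (\<lambda>i. xs ! \<tau> i) [m..<m + k])))"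
        unfolding T_def 1 2 s by (cases \<tau> rule: sign_cases) (auto simp: sg_def)
    qed simp
    also have "\<dots> = shuffle_sum (\<lambda>ys zs. if length ys = m then sg m (F ys (x # zs)) else 0) xs"
      using Cons.IH[of m k "\<lambda>ys zs. sg m (F ys (x # zs))"] Cons.prems Suc by simp
    also have "\<dots> = shuffle_sum (\<lambda>ys zs. sg (length ys) (if length ys
        = m then F ys (x # zs) else 0)) xs"
      by (intro shuffle_sum_cong) auto
    finally show ?thesis .
  qed
  finally show ?case by (simp add: T_def)
qed

section \<open>Contraction and insertion\<close>

definition contract :: "'v \<Rightarrow> ('v list \<Rightarrow> 'w) \<Rightarrow> 'v list \<Rightarrow> 'w"
  where "contract x P = (\<lambda>xs. P (x # xs))"

text \<open>
The grading involution.  It replaces the sign \<open>(- 1)\<^sup>m\<close> in Leibniz rules for functions that are not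
homogeneous.
\<close>

definition twist :: "('v list \<Rightarrow> 'w::ab_group_add) \<Rightarrow> 'v list \<Rightarrow> 'w"
  where "twist P = (\<lambda>xs. sg (length xs) (P xs))"

text \<open>
Contraction shifts the parity by one in all cases, whereas it lowers an arity only if this is positive.
Keeping track of parities alone spares the inductions below a separate treatment of arity 0.
\<close>

definition has_parity :: "nat \<Rightarrow> ('v list \<Rightarrow> 'w::ab_group_add) \<Rightarrow> bool"
  where "has_parity p P \<longleftrightarrow> (\<forall>xs. P xs \<noteq> 0 \<longrightarrow> (even (length xs) \<longleftrightarrow> even p))"

text \<open>
For \<open>P\<close> of arity \<open>m\<close> and \<open>f = \<alpha>\<^bsup>m - 1\<^esup>\<close> this is \<open>i\<^sub>P Q\<close>.
\<close>

definition insert_sum :: "('v \<Rightarrow> 'v) \<Rightarrow> ('v list \<Rightarrow> 'v) \<Rightarrow> ('v list \<Rightarrow> 'w::ab_group_add) \<Rightarrow> 'v list \<Rightarrow> 'w"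
  where "insert_sum f P Q = shuffle_sum (\<lambda>ys zs. Q (P ys # map f zs))"

lemma twist_parity: "has_parity p P \<Longrightarrow> twist P = sg p P"
  unfolding twist_def has_parity_def fun_eq_iff sg_apply
  by (metis sg_def sg_zero(2))

lemma contract_parity: "has_parity p P \<Longrightarrow> has_parity (Suc p) (contract x P)"
  by (auto simp: has_parity_def contract_def)

lemma parity_comp:
  assumes "has_parity p P" "h 0 = 0" shows "has_parity p (h \<circ> P)"
  unfolding has_parity_def
proof (intro allI impI)
  fix xs assume "(h \<circ> P) xs \<noteq> 0"
  then have "P xs \<noteq> 0" using assms(2) by auto
  then show "even (length xs) \<longleftrightarrow> even p" using assms(1) by (simp add: has_parity_def)
qed

lemma parity_map:
  assumes "has_parity p P" shows "has_parity p (P \<circ> map f)"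
  unfolding has_parity_def
proof (intro allI impI)
  fix xs assume "(P \<circ> map f) xs \<noteq> 0"
  then have "even (length (map f xs)) \<longleftrightarrow> even p"
    using assms unfolding has_parity_def comp_apply by blast
  then show "even (length xs) \<longleftrightarrow> even p" by simp
qed

lemma parity_Nil: "has_parity p P \<Longrightarrow> odd p \<Longrightarrow> P [] = 0"
  by (force simp: has_parity_def)

lemma insert_sum_add_right: "insert_sum f P (Q + R) = insert_sum f P Q + insert_sum f P R"
  by (simp add: insert_sum_def fun_eq_iff shuffle_sum_add)

lemma insert_sum_uminus_right: "insert_sum f P (- Q) = - insert_sum f P Q"
  by (simp add: insert_sum_def fun_eq_iff shuffle_sum_uminus)

lemma insert_sum_diff_right: "insert_sum f P (Q - R) = insert_sum f P Q - insert_sum f P R"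
  using insert_sum_add_right[of f P Q "- R"] by (simp add: insert_sum_uminus_right)

lemma insert_sum_sg_right: "insert_sum f P (sg k Q) = sg k (insert_sum f P Q)"
  by (simp add: sg_def insert_sum_uminus_right)

lemma contract_twist: "contract x (twist P) = - twist (contract x P)"
  and contract_comp: "contract x (g \<circ> P) = g \<circ> contract x P"
  and contract_map: "contract x (P \<circ> map f) = contract (f x) P \<circ> map f"
  by (auto simp: contract_def twist_def sg_def fun_eq_iff)

context hom_lie_algebra
begin

text \<open>
Multilinear and skew-symmetric under exchange of neighbours, without reference to an arity; the condition
is inherited by contractions.
\<close>

definition alternating :: "('v list \<Rightarrow> 'v) \<Rightarrow> bool" where
  "alternating P \<longleftrightarrow>
    (\<forall>us u v ws. P (us @ (u + v) # ws) = P (us @ u # ws) + P (us @ v # ws)) \<and>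
    (\<forall>us c u ws. P (us @ scale c u # ws) = scale c (P (us @ u # ws))) \<and>
    (\<forall>us u v ws. P (us @ u # v # ws) = - P (us @ v # u # ws))"

lemma alternatingD:
  assumes "alternating P"
  shows "P (us @ (u + v) # ws) = P (us @ u # ws) + P (us @ v # ws)"
    and "P (us @ scale c u # ws) = scale c (P (us @ u # ws))"
    and "P (us @ u # v # ws) = - P (us @ v # u # ws)"
  using assms unfolding alternating_def by blast+

lemma alternating_contract: "alternating P \<Longrightarrow> alternating (contract x P)"
  unfolding alternating_def contract_def by (metis append_Cons)

lemma alternating_head_add: "alternating P \<Longrightarrow> P ((u + v) # ws) = P (u # ws) + P (v # ws)"
  unfolding alternating_def by (metis append_Nil)
lemma alternating_head_scale: "alternating P \<Longrightarrow> P (scale c u # ws) = scale c (P (u # ws))"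
  unfolding alternating_def by (metis append_Nil)
lemma alternating_head_swap: "alternating P \<Longrightarrow> P (u # v # ws) = - P (v # u # ws)"
  unfolding alternating_def by (metis append_Nil)

lemma alternating_head_zero: "alternating P \<Longrightarrow> P (0 # ws) = 0"
  using additive_0[of "\<lambda>v. P (v # ws)"] by (simp add: alternating_head_add)
lemma alternating_head_sg: "alternating P \<Longrightarrow> P (sg k u # ws) = sg k (P (u # ws))"
  using additive_uminus[of "\<lambda>v. P (v # ws)"] by (simp add: sg_def alternating_head_add)
lemma alternating_head_uminus: "alternating P \<Longrightarrow> P ((- u) # ws) = - (P (u # ws))"
  using additive_uminus[of "\<lambda>v. P (v # ws)"] by (simp add: sg_def alternating_head_add)

lemma alternating_twist:
  assumes "alternating P" shows "alternating (twist P)"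
proof -
  note P = alternatingD[OF assms]
  show ?thesis
    unfolding alternating_def twist_def
  proof (intro conjI allI)
    fix us u v ws
    show "sg (length (us @ u # v # ws)) (P (us @ u # v # ws)) =
        - sg (length (us @ v # u # ws)) (P (us @ v # u # ws))"
      unfolding P(3)[of us u v ws] by (simp add: sg_def)
  qed (simp_all add: P(1,2) sg_def)
qed

lemma insert_sum_add_left:
  "alternating R \<Longrightarrow> insert_sum f (P + Q) R = insert_sum f P R + insert_sum f Q R"
  by (simp add: insert_sum_def fun_eq_iff shuffle_sum_add alternating_head_add)

lemma insert_sum_uminus_left:
  "alternating R \<Longrightarrow> insert_sum f (- P) R = - insert_sum f P R"
  by (simp add: insert_sum_def fun_eq_iff shuffle_sum_uminus alternating_head_uminus)

lemma insert_sum_diff_left: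
  "alternating R \<Longrightarrow> insert_sum f (P - Q) R = insert_sum f P R - insert_sum f Q R"
  using insert_sum_add_left[of R f P "- Q"] by (simp add: insert_sum_uminus_left)

lemma insert_sum_sg_left:
  "alternating R \<Longrightarrow> insert_sum f (sg k P) R = sg k (insert_sum f P R)"
  by (simp add: sg_def insert_sum_uminus_left)

text \<open>
The Leibniz rule: the first argument either goes into \<open>P\<close>, or it becomes, after \<open>f\<close>, the second
argument of \<open>Q\<close>.  Exchanging it there with the value of \<open>P\<close> gives the minus sign.
\<close>

lemma contract_insert_sum:
  assumes "alternating Q"
  shows "contract x (insert_sum f P Q) =
    insert_sum f (contract x P) Q - insert_sum f (twist P) (contract (f x) Q)"
proof -
  have "sg (length ys) (Q (P ys # f x # map f zs)) =
      - Q (f x # sg (length ys) (P ys) # map f zs)" for ys zs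
    using alternating_head_swap[OF assms, of "f x" "sg (length ys) (P ys)"]
    by (simp add: alternating_head_sg[OF assms])
  then show ?thesis
    by (simp add: fun_eq_iff insert_sum_def contract_def twist_def shuffle_sum_uminus)
qed

lemma contract_insert_sum_parity:
  assumes "alternating Q" "has_parity p P"
  shows "contract x (insert_sum f P Q) =
    insert_sum f (contract x P) Q - sg p (insert_sum f P (contract (f x) Q))"
  using assms
  by (simp add: contract_insert_sum twist_parity insert_sum_sg_left alternating_contract)

lemma insert_sum_parity:
  assumes "has_parity p P" "has_parity q Q" "alternating Q"
  shows "has_parity (p + Suc q) (insert_sum f P Q)"
  unfolding has_parity_def
proof (intro allI impI)
  fix xs assume ne: "insert_sum f P Q xs \<noteq> 0"
  show "even (length xs) \<longleftrightarrow> even (p + Suc q)"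
  proof (rule ccontr)
    assume odd: "\<not> (even (length xs) \<longleftrightarrow> even (p + Suc q))"
    have "shuffle_sum (\<lambda>ys zs. Q (P ys # map f zs)) xs = shuffle_sum (\<lambda>ys zs. 0) xs"
    proof (rule shuffle_sum_cong)
      fix ys zs :: "'v list" assume l: "length ys + length zs = length xs"
      show "Q (P ys # map f zs) = 0"
      proof (cases "P ys = 0")
        case False
        then have "even (length ys) \<longleftrightarrow> even p" using assms(1) by (simp add: has_parity_def)
        then have "\<not> (even (length (P ys # map f zs)) \<longleftrightarrow> even q)"
          using odd l[symmetric] by auto
        then show ?thesis using assms(2) unfolding has_parity_def by blast
      qed (simp add: alternating_head_zero assms)
    qed
    then show False using ne by (simp add: insert_sum_def shuffle_sum_zero)
  qed
qed

lemma alternating_insert_sum: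
  assumes P: "alternating P" and Q: "alternating Q"
    and f: "\<And>u v. f (u + v) = f u + f v" "\<And>c u. f (scale c u) = scale c (f u)"
  shows "alternating (insert_sum f P Q)"
proof -
  note cI = contract_insert_sum
  have ap: "insert_sum f P Q (x # xs) = insert_sum f (contract x P) Q xs
      - insert_sum f (twist P) (contract (f x) Q) xs"
    if "alternating P" "alternating Q" for x xs P Q
    using cI[OF that(2), of x f P] by (simp add: contract_def fun_eq_iff)
  have add: "insert_sum f P Q (us @ (u + v) # ws) = insert_sum f P Q (us @ u # ws)
      + insert_sum f P Q (us @ v # ws)"
    if "alternating P" "alternating Q" for us u v ws P Q
    using that
  proof (induction us arbitrary: P Q)
    case Nil
    have "contract (u + v) P = contract u P + contract v P" "contract (f u + f v) Q
        = contract (f u) Q + contract (f v) Q"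
      using Nil by (simp_all add: contract_def fun_eq_iff alternating_head_add)
    then show ?case
      using Nil by (simp add: ap f insert_sum_add_left insert_sum_add_right)
  next
    case (Cons a us)
    then show ?case by (simp add: ap Cons.IH alternating_contract alternating_twist)
  qed
  have sc: "insert_sum f P Q (us @ scale c u # ws) = scale c (insert_sum f P Q (us @ u # ws))"
    if "alternating P" "alternating Q" for us c u ws P Q
    using that
  proof (induction us arbitrary: P Q)
    case Nil
    have 1: "contract (scale c u) P = (\<lambda>xs. scale c (contract u P xs))" "contract (scale c (f u))
        Q = (\<lambda>xs. scale c (contract (f u) Q xs))"
      using Nil by (simp_all add: contract_def fun_eq_iff alternating_head_scale)
    have "insert_sum f (\<lambda>xs. scale c (contract u P xs)) Q ws
        = scale c (insert_sum f (contract u P) Q ws)"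
      unfolding insert_sum_def using Nil
      by (subst additive_shuffle_sum[of "scale c"]) (simp_all
          add: scale_right_distrib alternating_head_scale)
    moreover have "insert_sum f (twist P) (\<lambda>xs. scale c (contract (f u) Q xs)) ws
        = scale c (insert_sum f (twist P) (contract (f u) Q) ws)"
      unfolding insert_sum_def
      by (subst additive_shuffle_sum[of "scale c"]) (simp_all add: scale_right_distrib)
    ultimately show ?case
      using Nil by (simp add: ap f 1 scale_right_diff_distrib)
  next
    case (Cons a us)
    then show ?case by (simp add: ap Cons.IH alternating_contract alternating_twist
        scale_right_diff_distrib)
  qed
  have sw: "insert_sum f P Q (us @ u # v # ws) = - insert_sum f P Q (us @ v # u # ws)"
    if "alternating P" "alternating Q" for us u v ws P Q
    using that
  proof (induction us arbitrary: P Q)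
    case Nil
    have 1: "contract u (contract v P) = - contract v (contract u P)" if "alternating P" for u v P
      using alternating_head_swap[OF that, of u v] by (simp add: contract_def fun_eq_iff)
    show ?case
      using Nil by (simp add: ap contract_twist insert_sum_uminus_left alternating_contract
          alternating_twist
        1[OF Nil(1), of u v] 1[OF Nil(2), of "f u" "f v"] insert_sum_uminus_right)
  next
    case (Cons a us)
    then show ?case by (simp add: ap Cons.IH alternating_contract alternating_twist)
  qed
  show ?thesis
    unfolding alternating_def using add[OF P Q] sc[OF P Q] sw[OF P Q] by blast
qed

section \<open>The cup product\<close>

definition cup_sum :: "('v list \<Rightarrow> 'v) \<Rightarrow> ('v list \<Rightarrow> 'v) \<Rightarrow> 'v list \<Rightarrow> 'v"
  where "cup_sum P Q = shuffle_sum (\<lambda>ys zs. br (P ys) (Q zs))"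

lemma br_add_left: "br (x + y) z = br x z + br y z"
  and br_add_right: "br x (y + z) = br x y + br x z"
  and br_scale_left: "br (scale c x) z = scale c (br x z)"
  and br_scale_right: "br x (scale c z) = scale c (br x z)"
  using bilinear_br by (simp_all add: bilinear_on_def)

lemma br_zero_left [simp]: "br 0 z = 0" and br_zero_right [simp]: "br z 0 = 0"
  using additive_0[of "\<lambda>x. br x z"] additive_0[of "br z"]
  by (simp_all add: br_add_left br_add_right)

lemma br_uminus_left: "br (- x) z = - br x z" and br_uminus_right: "br z (- x) = - br z x"
  using additive_uminus[of "\<lambda>x. br x z"] additive_uminus[of "br z"]
  by (simp_all add: br_add_left br_add_right)

lemma alpha_add: "\<alpha> (x + y) = \<alpha> x + \<alpha> y" and alpha_scale: "\<alpha> (scale c x) = scale c (\<alpha> x)"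
  using linear_alpha unfolding Vector_Spaces.linear_def module_hom_iff by blast+

lemma cup_sum_add_left: "cup_sum (P + Q) R = cup_sum P R + cup_sum Q R"
  by (simp add: cup_sum_def fun_eq_iff br_add_left shuffle_sum_add)
lemma cup_sum_add_right: "cup_sum P (Q + R) = cup_sum P Q + cup_sum P R"
  by (simp add: cup_sum_def fun_eq_iff br_add_right shuffle_sum_add)
lemma cup_sum_uminus_left: "cup_sum (- P) R = - cup_sum P R"
  by (simp add: cup_sum_def fun_eq_iff br_uminus_left shuffle_sum_uminus)
lemma cup_sum_uminus_right: "cup_sum P (- R) = - cup_sum P R"
  by (simp add: cup_sum_def fun_eq_iff br_uminus_right shuffle_sum_uminus)
lemma cup_sum_diff_left: "cup_sum (P - Q) R = cup_sum P R - cup_sum Q R"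
  using cup_sum_add_left[of P "- Q" R] by (simp add: cup_sum_uminus_left)
lemma cup_sum_diff_right: "cup_sum P (Q - R) = cup_sum P Q - cup_sum P R"
  using cup_sum_add_right[of P Q "- R"] by (simp add: cup_sum_uminus_right)
lemma cup_sum_sg_left: "cup_sum (sg k P) R = sg k (cup_sum P R)"
  by (simp add: sg_def cup_sum_uminus_left)

lemma contract_cup_sum:
  "contract x (cup_sum P Q) = cup_sum (contract x P) Q + cup_sum (twist P) (contract x Q)"
proof -
  have "sg (length ys) (br (P ys) (Q (x # zs))) = br (twist P ys) (Q (x # zs))" for ys zs
    by (simp add: sg_def twist_def br_uminus_left)
  then show ?thesis
    by (simp add: fun_eq_iff cup_sum_def contract_def)
qed

lemma contract_cup_sum_parity:
  "has_parity p P \<Longrightarrow>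
    contract x (cup_sum P Q) = cup_sum (contract x P) Q + sg p (cup_sum P (contract x Q))"
  by (simp add: contract_cup_sum twist_parity cup_sum_sg_left)

lemma cup_sum_parity:
  assumes "has_parity p P" "has_parity q Q"
  shows "has_parity (p + q) (cup_sum P Q)"
  unfolding has_parity_def
proof (intro allI impI, rule ccontr)
  fix xs assume ne: "cup_sum P Q xs \<noteq> 0" and odd: "\<not> (even (length xs) \<longleftrightarrow> even (p + q))"
  have "shuffle_sum (\<lambda>ys zs. br (P ys) (Q zs)) xs = shuffle_sum (\<lambda>ys zs. 0) xs"
  proof (rule shuffle_sum_cong)
    fix ys zs :: "'v list" assume l: "length ys + length zs = length xs"
    have "P ys = 0 \<or> Q zs = 0"
      using assms odd unfolding has_parity_def l[symmetric] by auto
    then show "br (P ys) (Q zs) = 0" by auto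
  qed
  then show False using ne by (simp add: cup_sum_def shuffle_sum_zero)
qed

lemma alternating_cup_sum:
  assumes P: "alternating P" and Q: "alternating Q"
  shows "alternating (cup_sum P Q)"
proof -
  have ap: "cup_sum P Q (x # xs) = cup_sum (contract x P) Q xs
      + cup_sum (twist P) (contract x Q) xs"
    for x xs P Q
    using contract_cup_sum[of x P Q] by (simp add: contract_def fun_eq_iff)
  have add: "cup_sum P Q (us @ (u + v) # ws) = cup_sum P Q (us @ u # ws)
      + cup_sum P Q (us @ v # ws)"
    if "alternating P" "alternating Q" for us u v ws P Q
    using that
  proof (induction us arbitrary: P Q)
    case Nil
    have "contract (u + v) P = contract u P + contract v P" if "alternating P" for P
      using that by (simp add: contract_def fun_eq_iff alternating_head_add)
    then show ?case
      using Nil by (simp add: ap cup_sum_add_left cup_sum_add_right)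
  next
    case (Cons a us)
    then show ?case by (simp add: ap Cons.IH alternating_contract alternating_twist)
  qed
  have sc: "cup_sum P Q (us @ scale c u # ws) = scale c (cup_sum P Q (us @ u # ws))"
    if "alternating P" "alternating Q" for us c u ws P Q
    using that
  proof (induction us arbitrary: P Q)
    case Nil
    have 1: "contract (scale c u) P = (\<lambda>xs. scale c (contract u P xs))" if "alternating P" for P
      using that by (simp add: contract_def fun_eq_iff alternating_head_scale)
    have "cup_sum (\<lambda>xs. scale c (R xs)) S ws = scale c (cup_sum R S ws)"
      "cup_sum R (\<lambda>xs. scale c (S xs)) ws = scale c (cup_sum R S ws)" for R S
      unfolding cup_sum_def
      by (simp_all add: additive_shuffle_sum[of "scale c"] scale_right_distrib br_scale_left
          br_scale_right)
    then show ?case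
      using Nil by (simp add: ap 1 scale_right_distrib)
  next
    case (Cons a us)
    then show ?case by (simp add: ap Cons.IH alternating_contract alternating_twist
        scale_right_distrib)
  qed
  have sw: "cup_sum P Q (us @ u # v # ws) = - cup_sum P Q (us @ v # u # ws)"
    if "alternating P" "alternating Q" for us u v ws P Q
    using that
  proof (induction us arbitrary: P Q)
    case Nil
    have 1: "contract u (contract v P) = - contract v (contract u P)" if "alternating P" for u v P
      using alternating_head_swap[OF that, of u v] by (simp add: contract_def fun_eq_iff)
    have 2: "twist (twist R) = R" for R by (auto simp: twist_def sg_def fun_eq_iff)
    show ?case
      by (simp add: ap contract_twist cup_sum_uminus_left cup_sum_uminus_right 2
        1[OF Nil(1), of u v] 1[OF Nil(2), of u v])
  next
    case (Cons a us)
    then show ?case by (simp add: ap Cons.IH alternating_contract alternating_twist)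
  qed
  show ?thesis
    unfolding alternating_def using add[OF P Q] sc[OF P Q] sw[OF P Q] by blast
qed

lemma cup_sum_skew:
  assumes "has_parity p P" "has_parity q Q"
  shows "cup_sum P Q xs = - sg (p * q) (cup_sum Q P xs)"
  using assms
proof (induction xs arbitrary: p q P Q)
  case Nil
  then show ?case
    using skew_br[of "P []" "Q []"] by (auto simp: cup_sum_def parity_Nil sg_def)
next
  case (Cons x xs)
  have e: "R (x # xs) = contract x R xs" for R :: "'v list \<Rightarrow> 'v" by (simp add: contract_def)
  note IH = Cons.IH[OF contract_parity[OF Cons.prems(1)] Cons.prems(2), of x]
    Cons.IH[OF Cons.prems(1) contract_parity[OF Cons.prems(2)], of x]
  show ?case
    unfolding e contract_cup_sum_parity[OF Cons.prems(1)] contract_cup_sum_parity[OF Cons.prems(2)]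
    by (cases "even p"; cases "even q") (simp_all add: IH sg_def)
qed

text \<open>
In the cup product the powers of \<open>\<alpha>\<close> are balanced in such a way that, once they are moved to the
cochains, the outer cochain always carries one \<open>\<alpha>\<close> more than the two inner ones.  This is the shape of the
Hom-Jacobi identity, to which the induction reduces.
\<close>

lemma cup_sum_jacobi:
  assumes "has_parity p P" "has_parity q Q" "has_parity r R"
  shows "cup_sum (\<alpha> \<circ> P) (cup_sum Q R) xs =
    cup_sum (cup_sum P Q) (\<alpha> \<circ> R) xs + sg (p * q) (cup_sum (\<alpha> \<circ> Q) (cup_sum P R) xs)"
  using assms
proof (induction xs arbitrary: p q r P Q R)
  case Nil
  \<comment> \<open>the Hom-Jacobi identity as a Leibniz rule\<close>
  have J: "br (\<alpha> u) (br v w) = br (br u v) (\<alpha> w) + br (\<alpha> v) (br u w)" for u v w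
  proof -
    have "br (\<alpha> u) (br v w) - br (\<alpha> v) (br u w) - br (br u v) (\<alpha> w) = 0"
      using hom_jacobi[of u v w]
      unfolding skew_br[of w u] skew_br[of "\<alpha> w"] br_uminus_right by simp
    then show ?thesis by (simp add: algebra_simps)
  qed
  show ?case
    using Nil J[of "P []" "Q []" "R []"] by (auto simp: cup_sum_def parity_Nil sg_def alpha_add
        additive_0[of \<alpha>])
next
  case (Cons x xs)
  have e: "R (x # xs) = contract x R xs" for R :: "'v list \<Rightarrow> 'v" by (simp add: contract_def)
  have par: "has_parity k (\<alpha> \<circ> S)" if "has_parity k S" for k and S :: "'v list \<Rightarrow> 'v"
    using that by (rule parity_comp) (rule additive_0, rule alpha_add)
  note prems = Cons.prems and cp = contract_parity
  note IH = Cons.IH[OF cp[OF prems(1)] prems(2,3), of x]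
    Cons.IH[OF prems(1) cp[OF prems(2)] prems(3), of x]
    Cons.IH[OF prems(1,2) cp[OF prems(3)], of x]
  note c = contract_cup_sum_parity[OF prems(1)] contract_cup_sum_parity[OF prems(2)]
    contract_cup_sum_parity[OF par[OF prems(1)]] contract_cup_sum_parity[OF par[OF prems(2)]]
    contract_cup_sum_parity[OF cup_sum_parity[OF prems(1,2)]]
  show ?case
    unfolding e c contract_comp
    by (cases "even p"; cases "even q"; cases "even r")
      (simp_all add: IH[unfolded comp_def] comp_def sg_def cup_sum_add_left cup_sum_add_right
          cup_sum_uminus_left cup_sum_uminus_right
        cup_sum_diff_left cup_sum_diff_right algebra_simps)
qed

text \<open>
The value of \<open>P\<close> goes into \<open>Q\<close> or into \<open>R\<close>; the other factor is fed with images under \<open>f\<close> only.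
\<close>

lemma insert_sum_cup_sum:
  assumes "has_parity p P" "has_parity q Q" "has_parity r R" "alternating Q" "alternating R"
  shows "insert_sum f P (cup_sum Q R) xs =
    cup_sum (insert_sum f P Q) (R \<circ> map f) xs + sg (Suc p * q) (cup_sum (Q \<circ> map f) (insert_sum f
        P R) xs)"
  using assms
proof (induction xs arbitrary: p q r P Q R)
  case Nil
  then show ?case
    by (auto simp: insert_sum_def cup_sum_def parity_Nil sg_def alternating_head_zero)
next
  case (Cons x xs)
  have e: "R (x # xs) = contract x R xs" for R :: "'v list \<Rightarrow> 'v" by (simp add: contract_def)
  note par = parity_map
  note prems = Cons.prems and cp = contract_parity
  note alt = prems(4,5) alternating_contract[OF prems(4)] alternating_contract[OF prems(5)]
  note IH = Cons.IH[OF cp[OF prems(1)] prems(2-5), of x]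
    Cons.IH[OF prems(1) cp[OF prems(2)] prems(3) alt(3) alt(2), of "f x"]
    Cons.IH[OF prems(1,2) cp[OF prems(3)] alt(1) alt(4), of "f x"]
  note c = contract_insert_sum_parity[OF alternating_cup_sum[OF alt(1,2)] prems(1)]
    contract_insert_sum_parity[OF alt(1) prems(1)] contract_insert_sum_parity[OF alt(2) prems(1)]
    contract_cup_sum_parity[OF prems(2)]
    contract_cup_sum_parity[OF par[OF prems(2)]]
    contract_cup_sum_parity[OF insert_sum_parity[OF prems(1,2) alt(1)]] contract_map
    insert_sum_add_right insert_sum_sg_right
  show ?case
    unfolding e c
    by (cases "even p"; cases "even q")
      (simp_all add: IH sg_def cup_sum_add_left cup_sum_add_right cup_sum_uminus_left
          cup_sum_uminus_right
        cup_sum_diff_left cup_sum_diff_right comp_def algebra_simps)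
qed

section \<open>Insertion is a graded pre-Lie product\<close>

text \<open>
The sum of the terms \<open>R (Q (\<dots>), P (\<dots>), h \<dots>)\<close>, up to sign.  It is the part of an iterated insertion in
which the value of \<open>P\<close> is not an argument of \<open>Q\<close>, in other words the associator of insertion.
\<close>

definition double_insert :: "('v \<Rightarrow> 'v) \<Rightarrow> ('v list \<Rightarrow> 'v) \<Rightarrow> ('v list \<Rightarrow> 'v) \<Rightarrow> ('v list \<Rightarrow> 'v)
    \<Rightarrow> 'v list \<Rightarrow> 'v"
  where "double_insert h P Q R = shuffle_sum (\<lambda>ys zs. insert_sum h Q (contract (P ys) R) zs)"

lemma double_insert_uminus: "alternating R \<Longrightarrow> double_insert h (- P) Q R = - double_insert h P Q R"
proof -
  assume "alternating R"
  then have "contract (- u) R = - contract u R" for u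
    by (simp add: fun_eq_iff contract_def alternating_head_uminus)
  then have "insert_sum h Q (contract (- u) R) zs = - insert_sum h Q (contract u R) zs" for u zs
    by (simp add: insert_sum_uminus_right)
  then show ?thesis
    by (simp add: double_insert_def shuffle_sum_uminus fun_eq_iff)
qed

lemma contract_double_insert:
  assumes p: "has_parity p P" and q: "has_parity q Q" and R: "alternating R"
  shows "contract x (double_insert h P Q R) = double_insert h (contract x P) Q R
    + sg p (double_insert h P (contract x Q) R) + sg (p
        + q) (double_insert h P Q (contract (h x) R))"
proof -
  have sw: "contract (h x) (contract u R) = - contract u (contract (h x) R)" for u
    using alternating_head_swap[OF R, of u "h x"] by (simp add: contract_def fun_eq_iff)
  have 1: "insert_sum h Q (contract u R) (x # zs) = insert_sum h (contract x Q) (contract u R) zs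
      + sg q (insert_sum h Q (contract u (contract (h x) R)) zs)" for u zs
    using fun_cong[OF contract_insert_sum_parity[OF alternating_contract[OF R] q, of x h u], of zs]
    unfolding sw insert_sum_uminus_right by (simp add: contract_def[of x "insert_sum _ _ _"]
        sg_apply) (simp add: sg_def)
  have 2: "sg (length ys) (insert_sum h S (contract (P ys) T) zs)
      = sg p (insert_sum h S (contract (P ys) T) zs)"
    if "alternating T" for S T ys zs
  proof (cases "P ys = 0")
    case True
    have "contract 0 T = 0" using that by (simp add: contract_def fun_eq_iff alternating_head_zero)
    then show ?thesis by (simp add: True insert_sum_def shuffle_sum_zero)
  next
    case False
    then show ?thesis using p by (simp add: has_parity_def sg_def)
  qed
  have sg_sum: "sg k (a + b) = sg k a + sg k b" "sg k (sg l a) = sg (k + l) a" for k l and a b :: 'v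
    by (auto simp: sg_def)
  have "sg (length ys) (insert_sum h Q (contract (P ys) R) (x # zs)) =
      sg p (insert_sum h (contract x Q) (contract (P ys) R) zs)
      + sg (p + q) (insert_sum h Q (contract (P ys) (contract (h x) R)) zs)" for ys zs
    unfolding 1 sg_sum using 2[OF R] 2[OF alternating_contract[OF R, of "h x"]]
    by (metis add.commute sg_sum(2))
  note 3 = this
  show ?thesis
  proof
    fix xs
    have "contract x (double_insert h P Q R) xs =
      shuffle_sum (\<lambda>ys zs. insert_sum h Q (contract (P (x # ys)) R) zs) xs +
      shuffle_sum (\<lambda>ys zs. sg (length ys) (insert_sum h Q (contract (P ys) R) (x # zs))) xs"
      unfolding contract_def[of x "double_insert h P Q R"] unfolding double_insert_def by simp
    then show "contract x (double_insert h P Q R) xs = (double_insert h (contract x P) Q R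
      + sg p (double_insert h P (contract x Q) R) + sg (p
          + q) (double_insert h P Q (contract (h x) R))) xs"
      unfolding 3 shuffle_sum_add shuffle_sum_sg
      by (simp add: double_insert_def sg_apply contract_def[of x P] add.assoc)
  qed
qed

text \<open>
The symmetry of the associator is the skew-symmetry of \<open>R\<close> in its first two arguments.
\<close>

lemma double_insert_skew:
  assumes "has_parity p P" "has_parity q Q" "alternating R"
  shows "double_insert h P Q R xs = - sg (p * q) (double_insert h Q P R xs)"
  using assms
proof (induction xs arbitrary: p q P Q R)
  case Nil
  then show ?case
    using alternating_head_swap[of R "P []" "Q []" "[]"]
    by (auto simp: double_insert_def insert_sum_def contract_def parity_Nil sg_def
        alternating_head_zero)
next
  case (Cons x xs)
  have e: "R (x # xs) = contract x R xs" for R :: "'v list \<Rightarrow> 'v" by (simp add: contract_def)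
  note prems = Cons.prems and cp = contract_parity
  note IH = Cons.IH[OF cp[OF prems(1)] prems(2-3), of x]
    Cons.IH[OF prems(1) cp[OF prems(2)] prems(3), of x]
    Cons.IH[OF prems(1,2) alternating_contract[OF prems(3)], of "h x"]
  show ?case
    unfolding e contract_double_insert[OF prems] contract_double_insert[OF prems(2,1,3)]
    by (cases "even p"; cases "even q") (simp_all add: IH sg_def algebra_simps)
qed

text \<open>
The pre-Lie identity in its asymmetric form: the value of \<open>P\<close> goes either into \<open>Q\<close> or into \<open>R\<close>.  In the
second case \<open>Q\<close> sees its arguments through \<open>f\<close> while the value of \<open>P\<close> is moved by \<open>g\<close>; for
equivariant cochains these two modifications agree, which makes the last term symmetric in \<open>P\<close> and \<open>Q\<close>.
\<close>

lemma insert_sum_insert_sum: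
  assumes "has_parity p P" "has_parity q Q" "alternating Q" "alternating R"
    and f: "\<And>u v. f (u + v) = f u + f v" "\<And>c u. f (scale c u) = scale c (f u)"
    and g: "\<And>u v. g (u + v) = g u + g v" "\<And>c u. g (scale c u) = scale c (g u)"
  shows "insert_sum f P (insert_sum g Q R) xs =
    insert_sum (g \<circ> f) (insert_sum f P Q) R xs - sg q (double_insert (g \<circ> f) (g \<circ> P) (Q \<circ> map f) R
        xs)"
  using assms(1-4)
proof (induction xs arbitrary: p q P Q R)
  case Nil
  then show ?case
    using alternating_head_swap[of R "Q []" "g (P [])" "[]"]
    by (auto simp: insert_sum_def double_insert_def contract_def parity_Nil sg_def
        alternating_head_zero)
next
  case (Cons x xs)
  have e: "R (x # xs) = contract x R xs" for R :: "'v list \<Rightarrow> 'v" by (simp add: contract_def)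
  note par = parity_map
  have parg: "has_parity k (g \<circ> S)" if "has_parity k S" for k and S :: "'v list \<Rightarrow> 'v"
    using that by (rule parity_comp) (rule additive_0, rule g(1))
  note prems = Cons.prems and cp = contract_parity
  note alt = prems(3,4) alternating_contract[OF prems(3)] alternating_contract[OF prems(4)]
  note IH = Cons.IH[OF cp[OF prems(1)] prems(2-4), of x]
    Cons.IH[OF prems(1) cp[OF prems(2)] alt(3) alt(2), of "f x"]
    Cons.IH[OF prems(1,2) alt(1) alt(4), of "g (f x)"]
  note c = contract_insert_sum_parity[OF alternating_insert_sum[OF alt(1,2) g] prems(1)]
    contract_insert_sum_parity[OF alt(1) prems(1)] contract_insert_sum_parity[OF alt(2) prems(2)]
    contract_insert_sum_parity[OF alt(2) insert_sum_parity[OF prems(1,2) alt(1)]]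
    contract_double_insert[OF parg[OF prems(1)] par[OF prems(2)] alt(2)]
    contract_map[of x Q f] contract_comp[of x g P]
  note lin = insert_sum_add_right insert_sum_diff_right insert_sum_uminus_right
    insert_sum_add_left insert_sum_diff_left insert_sum_uminus_left double_insert_uminus alt
  show ?case
    unfolding e
    by (cases "even p"; cases "even q")
      (simp_all add: c[unfolded comp_def] IH[unfolded comp_def] lin sg_def comp_def algebra_simps)
qed

end

section \<open>The formal calculus of cup product and insertion\<close>

text \<open>
Here \<open>H n\<close> stands for the cochains of arity \<open>n\<close>, \<open>V\<close> for their sums, \<open>I P Q\<close> for \<open>i\<^sub>P Q\<close>, \<open>C\<close> for the cup product,
\<open>e\<close> for the identity and \<open>\<mu>\<close> for the Hom-Lie bracket.  The cup product has the arity as degree, but the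
degree of the derivation \<open>I P\<close> is one less than the arity of \<open>P\<close>; this is why the inserted
cochains are taken from \<open>H (Suc p)\<close>.
\<close>

locale cup_insertion_algebra =
  fixes H :: "nat \<Rightarrow> 'a::ab_group_add set" and V :: "'a set"
    and I C :: "'a \<Rightarrow> 'a \<Rightarrow> 'a" and e \<mu> :: 'a
  assumes H_subset: "x \<in> H n \<Longrightarrow> x \<in> V"
    and H_add: "x \<in> H n \<Longrightarrow> y \<in> H n \<Longrightarrow> x + y \<in> H n"
    and H_uminus: "x \<in> H n \<Longrightarrow> - x \<in> H n"
    and V_add: "x \<in> V \<Longrightarrow> y \<in> V \<Longrightarrow> x + y \<in> V"
    and V_uminus: "x \<in> V \<Longrightarrow> - x \<in> V"
    and V_I: "x \<in> V \<Longrightarrow> y \<in> V \<Longrightarrow> I x y \<in> V"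
    and V_C: "x \<in> V \<Longrightarrow> y \<in> V \<Longrightarrow> C x y \<in> V"
    and torsion_free: "x \<in> V \<Longrightarrow> (\<Sum>i<Suc n. x) = 0 \<Longrightarrow> x = 0"
    and I_add_left: "x \<in> V \<Longrightarrow> y \<in> V \<Longrightarrow> z \<in> V \<Longrightarrow> I (x + y) z = I x z + I y z"
    and I_add_right: "x \<in> V \<Longrightarrow> y \<in> V \<Longrightarrow> z \<in> V \<Longrightarrow> I x (y + z) = I x y + I x z"
    and C_add_left: "x \<in> V \<Longrightarrow> y \<in> V \<Longrightarrow> z \<in> V \<Longrightarrow> C (x + y) z = C x z + C y z"
    and C_add_right: "x \<in> V \<Longrightarrow> y \<in> V \<Longrightarrow> z \<in> V \<Longrightarrow> C x (y + z) = C x y + C x z"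
    and I_degree: "P \<in> H (Suc p) \<Longrightarrow> E \<in> H n \<Longrightarrow> I P E \<in> H (p + n)"
    and C_degree: "E \<in> H m \<Longrightarrow> F \<in> H n \<Longrightarrow> C E F \<in> H (m + n)"
    and e_degree: "e \<in> H 1" and mu_degree: "\<mu> \<in> H 2"
    and I_action: "P \<in> H (Suc p) \<Longrightarrow> Q \<in> H (Suc q) \<Longrightarrow> E \<in> H n \<Longrightarrow>
      I (I P Q - sg (p * q) (I Q P)) E = I P (I Q E) - sg (p * q) (I Q (I P E))"
    and I_derivation: "P \<in> H (Suc p) \<Longrightarrow> E \<in> H m \<Longrightarrow> F \<in> H n \<Longrightarrow>
      I P (C E F) = C (I P E) F + sg (p * m) (C E (I P F))"
    and C_skew: "E \<in> H m \<Longrightarrow> F \<in> H n \<Longrightarrow> C E F = - sg (m * n) (C F E)"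
    and C_jacobi: "E \<in> H m \<Longrightarrow> F \<in> H n \<Longrightarrow> G \<in> H p \<Longrightarrow>
      C E (C F G) = C (C E F) G + sg (m * n) (C F (C E G))"
    and I_e: "P \<in> H n \<Longrightarrow> I P e = P"
    and C_e_e: "C e e = \<mu> + \<mu>"
begin

definition \<delta> where "\<delta> E = C e E - I \<mu> E"

text \<open>
The elements \<open>(E, \<theta> m E)\<close> of the semidirect product form the graph that carries the
Froelicher-Nijenhuis bracket.
\<close>

definition \<theta> where "\<theta> m E = sg m (\<delta> E)"
definition nr_bracket where "nr_bracket p q P Q = I P Q - sg (p * q) (I Q P)"
definition fn_bracket where "fn_bracket m n E F = C E F + I (\<theta> m E) F - sg (m * n) (I (\<theta> n F) E)"

lemma V_e: "e \<in> V" and V_mu: "\<mu> \<in> V"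
  using e_degree mu_degree H_subset by blast+

lemma no_two_torsion: "x \<in> V \<Longrightarrow> x + x = 0 \<Longrightarrow> x = 0"
  using torsion_free[of x 1] by simp

lemma no_three_torsion: "x \<in> V \<Longrightarrow> x + x + x = 0 \<Longrightarrow> x = 0"
  using torsion_free[of x 2] by (simp add: numeral_2_eq_2)

lemma V_zero: "0 \<in> V"
  using V_add[OF V_e V_uminus[OF V_e]] by simp

lemma V_diff: "x \<in> V \<Longrightarrow> y \<in> V \<Longrightarrow> x - y \<in> V"
  using V_add[of x "- y"] V_uminus by simp

lemma H_diff: "x \<in> H n \<Longrightarrow> y \<in> H n \<Longrightarrow> x - y \<in> H n"
  using H_add[of x n "- y"] H_uminus by simp

lemma H_sg: "x \<in> H n \<Longrightarrow> sg k x \<in> H n"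
  by (simp add: sg_def H_uminus)

lemma V_sg: "x \<in> V \<Longrightarrow> sg k x \<in> V"
  by (simp add: sg_def V_uminus)

lemma additive_on_V_uminus:
  fixes f :: "'a \<Rightarrow> 'a"
  assumes "\<And>x y. x \<in> V \<Longrightarrow> y \<in> V \<Longrightarrow> f (x + y) = f x + f y" and "x \<in> V"
  shows "f (- x) = - f x"
proof -
  have "f 0 = 0" using assms(1)[OF V_zero V_zero] by simp
  then show ?thesis using assms(1)[OF assms(2) V_uminus[OF assms(2)]]
    by (simp add: minus_unique)
qed

lemma I_uminus_left: "x \<in> V \<Longrightarrow> z \<in> V \<Longrightarrow> I (- x) z = - I x z"
  by (rule additive_on_V_uminus[of "\<lambda>x. I x z"]) (auto simp: I_add_left)
lemma I_uminus_right: "x \<in> V \<Longrightarrow> z \<in> V \<Longrightarrow> I z (- x) = - I z x"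
  by (rule additive_on_V_uminus[of "\<lambda>x. I z x"]) (auto simp: I_add_right)
lemma C_uminus_left: "x \<in> V \<Longrightarrow> z \<in> V \<Longrightarrow> C (- x) z = - C x z"
  by (rule additive_on_V_uminus[of "\<lambda>x. C x z"]) (auto simp: C_add_left)
lemma C_uminus_right: "x \<in> V \<Longrightarrow> z \<in> V \<Longrightarrow> C z (- x) = - C z x"
  by (rule additive_on_V_uminus[of "\<lambda>x. C z x"]) (auto simp: C_add_right)

lemma I_diff_left: "x \<in> V \<Longrightarrow> y \<in> V \<Longrightarrow> z \<in> V \<Longrightarrow> I (x - y) z = I x z - I y z"
  using I_add_left[of x "- y" z] by (simp add: I_uminus_left V_uminus)
lemma I_diff_right: "x \<in> V \<Longrightarrow> y \<in> V \<Longrightarrow> z \<in> V \<Longrightarrow> I z (x - y) = I z x - I z y"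
  using I_add_right[of z x "- y"] by (simp add: I_uminus_right V_uminus)
lemma C_diff_left: "x \<in> V \<Longrightarrow> y \<in> V \<Longrightarrow> z \<in> V \<Longrightarrow> C (x - y) z = C x z - C y z"
  using C_add_left[of x "- y" z] by (simp add: C_uminus_left V_uminus)
lemma C_diff_right: "x \<in> V \<Longrightarrow> y \<in> V \<Longrightarrow> z \<in> V \<Longrightarrow> C z (x - y) = C z x - C z y"
  using C_add_right[of z x "- y"] by (simp add: C_uminus_right V_uminus)

lemma delta_V: "E \<in> V \<Longrightarrow> \<delta> E \<in> V"
  by (simp add: \<delta>_def V_C V_I V_diff V_e V_mu)
lemma theta_V: "E \<in> V \<Longrightarrow> \<theta> m E \<in> V"
  by (simp add: \<theta>_def delta_V V_sg)

lemmas V_intros = V_add V_uminus V_diff V_sg V_I V_C V_e V_mu delta_V theta_V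
lemmas bilinear = I_add_left I_add_right I_uminus_left I_uminus_right I_diff_left I_diff_right
  C_add_left C_add_right C_uminus_left C_uminus_right C_diff_left C_diff_right

lemma delta_degree: "E \<in> H n \<Longrightarrow> \<delta> E \<in> H (Suc n)"
  unfolding \<delta>_def using C_degree[OF e_degree] I_degree[of \<mu> 1 E n] mu_degree
  by (intro H_diff) (auto simp: numeral_2_eq_2)

lemma theta_degree: "E \<in> H n \<Longrightarrow> \<theta> m E \<in> H (Suc n)"
  by (simp add: \<theta>_def H_sg delta_degree)

lemma nr_degree: "P \<in> H (Suc p) \<Longrightarrow> Q \<in> H (Suc q) \<Longrightarrow> nr_bracket p q P Q \<in> H (Suc (p + q))"
  unfolding nr_bracket_def using I_degree[of P p Q "Suc q"] I_degree[of Q q P "Suc p"]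
  by (intro H_diff H_sg) (auto simp: add_ac)

lemma fn_degree: "E \<in> H m \<Longrightarrow> F \<in> H n \<Longrightarrow> fn_bracket m n E F \<in> H (m + n)"
  unfolding fn_bracket_def
  using C_degree[of E m F n] I_degree[of "\<theta> m E" m F n] I_degree[of "\<theta> n F" n E m]
  by (intro H_diff H_sg H_add) (auto simp: add_ac theta_degree)

lemma delta_add: "x \<in> V \<Longrightarrow> y \<in> V \<Longrightarrow> \<delta> (x + y) = \<delta> x + \<delta> y"
  by (simp add: \<delta>_def bilinear V_intros)
lemma delta_uminus: "x \<in> V \<Longrightarrow> \<delta> (- x) = - \<delta> x"
  by (rule additive_on_V_uminus) (auto simp: delta_add)
lemma delta_diff: "x \<in> V \<Longrightarrow> y \<in> V \<Longrightarrow> \<delta> (x - y) = \<delta> x - \<delta> y"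
  by (simp add: \<delta>_def bilinear V_intros)

text \<open>
Applying the derivation \<open>I P\<close> to \<open>[e, e] = 2 \<mu>\<close> gives twice this identity.
\<close>

lemma I_mu: assumes "P \<in> H (Suc p)" shows "I P \<mu> = C P e"
proof -
  have V: "P \<in> V" using assms H_subset by blast
  have "I P \<mu> + I P \<mu> = I P (C e e)"
    by (simp add: C_e_e bilinear V_intros V)
  also have "\<dots> = C P e + sg p (C e P)"
    using I_derivation[OF assms e_degree e_degree] I_e[OF assms] by simp
  also have "C e P = - sg (Suc p) (C P e)"
    using C_skew[OF e_degree assms] by simp
  finally have "(I P \<mu> - C P e) + (I P \<mu> - C P e) = 0"
    by (auto simp: sg_def algebra_simps)
  then show ?thesis
    using no_two_torsion[of "I P \<mu> - C P e"] by (simp add: V_intros V)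
qed

lemma nr_mu: assumes P: "P \<in> H (Suc p)" shows "nr_bracket p 1 P \<mu> = sg p (\<delta> P)"
  using C_skew[OF e_degree P] by (auto simp: nr_bracket_def \<delta>_def I_mu[OF P] sg_def)

text \<open>
The commutator of \<open>I P\<close> and \<open>\<delta>\<close>.  With \<open>\<delta> = [e, -] - I \<mu>\<close>, the commutator with \<open>[e, -]\<close> is the
cup product with \<open>I P e = P\<close>, and the commutator with \<open>I \<mu>\<close> is insertion of the bracket of \<open>P\<close> and
\<open>\<mu>\<close>, which is \<open>\<delta> P\<close> up to sign.
\<close>

lemma I_delta:
  assumes P: "P \<in> H (Suc p)" and E: "E \<in> H m"
  shows "I P (\<delta> E) = sg p (\<delta> (I P E)) + C P E - sg p (I (\<delta> P) E)"
proof -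
  have V: "P \<in> V" "E \<in> V" using assms H_subset by blast+
  have mu: "\<mu> \<in> H (Suc 1)" using mu_degree by (simp add: numeral_2_eq_2)
  have 1: "I P (C e E) = C P E + sg p (C e (I P E))"
    using I_derivation[OF P e_degree E] I_e[OF P] by simp
  have "I (nr_bracket p 1 P \<mu>) E = I P (I \<mu> E) - sg p (I \<mu> (I P E))"
    using I_action[OF P mu E] by (simp add: nr_bracket_def)
  then have 2: "I P (I \<mu> E) = sg p (I (\<delta> P) E) + sg p (I \<mu> (I P E))"
    unfolding nr_mu[OF P] by (auto simp: sg_def bilinear V_intros V algebra_simps)
  show ?thesis
    using 1 2 by (auto simp: \<delta>_def bilinear V_intros V sg_def)
qed

lemma delta_cup:
  assumes E: "E \<in> H m" and F: "F \<in> H n"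
  shows "\<delta> (C E F) = C (\<delta> E) F + sg m (C E (\<delta> F))"
proof -
  have V: "F \<in> V" "E \<in> V" using assms H_subset by blast+
  have mu: "\<mu> \<in> H (Suc 1)" using mu_degree by (simp add: numeral_2_eq_2)
  show ?thesis
    using C_jacobi[OF e_degree E F] I_derivation[OF mu E F]
    by (auto simp: \<delta>_def bilinear V_intros V sg_def)
qed

lemma delta_e: "\<delta> e = \<mu>"
  using I_e[OF mu_degree] by (simp add: \<delta>_def C_e_e)

text \<open>
The Jacobi identity makes three times \<open>[e, [e, e]]\<close> vanish.
\<close>

lemma C_e_mu: "C e \<mu> = 0" and C_mu_e: "C \<mu> e = 0"
proof -
  have "C e (C e e) = C (C e e) e - C e (C e e)"
    using C_jacobi[OF e_degree e_degree e_degree] by (simp add: sg_def)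
  moreover have "C (C e e) e = - C e (C e e)"
    using C_skew[OF e_degree C_degree[OF e_degree e_degree]] by (simp add: sg_def)
  ultimately have "C e (C e e) + C e (C e e) = - C e (C e e)"
    by (simp only: eq_diff_eq)
  then have "C e (C e e) + C e (C e e) + C e (C e e) = 0"
    by (metis left_minus)
  then have 0: "C e (C e e) = 0"
    by (rule no_three_torsion[rotated]) (simp_all add: V_intros)
  then have "C e \<mu> + C e \<mu> = 0"
    by (simp add: C_e_e bilinear V_intros)
  then show "C e \<mu> = 0"
    by (rule no_two_torsion[rotated]) (simp_all add: V_intros)
  then show "C \<mu> e = 0"
    using C_skew[OF e_degree mu_degree] by (simp add: sg_def)
qed

lemma delta_mu: "\<delta> \<mu> = 0"
  using I_mu[of \<mu> 1] mu_degree by (simp add: \<delta>_def C_e_mu C_mu_e numeral_2_eq_2)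

text \<open>
As \<open>\<delta>\<close> is odd and \<open>\<delta> e = \<mu>\<close>, the derivation rule for \<open>[e, E]\<close> and the commutator with \<open>I \<mu>\<close> show
that \<open>\<delta>\<^sup>2 E\<close> is equal to its own negative.
\<close>

lemma delta_delta:
  assumes E: "E \<in> H m"
  shows "\<delta> (\<delta> E) = 0"
proof -
  have V: "E \<in> V" using assms H_subset by blast+
  have mu: "\<mu> \<in> H (Suc 1)" using mu_degree by (simp add: numeral_2_eq_2)
  have I0: "I 0 E = 0"
    using I_diff_left[of e e E] by (simp add: V V_e)
  have 1: "I \<mu> (\<delta> E) = C \<mu> E - \<delta> (I \<mu> E)"
    using I_delta[OF mu E] by (simp add: sg_def delta_mu I0)
  have 2: "\<delta> (C e E) = C \<mu> E - C e (\<delta> E)"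
    using delta_cup[OF e_degree E] by (simp add: sg_def delta_e)
  have 3: "\<delta> (\<delta> E) = C e (\<delta> E) - I \<mu> (\<delta> E)"
    by (simp add: \<delta>_def)
  have 4: "\<delta> (\<delta> E) = \<delta> (C e E) - \<delta> (I \<mu> E)"
    by (subst (2) \<delta>_def) (simp add: delta_diff V_intros V)
  have "\<delta> (\<delta> E) + \<delta> (\<delta> E) = 0"
    by (subst 3, subst 4) (simp add: 1 2)
  then show ?thesis
    by (rule no_two_torsion[rotated]) (simp_all add: V_intros V)
qed

text \<open>
The mixed bracket of the semidirect product: the deviation of \<open>\<theta>\<close> from commuting with the insertion
of \<open>P\<close> is the Froelicher-Nijenhuis bracket with \<open>P\<close>.
\<close>

lemma nr_theta:
  assumes P: "P \<in> H (Suc p)" and E: "E \<in> H m"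
  shows "nr_bracket p m P (\<theta> m E) = \<theta> (p + m) (I P E) - sg (p * m) (fn_bracket m (Suc p) E P)"
proof -
  have V: "P \<in> V" "E \<in> V" using assms H_subset by blast+
  show ?thesis
  using I_delta[OF P E] C_skew[OF P E]
  by (auto simp: fn_bracket_def nr_bracket_def \<theta>_def sg_def bilinear V_intros V)
qed

lemma nr_skew: "nr_bracket p q P Q = - sg (p * q) (nr_bracket q p Q P)"
  by (auto simp: nr_bracket_def sg_def mult.commute)

lemma fn_skew: assumes "E \<in> H m" "F \<in> H n" shows "fn_bracket m n E F =
    - sg (m * n) (fn_bracket n m F E)"
  using C_skew[OF assms] by (auto simp: fn_bracket_def sg_def mult.commute)

lemma I_nr:
  assumes "P \<in> H (Suc p)" "Q \<in> H (Suc q)" "E \<in> H n"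
  shows "I (nr_bracket p q P Q) E = I P (I Q E) - sg (p * q) (I Q (I P E))"
  using I_action[OF assms] by (simp add: nr_bracket_def)

text \<open>
The commutator of a pre-Lie product satisfies the Jacobi identity: insertions of brackets are rewritten by
the action property, and then all iterated insertions cancel.
\<close>

lemma nr_jacobi:
  assumes P: "P \<in> H (Suc p)" and Q: "Q \<in> H (Suc q)" and R: "R \<in> H (Suc r)"
  shows "nr_bracket p (q + r) P (nr_bracket q r Q R) =
    nr_bracket (p + q) r (nr_bracket p q P Q) R + sg (p * q) (nr_bracket q (p
        + r) Q (nr_bracket p r P R))"
proof -
  have V: "P \<in> V" "Q \<in> V" "R \<in> V" using assms H_subset by blast+
  show ?thesis
    using I_nr[OF P Q R] I_nr[OF P R Q] I_nr[OF Q R P]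
    by (auto simp: nr_bracket_def[of p "q+r"] nr_bracket_def[of "p+q" r] nr_bracket_def[of q "p+r"])
       (auto simp: nr_bracket_def sg_def bilinear V_intros V)
qed

text \<open>
The graph of \<open>\<theta>\<close> is closed under the bracket of the semidirect product.
\<close>

lemma theta_fn:
  assumes E: "E \<in> H m" and F: "F \<in> H n"
  shows "\<theta> (m + n) (fn_bracket m n E F) = nr_bracket m n (\<theta> m E) (\<theta> n F)"
proof -
  have V: "E \<in> V" "F \<in> V" using assms H_subset by blast+
  note d = delta_degree[OF E] delta_degree[OF F]
  have I0: "I 0 E = 0" "I 0 F = 0"
    using I_diff_left[of e e E] I_diff_left[of e e F] by (simp_all add: V V_e)
  note 1 = I_delta[OF d(1) F] I_delta[OF d(2) E] delta_cup[OF E F] C_skew[OF d(1) F] C_skew[OF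
      d(2) E]
  show ?thesis
    by (cases "even m"; cases "even n")
      (simp_all add: fn_bracket_def nr_bracket_def \<theta>_def sg_def bilinear V_intros V delta_delta[OF
          E] delta_delta[OF F] I0
        1 delta_add delta_diff delta_uminus)
qed

text \<open>
The first component of the Jacobi identity in the semidirect product; \<open>theta_fn\<close> gives
the second components of the inner brackets.
\<close>

lemma fn_jacobi:
  assumes E: "E \<in> H m" and F: "F \<in> H n" and G: "G \<in> H p"
  shows "fn_bracket m (n + p) E (fn_bracket n p F G) =
    fn_bracket (m + n) p (fn_bracket m n E F) G + sg (m * n) (fn_bracket n (m
        + p) F (fn_bracket m p E G))"
proof -
  have V: "E \<in> V" "F \<in> V" "G \<in> V" using assms H_subset by blast+
  note t = theta_degree[OF E, of m] theta_degree[OF F, of n] theta_degree[OF G, of p]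
  note [simp] = V_intros V
  note skew = C_skew[OF I_degree[OF t(1) G] F] C_skew[OF I_degree[OF t(1) F] G]
    C_skew[OF I_degree[OF t(2) G] E] C_skew[OF I_degree[OF t(2) E] G]
    C_skew[OF I_degree[OF t(3) E] F] C_skew[OF I_degree[OF t(3) F] E]
    note x = I_nr[OF t(1) t(2) G] I_nr[OF t(1) t(3) F] I_nr[OF t(2) t(3) E]
    I_derivation[OF t(1) F G] I_derivation[OF t(2) E G] I_derivation[OF t(3) E F]
    C_jacobi[OF E F G]
  show ?thesis
    unfolding fn_bracket_def[of m "n+p"] fn_bracket_def[of "m+n" p] fn_bracket_def[of n "m+p"]
        theta_fn[OF E F] theta_fn[OF E G] theta_fn[OF F G] x
    using skew
    by (cases "even m"; cases "even n"; cases "even p") (auto simp: fn_bracket_def sg_def bilinear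
        x)
qed

text \<open>
The first component of the Jacobi identity for \<open>(0, P)\<close>, \<open>(E, \<theta> E)\<close> and \<open>(F, \<theta> F)\<close>, where the mixed
brackets are decomposed by \<open>nr_theta\<close>.
\<close>

lemma I_fn:
  assumes P: "P \<in> H (Suc p)" and E: "E \<in> H m" and F: "F \<in> H n"
  shows "I P (fn_bracket m n E F) = fn_bracket (p + m) n (I P E) F + sg (p * m) (fn_bracket m (p
      + n) E (I P F))
    + sg ((p + m) * n) (I (fn_bracket n (Suc p) F P) E)
        - sg (p * m) (I (fn_bracket m (Suc p) E P) F)"
proof -
  have V: "P \<in> V" "E \<in> V" "F \<in> V" using assms H_subset by blast+
  have fV: "fn_bracket m (Suc p) E P \<in> V" "fn_bracket n (Suc p) F P \<in> V"
    using fn_degree[OF E P] fn_degree[OF F P] H_subset by blast+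
  note t = theta_degree[OF E, of m] theta_degree[OF F, of n]
  have 1: "I P (I (\<theta> m E) F) = sg (p * m) (I (\<theta> m E) (I P F)) + I (\<theta> (p + m) (I P E)) F
      - sg (p * m) (I (fn_bracket m (Suc p) E P) F)"
    using I_nr[OF P t(1) F] by (auto simp: nr_theta[OF P E] sg_def bilinear V_intros V fV
        algebra_simps)
  have 2: "I P (I (\<theta> n F) E) = sg (p * n) (I (\<theta> n F) (I P E)) + I (\<theta> (p + n) (I P F)) E
      - sg (p * n) (I (fn_bracket n (Suc p) F P) E)"
    using I_nr[OF P t(2) E] by (auto simp: nr_theta[OF P F] sg_def bilinear V_intros V fV
        algebra_simps)
  show ?thesis
    unfolding fn_bracket_def[of m n] fn_bracket_def[of "p+m"] fn_bracket_def[of m "p+n"]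
    by (cases "even m"; cases "even n"; cases "even p")
      (auto simp: sg_def bilinear V_intros V fV 1 2 I_derivation[OF P E F])
qed

text \<open>
The second component of the Jacobi identity for \<open>(E, \<theta> E)\<close>, \<open>(0, P)\<close> and \<open>(0, Q)\<close>: each bracket with
\<open>E\<close> is expressed by \<open>nr_theta\<close>, and the claim becomes the Jacobi identity for \<open>P\<close>, \<open>Q\<close> and \<open>\<theta> E\<close>.
\<close>

lemma fn_nr:
  assumes E: "E \<in> H n" and P: "P \<in> H (Suc p)" and Q: "Q \<in> H (Suc q)"
  shows "fn_bracket n (Suc (p + q)) E (nr_bracket p q P Q) =
    nr_bracket (n + p) q (fn_bracket n (Suc p) E P) Q + sg (n * p) (nr_bracket p (n
        + q) P (fn_bracket n (Suc q) E Q))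
    + sg ((n + p) * q) (fn_bracket (q + n) (Suc p) (I Q E) P) - sg (n * p) (fn_bracket (p
        + n) (Suc q) (I P E) Q)"
proof -
  have V: "P \<in> V" "E \<in> V" "Q \<in> V" using assms H_subset by blast+
  have fV: "fn_bracket n (Suc p) E P \<in> V" "fn_bracket n (Suc q) E Q \<in> V"
    using fn_degree[OF E P] fn_degree[OF E Q] H_subset by blast+
  note t = theta_degree[OF E, of n]
  note Y = I_degree[OF Q E] and X = I_degree[OF P E]
  have nV: "nr_bracket p q P Q \<in> V" using nr_degree[OF P Q] H_subset by blast
  note XV = V_I[OF V(1,2)] V_I[OF V(3,2)]
  have "sg ((p + q) * n) (fn_bracket n (Suc (p + q)) E (nr_bracket p q P Q)) =
      \<theta> (p + q + n) (I (nr_bracket p q P Q) E) - nr_bracket (p + q) n (nr_bracket p q P Q) (\<theta> n E)"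
    using nr_theta[OF nr_degree[OF P Q] E] by simp
  also have "\<theta> (p + q + n) (I (nr_bracket p q P Q) E) =
      \<theta> (p + (q + n)) (I P (I Q E)) - sg (p * q) (\<theta> (q + (p + n)) (I Q (I P E)))"
    unfolding I_nr[OF P Q E]
    by (auto simp: \<theta>_def sg_def delta_diff delta_add delta_uminus V_intros V XV)
  also have "\<theta> (p + (q + n)) (I P (I Q E)) =
      nr_bracket p (q + n) P (\<theta> (q + n) (I Q E)) + sg (p * (q + n)) (fn_bracket (q
          + n) (Suc p) (I Q E) P)"
    using nr_theta[OF P Y] by simp
  also have "\<theta> (q + (p + n)) (I Q (I P E)) =
      nr_bracket q (p + n) Q (\<theta> (p + n) (I P E)) + sg (q * (p + n)) (fn_bracket (p
          + n) (Suc q) (I P E) Q)"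
    using nr_theta[OF Q X] by simp
  also have "nr_bracket (p + q) n (nr_bracket p q P Q) (\<theta> n E) =
      nr_bracket p (q + n) P (nr_bracket q n Q (\<theta> n E)) - sg (p * q) (nr_bracket q (p
          + n) Q (nr_bracket p n P (\<theta> n E)))"
    using nr_jacobi[OF P Q t] by simp
  also have "nr_bracket p (q + n) P (nr_bracket q n Q (\<theta> n E)) =
      nr_bracket p (q + n) P (\<theta> (q + n) (I Q E)) - sg (q * n) (nr_bracket p (q
          + n) P (fn_bracket n (Suc q) E Q))"
    unfolding nr_theta[OF Q E] by (auto simp: nr_bracket_def sg_def bilinear V_intros V fV XV)
  also have "nr_bracket q (p + n) Q (nr_bracket p n P (\<theta> n E)) =
      nr_bracket q (p + n) Q (\<theta> (p + n) (I P E)) - sg (p * n) (nr_bracket q (p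
          + n) Q (fn_bracket n (Suc p) E P))"
    unfolding nr_theta[OF P E] by (auto simp: nr_bracket_def sg_def bilinear V_intros V fV XV)
  also have "nr_bracket q (p + n) Q (fn_bracket n (Suc p) E P) =
      - sg (q * (p + n)) (nr_bracket (n + p) q (fn_bracket n (Suc p) E P) Q)"
    using nr_skew[of q "p + n"] by (simp add: add.commute)
  finally show ?thesis
    by (cases "even p"; cases "even q"; cases "even n")
      (simp_all add: sg_def add.commute[of q n] algebra_simps)
qed
end

section \<open>The operations on cochains as shuffle sums\<close>

lemma shuffle_sum_first_empty: "shuffle_sum (\<lambda>ys zs. if ys = [] then g zs else 0) xs = g xs"
proof (induction xs arbitrary: g)
  case (Cons x xs)
  have "shuffle_sum (\<lambda>ys zs. if ys = [] then g zs else 0) (x # xs) =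
      shuffle_sum (\<lambda>ys zs. 0) xs + shuffle_sum (\<lambda>ys zs. sg (length ys) (if ys
          = [] then g (x # zs) else 0)) xs"
    by simp
  also have "shuffle_sum (\<lambda>ys zs. sg (length ys) (if ys = [] then g (x # zs) else 0)) xs =
      shuffle_sum (\<lambda>ys zs. if ys = [] then g (x # zs) else 0) xs"
    by (rule shuffle_sum_cong) (simp add: sg_def)
  finally show ?case by (simp add: shuffle_sum_zero Cons.IH)
qed simp

lemma nths_Cons_Compl_0: "nths (x # xs) (- {0}) = xs"
  and nths_Cons_Compl_Suc: "nths (x # xs) (- {Suc i}) = x # nths xs (- {i})"
  and nths_Cons_Compl_0_Suc: "nths (x # xs) (- {0, Suc i}) = nths xs (- {i})"
  and nths_Cons_Compl_Suc_Suc: "nths (x # xs) (- {Suc i, Suc j}) = x # nths xs (- {i, j})"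
proof -
  have "{j. Suc j \<in> - {0}} = UNIV" "{j. Suc j \<in> - {Suc i}} = - {i}"
    "{j. Suc j \<in> - {0, Suc i}} = - {i}" "{k. Suc k \<in> - {Suc i, Suc j}} = - {i, j}" by auto
  then show "nths (x # xs) (- {0}) = xs" "nths (x # xs) (- {Suc i}) = x # nths xs (- {i})"
    "nths (x # xs) (- {0, Suc i}) = nths xs (- {i})"
    "nths (x # xs) (- {Suc i, Suc j}) = x # nths xs (- {i, j})"
    by (simp_all add: nths_Cons nths_all)
qed

lemma sg_0: "sg 0 v = v"
  by (simp add: sg_def)
lemma sg_Suc: "sg (Suc k) v = - sg k v"
  by (simp add: sg_def)
lemma sg_sum: "(\<Sum>i\<in>A. sg k (f i)) = sg k (\<Sum>i\<in>A. f i)"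
  by (simp add: sg_def sum_negf)

text \<open>
A splitting with a short first part is given by the positions of the elements of this part.  In this form
such splittings occur in the differential.
\<close>

lemma shuffle_sum_first_single:
  "shuffle_sum (\<lambda>ys zs. if length ys = 1 then G (hd ys) zs else 0) xs =
    (\<Sum>i<length xs. sg i (G (xs ! i) (nths xs (- {i}))))"
proof (induction xs arbitrary: G)
  case (Cons x xs)
  have "shuffle_sum (\<lambda>ys zs. if length ys = 1 then G (hd ys) zs else 0) (x # xs) =
      shuffle_sum (\<lambda>ys zs. if length (x # ys) = 1 then G (hd (x # ys)) zs else 0) xs +
      shuffle_sum (\<lambda>ys zs. sg (length ys) (if length ys = 1 then G (hd ys) (x # zs) else 0)) xs"
    by (rule shuffle_sum.simps(2))
  also have "shuffle_sum (\<lambda>ys zs. if length (x # ys) = 1 then G (hd (x # ys)) zs else 0) xs =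
      shuffle_sum (\<lambda>ys zs. if ys = [] then G x zs else 0) xs"
    by (rule shuffle_sum_cong) auto
  also have "\<dots> = G x xs"
    by (rule shuffle_sum_first_empty)
  also have "shuffle_sum (\<lambda>ys zs. sg (length ys) (if length ys
      = 1 then G (hd ys) (x # zs) else 0)) xs =
      shuffle_sum (\<lambda>ys zs. - (if length ys = 1 then G (hd ys) (x # zs) else 0)) xs"
    by (rule shuffle_sum_cong) (simp add: sg_def)
  also have "\<dots> = - (\<Sum>i<length xs. sg i (G (xs ! i) (x # nths xs (- {i}))))"
    unfolding shuffle_sum_uminus Cons.IH[of "\<lambda>v zs. G v (x # zs)"] ..
  finally show ?case
    unfolding list.size(4) add_0_right add_Suc_right sum.lessThan_Suc_shift
    by (simp add: nths_Cons_Compl_0 nths_Cons_Compl_Suc sg_Suc sg_0 sum_negf)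
qed simp

lemma shuffle_sum_first_pair:
  "shuffle_sum (\<lambda>ys zs. if length ys = 2 then G (ys ! 0) (ys ! 1) zs else 0) xs =
    - (\<Sum>j<length xs. \<Sum>i<j. sg (i + j) (G (xs ! i) (xs ! j) (nths xs (- {i, j}))))"
proof (induction xs arbitrary: G)
  case (Cons x xs)
  have "shuffle_sum (\<lambda>ys zs. if length ys = 2 then G (ys ! 0) (ys ! 1) zs else 0) (x # xs) =
      shuffle_sum (\<lambda>ys zs. if length (x # ys) = 2 then G ((x # ys) ! 0) ((x # ys) ! 1) zs else 0)
          xs +
      shuffle_sum (\<lambda>ys zs. sg (length ys) (if length ys
          = 2 then G (ys ! 0) (ys ! 1) (x # zs) else 0)) xs"
    by (rule shuffle_sum.simps(2))
  also have "shuffle_sum (\<lambda>ys zs. if length (x # ys)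
      = 2 then G ((x # ys) ! 0) ((x # ys) ! 1) zs else 0) xs =
      shuffle_sum (\<lambda>ys zs. if length ys = 1 then G x (hd ys) zs else 0) xs"
    by (rule shuffle_sum_cong) (auto simp: length_Suc_conv)
  also have "\<dots> = (\<Sum>j<length xs. sg j (G x (xs ! j) (nths xs (- {j}))))"
    by (rule shuffle_sum_first_single)
  also have "shuffle_sum (\<lambda>ys zs. sg (length ys) (if length ys
      = 2 then G (ys ! 0) (ys ! 1) (x # zs) else 0)) xs =
      shuffle_sum (\<lambda>ys zs. if length ys = 2 then G (ys ! 0) (ys ! 1) (x # zs) else 0) xs"
    by (rule shuffle_sum_cong) (simp add: sg_def)
  also have "\<dots> = - (\<Sum>j<length xs. \<Sum>i<j. sg (i + j) (G (xs ! i) (xs ! j) (x # nths xs (- {i, j}))))"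
    by (rule Cons.IH[of "\<lambda>u v zs. G u v (x # zs)"])
  finally show ?case
    unfolding list.size(4) add_0_right add_Suc_right sum.lessThan_Suc_shift
    by (simp add: nths_Cons_Compl_0_Suc nths_Cons_Compl_Suc_Suc sg_Suc sg_0 sum_negf sum.distrib
        sum_subtractf
       del: sum.lessThan_Suc)
qed simp

definition has_arity :: "nat \<Rightarrow> ('v list \<Rightarrow> 'w::ab_group_add) \<Rightarrow> bool"
  where "has_arity n P \<longleftrightarrow> (\<forall>xs. length xs \<noteq> n \<longrightarrow> P xs = 0)"

lemma has_arityD: "has_arity n P \<Longrightarrow> length xs \<noteq> n \<Longrightarrow> P xs = 0"
  by (simp add: has_arity_def)

lemma arity_parity: "has_arity n P \<Longrightarrow> has_parity n P"
  unfolding has_arity_def has_parity_def by metis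

lemma has_arity_comp: "has_arity n P \<Longrightarrow> h 0 = 0 \<Longrightarrow> has_arity n (\<lambda>xs. h (P xs))"
  by (simp add: has_arity_def)

definition unit_cochain :: "'v::ab_group_add list \<Rightarrow> 'v"
  where "unit_cochain xs = (if length xs = 1 then hd xs else 0)"

context hom_lie_algebra
begin

definition bracket_cochain :: "'v list \<Rightarrow> 'v"
  where "bracket_cochain xs = (if length xs = 2 then br (xs ! 0) (xs ! 1) else 0)"

definition equivariant :: "('v list \<Rightarrow> 'v) \<Rightarrow> bool"
  where "equivariant P \<longleftrightarrow> (\<forall>xs. \<alpha> (P xs) = P (map \<alpha> xs))"

lemma alpha_zero [simp]: "\<alpha> 0 = 0"
  by (rule additive_0) (rule alpha_add)

lemma alpha_pow_add: "(\<alpha> ^^ k) (x + y) = (\<alpha> ^^ k) x + (\<alpha> ^^ k) y"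
  and alpha_pow_scale: "(\<alpha> ^^ k) (scale c x) = scale c ((\<alpha> ^^ k) x)"
  and alpha_pow_br: "(\<alpha> ^^ k) (br x y) = br ((\<alpha> ^^ k) x) ((\<alpha> ^^ k) y)"
  by (induction k) (simp_all add: alpha_add alpha_scale multiplicative)

lemma alpha_pow_zero [simp]: "(\<alpha> ^^ k) 0 = 0"
  by (rule additive_0) (rule alpha_pow_add)

lemma scale_sign: "scale (of_int (sign \<sigma>)) v = (if sign \<sigma> = 1 then id else uminus) v"
  by (cases \<sigma> rule: sign_cases) simp_all

lemma scale_sg: "scale ((- 1) ^ k) v = sg k v"
  by (simp add: sg_def)

lemma no_two_torsion_scale:
  fixes v :: 'v
  shows "v + v = 0 \<Longrightarrow> v = 0"
  using scale_left_distrib[of 1 1 v] by (simp add: scale_eq_0_iff)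

text \<open>
Exchanging neighbours moves the first \<open>x\<close> to the right until it meets the second one.
\<close>

lemma alternating_repeated:
  assumes "alternating P" shows "P (us @ x # vs @ x # ws) = 0"
proof (induction vs arbitrary: us)
  case Nil
  have "P (us @ x # x # ws) = - P (us @ x # x # ws)"
    using assms unfolding alternating_def by blast
  then have "P (us @ x # x # ws) + P (us @ x # x # ws) = 0" by (simp only: eq_neg_iff_add_eq_0)
  then have "P (us @ x # x # ws) = 0" by (rule no_two_torsion_scale)
  then show ?case by simp
next
  case (Cons v vs)
  have "P (us @ x # v # (vs @ x # ws)) = - P (us @ v # x # (vs @ x # ws))"
    using assms unfolding alternating_def by blast
  then show ?case using Cons.IH[of "us @ [v]"] by simp
qed

lemma hom_cochains_arity: "P \<in> hom_cochains scale \<alpha> n \<Longrightarrow> has_arity n P"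
  by (simp add: hom_cochains_def has_arity_def)

lemma hom_cochains_equivariant: "P \<in> hom_cochains scale \<alpha> n \<Longrightarrow> equivariant P"
  unfolding equivariant_def hom_cochains_def by (metis (mono_tags, lifting) alpha_zero length_map
      mem_Collect_eq)

lemma hom_cochains_alternating:
  assumes "P \<in> hom_cochains scale \<alpha> n"
  shows "alternating P"
proof -
  have ar: "length xs \<noteq> n \<Longrightarrow> P xs = 0" for xs using assms by (simp add: hom_cochains_def)
  have lin: "Vector_Spaces.linear scale scale (\<lambda>v. P (us @ v # ws))" if "length us
      + Suc (length ws) = n" for us ws
  proof -
    have "Vector_Spaces.linear scale scale (\<lambda>v. P ((us @ 0 # ws)[length us := v]))"
      using assms that unfolding hom_cochains_def by (auto simp del: list_update_length)
    then show ?thesis by simp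
  qed
  have add: "P (us @ (u + v) # ws) = P (us @ u # ws) + P (us @ v # ws)" for us u v ws
  proof (cases "length us + Suc (length ws) = n")
    case True
    from lin[OF this] show ?thesis unfolding Vector_Spaces.linear_def module_hom_iff by blast
  qed (simp add: ar)
  have sc: "P (us @ scale c u # ws) = scale c (P (us @ u # ws))" for us u c ws
  proof (cases "length us + Suc (length ws) = n")
    case True
    from lin[OF this] show ?thesis unfolding Vector_Spaces.linear_def module_hom_iff by blast
  qed (simp add: ar)
  have rep: "P (us @ u # u # ws) = 0" for us u ws
  proof (cases "length us + Suc (Suc (length ws)) = n")
    case True
    have "\<And>i j. i < n \<Longrightarrow> j < n \<Longrightarrow> i \<noteq> j \<Longrightarrow> (us @ u # u # ws) ! i = (us @ u # u # ws) ! j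
        \<Longrightarrow> P (us @ u # u # ws) = 0"
      using assms True unfolding hom_cochains_def by auto
    from this[of "length us" "Suc (length us)"] True show ?thesis by (simp add: nth_append)
  qed (simp add: ar)
  have "P (us @ u # v # ws) = - P (us @ v # u # ws)" for us u v ws
  proof -
    \<comment> \<open>polarization\<close>
    have "0 = P (us @ (u + v) # (u + v) # ws)" by (simp add: rep)
    also have "\<dots> = P (us @ u # (u + v) # ws) + P (us @ v # (u + v) # ws)" by (rule add)
    also have "P (us @ u # (u + v) # ws) = P (us @ u # v # ws)"
      using add[of "us @ [u]" u v ws] by (simp add: rep)
    also have "P (us @ v # (u + v) # ws) = P (us @ v # u # ws)"
      using add[of "us @ [v]" u v ws] by (simp add: rep)
    finally show ?thesis by (simp add: eq_neg_iff_add_eq_0)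
  qed
  then show ?thesis unfolding alternating_def using add sc by blast
qed

lemma hom_cochainsI:
  assumes ar: "has_arity n P" and alt: "alternating P" and eq: "equivariant P"
  shows "P \<in> hom_cochains scale \<alpha> n"
proof -
  have "Vector_Spaces.linear scale scale (\<lambda>v. P (xs[i := v]))" if "i < n" "length xs = n" for xs i
  proof -
    have "P (us @ (u + v) # ws) = P (us @ u # ws) + P (us @ v # ws)"
      "P (us @ scale c u # ws) = scale c (P (us @ u # ws))" for us u v ws c
      using alt unfolding alternating_def by blast+
    then show ?thesis
      using that vector_space_axioms module_axioms unfolding Vector_Spaces.linear_def module_hom_iff
      by (simp add: upd_conv_take_nth_drop)
  qed
  moreover have "P xs = 0" if "i < n" "j < n" "length xs = n" "i \<noteq> j" "xs ! i = xs ! j" for xs i j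
  proof -
    have *: "P xs = 0" if "i < j" "j < length xs" "xs ! i = xs ! j" for i j
    proof -
      have "xs = take i xs @ xs ! i # drop (Suc i) xs" by (rule id_take_nth_drop) (use that in simp)
      also have "drop (Suc i) xs = take (j - Suc i) (drop (Suc i) xs) @ xs ! j # drop (Suc j) xs"
        using id_take_nth_drop[of "j - Suc i" "drop (Suc i) xs"] that by simp
      finally have "xs = take i xs @ xs ! i # take (j
          - Suc i) (drop (Suc i) xs) @ xs ! i # drop (Suc j) xs"
        using that by simp
      then show ?thesis using alternating_repeated[OF alt] by metis
    qed
    show ?thesis using *[of i j] *[of j i] that by (cases i j rule: linorder_cases) auto
  qed
  ultimately show ?thesis
    using ar eq unfolding hom_cochains_def has_arity_def equivariant_def by blast
qed

lemma has_arity_insert_sum: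
  assumes "has_arity (Suc p) P" "has_arity n Q" "alternating Q"
  shows "has_arity (p + n) (insert_sum f P Q)"
  unfolding has_arity_def
proof (intro allI impI)
  fix xs :: "'v list" assume l: "length xs \<noteq> p + n"
  have "shuffle_sum (\<lambda>ys zs. Q (P ys # map f zs)) xs = shuffle_sum (\<lambda>ys zs. 0) xs"
  proof (rule shuffle_sum_cong)
    fix ys zs :: "'v list" assume "length ys + length zs = length xs"
    then have "length ys \<noteq> Suc p \<or> length (P ys # map f zs) \<noteq> n" using l by auto
    then show "Q (P ys # map f zs) = 0"
      using has_arityD[OF assms(1), of ys] has_arityD[OF assms(2), of "P ys # map f zs"]
          alternating_head_zero[OF assms(3)]
      by auto
  qed
  then show "insert_sum f P Q xs = 0" by (simp add: insert_sum_def shuffle_sum_zero)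
qed

lemma has_arity_cup_sum:
  assumes "has_arity m P" "has_arity n Q"
  shows "has_arity (m + n) (cup_sum P Q)"
  unfolding has_arity_def
proof (intro allI impI)
  fix xs :: "'v list" assume l: "length xs \<noteq> m + n"
  have "shuffle_sum (\<lambda>ys zs. br (P ys) (Q zs)) xs = shuffle_sum (\<lambda>ys zs. 0) xs"
  proof (rule shuffle_sum_cong)
    fix ys zs :: "'v list" assume "length ys + length zs = length xs"
    then have "length ys \<noteq> m \<or> length zs \<noteq> n" using l by auto
    then show "br (P ys) (Q zs) = 0"
      using has_arityD[OF assms(1), of ys] has_arityD[OF assms(2), of zs] by auto
  qed
  then show "cup_sum P Q xs = 0" by (simp add: cup_sum_def shuffle_sum_zero)
qed

lemma ins_eq_insert_sum:
  assumes P: "has_arity (Suc p) P" and Q: "has_arity n Q" "alternating Q" "0 < n"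
  shows "ins scale \<alpha> (Suc p) n P Q = insert_sum (\<alpha> ^^ p) P Q"
proof
  fix xs
  show "ins scale \<alpha> (Suc p) n P Q xs = insert_sum (\<alpha> ^^ p) P Q xs"
  proof (cases "length xs = p + n")
    case True
    then have l: "length xs = Suc p + (n - 1)" "length xs = Suc p + n - 1" using Q(3) by auto
    have n: "Suc p + n - 1 = Suc p + (n - 1)" using Q(3) by simp
    have m: "map (\<lambda>i. (\<alpha> ^^ p) (xs ! \<sigma> i)) is = map (\<alpha> ^^ p) (map (\<lambda>i. xs ! \<sigma> i) is)" for \<sigma> "is"
      by simp
    have "ins scale \<alpha> (Suc p) n P Q xs =
        shuffle_sum (\<lambda>ys zs. if length ys = Suc p then Q (P ys # map (\<alpha> ^^ p) zs) else 0) xs"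
      unfolding ins_def if_P[OF l(2)] unfolding n m diff_Suc_1 scale_sign
        sum_Sh_eq_shuffle_sum[OF l(1), symmetric] ..
    also have "\<dots> = insert_sum (\<alpha> ^^ p) P Q xs"
      unfolding insert_sum_def
      by (rule shuffle_sum_cong) (use has_arityD[OF P] in \<open>simp
          add: alternating_head_zero[OF Q(2)]\<close>)
    finally show ?thesis .
  next
    case False
    then have "length xs \<noteq> Suc p + n - 1" by simp
    then show ?thesis
      using has_arityD[OF has_arity_insert_sum[OF P Q(1,2)] False] by (simp add: ins_def)
  qed
qed

lemma cup_eq_cup_sum:
  assumes P: "has_arity m P" and Q: "has_arity n Q"
  shows "cup scale br \<alpha> m n P Q = cup_sum (\<lambda>ys. (\<alpha> ^^ (n - 1)) (P ys)) (\<lambda>zs. (\<alpha> ^^ (m - 1)) (Q zs))"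
proof
  fix xs
  let ?P = "\<lambda>ys. (\<alpha> ^^ (n - 1)) (P ys)" and ?Q = "\<lambda>zs. (\<alpha> ^^ (m - 1)) (Q zs)"
  have PQ: "has_arity m ?P" "has_arity n ?Q"
    by (rule has_arity_comp[OF P], simp) (rule has_arity_comp[OF Q], simp)
  show "cup scale br \<alpha> m n P Q xs = cup_sum ?P ?Q xs"
  proof (cases "length xs = m + n")
    case True
    have "cup scale br \<alpha> m n P Q xs = shuffle_sum (\<lambda>ys zs. if length ys
        = m then br (?P ys) (?Q zs) else 0) xs"
      unfolding cup_def scale_sign if_P[OF True] sum_Sh_eq_shuffle_sum[OF True, symmetric] ..
    also have "\<dots> = cup_sum ?P ?Q xs"
      unfolding cup_sum_def by (rule shuffle_sum_cong) (use has_arityD[OF P] in simp)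
    finally show ?thesis .
  next
    case False
    then show ?thesis
      using has_arityD[OF has_arity_cup_sum[OF PQ] False] by (simp add: cup_def)
  qed
qed

text \<open>
The two sums of the differential are the cup product with the identity and the insertion of
the bracket: \<open>\<delta> P = [e, P] - i\<^sub>\<mu> P\<close>.
\<close>

lemma hom_delta_eq:
  assumes P: "has_arity m P" "alternating P"
  shows "hom_delta scale br \<alpha> m P =
    cup_sum (\<lambda>ys. (\<alpha> ^^ (m - 1)) (unit_cochain ys)) P - insert_sum \<alpha> bracket_cochain P"
proof
  fix xs
  let ?A = "\<lambda>xs. \<Sum>i<length xs. scale ((- 1) ^ i) (br ((\<alpha> ^^ (m
      - 1)) (xs ! i)) (P (nths xs (- {i}))))"
  let ?B = "\<lambda>xs. \<Sum>j<length xs. \<Sum>i<j. scale ((- 1) ^ (i + j))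
        (P (br (xs ! i) (xs ! j) # map \<alpha> (nths xs (- {i, j}))))"
  have u: "has_arity 1 (\<lambda>ys. (\<alpha> ^^ (m - 1)) (unit_cochain ys))"
    by (rule has_arity_comp) (simp_all add: has_arity_def unit_cochain_def)
  have b: "has_arity (Suc 1) bracket_cochain" by (simp add: has_arity_def bracket_cochain_def)
  have A: "cup_sum (\<lambda>ys. (\<alpha> ^^ (m - 1)) (unit_cochain ys)) P xs = ?A xs"
    unfolding scale_sg cup_sum_def
      shuffle_sum_first_single[of "\<lambda>x zs. br ((\<alpha> ^^ (m - 1)) x) (P zs)", symmetric]
    by (rule shuffle_sum_cong) (simp add: unit_cochain_def)
  have B: "insert_sum \<alpha> bracket_cochain P xs = - ?B xs"
    unfolding scale_sg insert_sum_def
      shuffle_sum_first_pair[of "\<lambda>x y zs. P (br x y # map \<alpha> zs)", symmetric]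
    by (rule shuffle_sum_cong) (simp add: bracket_cochain_def alternating_head_zero[OF P(2)])
  show "hom_delta scale br \<alpha> m P xs =
    (cup_sum (\<lambda>ys. (\<alpha> ^^ (m - 1)) (unit_cochain ys)) P - insert_sum \<alpha> bracket_cochain P) xs"
  proof (cases "length xs = m + 1")
    case True
    then show ?thesis using A B by (simp add: hom_delta_def del: sum.lessThan_Suc)
  next
    case False
    then show ?thesis
      using has_arityD[OF has_arity_cup_sum[OF u P(1)], of xs] has_arityD[OF
          has_arity_insert_sum[OF b P], of xs]
      by (simp add: hom_delta_def)
  qed
qed

end

section \<open>Bilinear extension to sums of cochains\<close>

lemma vector_space_cscale:
  assumes "vector_space scale" shows "vector_space (cscale scale)"
proof -
  interpret vector_space scale by fact
  show ?thesis
    by unfold_locales (auto simp: cscale_def fun_eq_iff scale_right_distrib scale_left_distrib)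
qed

lemma shuffle_sum_second_empty: "shuffle_sum (\<lambda>ys zs. if zs = [] then g ys else 0) xs = g xs"
proof (induction xs arbitrary: g)
  case (Cons x xs)
  then show ?case using Cons.IH[of "\<lambda>ys. g (x # ys)"] by (simp add: shuffle_sum_zero)
qed simp

lemma arity_part_add: "arity_part n (P + Q) = arity_part n P + arity_part n Q"
  and arity_part_zero: "arity_part n 0 = 0"
  by (auto simp: arity_part_def fun_eq_iff)

lemma arity_part_scale:
  assumes "vector_space s" shows "arity_part n (cscale s c P) = cscale s c (arity_part n P)"
proof -
  interpret vector_space s by fact
  show ?thesis by (auto simp: arity_part_def cscale_def fun_eq_iff)
qed

lemma arity_part_homogeneous: "has_arity m P \<Longrightarrow> arity_part n P = (if n = m then P else 0)"
  by (auto simp: has_arity_def arity_part_def fun_eq_iff)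

lemma bilinear_onD:
  assumes "bilinear_on s1 s2 s3 U V f" "x \<in> U" "y \<in> V"
  shows "x' \<in> U \<Longrightarrow> f (x + x') y = f x y + f x' y"
    and "y' \<in> V \<Longrightarrow> f x (y + y') = f x y + f x y'"
    and "f (s1 c x) y = s3 c (f x y)" and "f x (s2 c y) = s3 c (f x y)"
  using assms unfolding bilinear_on_def by blast+

lemma bilinear_on_swap:
  "bilinear_on s1 s2 s3 U V f \<Longrightarrow> bilinear_on s2 s1 s3 V U (\<lambda>x y. f y x)"
  unfolding bilinear_on_def by blast

lemma bilinear_on_add:
  assumes "vector_space s" "bilinear_on s1 s2 s U V f" "bilinear_on s1 s2 s U V g"
  shows "bilinear_on s1 s2 s U V (\<lambda>x y. f x y + g x y)"
proof -
  interpret vector_space s by fact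
  show ?thesis
    unfolding bilinear_on_def
    by (simp add: bilinear_onD[OF assms(2)] bilinear_onD[OF assms(3)] scale_right_distrib add_ac)
qed

lemma bilinear_on_scale:
  assumes "vector_space s" "bilinear_on s1 s2 s U V f"
  shows "bilinear_on s1 s2 s U V (\<lambda>x y. s c (f x y))"
proof -
  interpret vector_space s by fact
  show ?thesis
    unfolding bilinear_on_def
    by (simp add: bilinear_onD[OF assms(2)] scale_right_distrib mult.commute)
qed

lemma bilinear_on_diff:
  assumes "vector_space s" "bilinear_on s1 s2 s U V f" "bilinear_on s1 s2 s U V g"
  shows "bilinear_on s1 s2 s U V (\<lambda>x y. f x y - g x y)"
proof -
  interpret vector_space s by fact
  have "f x y - g x y = f x y + s (- 1) (g x y)" for x y by simp
  then show ?thesis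
    using bilinear_on_add[OF assms(1,2) bilinear_on_scale[OF assms(1,3), of "- 1"]] by simp
qed

context hom_lie_algebra
begin

lemma alternating_zero: "alternating 0"
  by (simp add: alternating_def)

lemma alternating_add:
  assumes "alternating P" "alternating Q" shows "alternating (P + Q)"
  unfolding alternating_def plus_fun_apply
proof (intro conjI allI)
  fix us u v ws
  show "P (us @ u # v # ws) + Q (us @ u # v # ws) = - (P (us @ v # u # ws) + Q (us @ v # u # ws))"
    unfolding alternatingD(3)[OF assms(1), of us u v] alternatingD(3)[OF assms(2), of us u v]
        by simp
qed (simp_all add: alternatingD(1,2)[OF assms(1)] alternatingD(1,2)[OF assms(2)]
    scale_right_distrib add_ac)

lemma alternating_comp:
  assumes P: "alternating P" and h: "\<And>u v. h (u + v) = h u + h v" "\<And>c u. h (scale c u)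
      = scale c (h u)"
  shows "alternating (\<lambda>xs. h (P xs))"
proof -
  note P = alternatingD[OF P]
  have m: "h (- u) = - h u" for u by (rule additive_uminus) (rule h)
  show ?thesis unfolding alternating_def
  proof (intro conjI allI)
    fix us u v ws
    show "h (P (us @ u # v # ws)) = - h (P (us @ v # u # ws))"
      unfolding P(3)[of us u v ws] m ..
  qed (simp_all add: P(1,2) h)
qed

lemma alternating_cscale: "alternating P \<Longrightarrow> alternating (cscale scale c P)"
  unfolding cscale_def by (rule alternating_comp) (simp_all add: scale_right_distrib mult.commute)

abbreviation cs where "cs \<equiv> cscale scale"
abbreviation Cg where "Cg \<equiv> C_gr scale \<alpha>"
abbreviation Ctot where "Ctot \<equiv> graded_total cs Cg"

lemma vs_cs: "vector_space cs"
  by (rule vector_space_cscale) (rule vector_space_axioms)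

sublocale cochains: vector_space cs
  by (rule vs_cs)

lemma cs_sg: "cs ((- 1) ^ k) P = sg k P"
  by (simp add: cscale_def fun_eq_iff sg_def)

text \<open>
The condition on the value at the empty list excludes nonzero constants in degree 0.
\<close>

lemma C_gr_iff: "P \<in> Cg n \<longleftrightarrow> has_arity n P \<and> alternating P \<and> equivariant P \<and> P [] = 0"
proof (cases "n = 0")
  case True
  have "P = 0" if "has_arity 0 P" "P [] = 0"
  proof
    fix xs show "P xs = 0 xs" using that by (cases "xs = []") (simp_all add: has_arity_def)
  qed
  then show ?thesis
    using True by (auto simp: C_gr_def has_arity_def alternating_zero equivariant_def)
next
  case False
  then have "P [] = 0" if "has_arity n P" using that by (simp add: has_arity_def)
  then show ?thesis
    using False hom_cochainsI[of n P] hom_cochains_arity[of P n] hom_cochains_alternating[of P n]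
      hom_cochains_equivariant[of P n] by (auto simp: C_gr_def)
qed

lemma C_gr_D:
  assumes "P \<in> Cg n"
  shows "has_arity n P" "alternating P" "equivariant P" "P [] = 0"
  using assms by (simp_all add: C_gr_iff)

lemma C_gr_0: "P \<in> Cg 0 \<Longrightarrow> P = 0"
  by (simp add: C_gr_def)

lemma C_gr_zero: "0 \<in> Cg n"
  by (simp add: C_gr_iff has_arity_def alternating_zero equivariant_def)

lemma C_gr_add: "P \<in> Cg n \<Longrightarrow> Q \<in> Cg n \<Longrightarrow> P + Q \<in> Cg n"
  by (simp add: C_gr_iff has_arity_def alternating_add equivariant_def alpha_add)

lemma C_gr_scale: "P \<in> Cg n \<Longrightarrow> cs c P \<in> Cg n"
  by (simp add: C_gr_iff has_arity_def alternating_cscale) (simp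
      add: cscale_def equivariant_def alpha_scale)

lemma C_gr_uminus: "P \<in> Cg n \<Longrightarrow> - P \<in> Cg n"
  using C_gr_scale[of P n "- 1"] by simp

lemma subspace_C_gr: "cochains.subspace (Cg n)"
  by (simp add: cochains.subspace_def C_gr_zero C_gr_add C_gr_scale)

lemma C_gr_shift_eq: "C_gr_shift scale \<alpha> n = Cg (Suc n)"
  by (simp add: C_gr_shift_def C_gr_def)

lemma total_shift_eq: "graded_total cs (C_gr_shift scale \<alpha>) = Ctot"
proof -
  have "(\<Union>n. C_gr_shift scale \<alpha> n) = (\<Union>n. Cg n)"
    unfolding C_gr_shift_eq
  proof (intro equalityI subsetI)
    fix P assume "P \<in> (\<Union>n. Cg n)"
    then obtain n where n: "P \<in> Cg n" by auto
    show "P \<in> (\<Union>n. Cg (Suc n))"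
    proof (cases n)
      case 0
      then show ?thesis using C_gr_0[of P] C_gr_zero n by auto
    qed (use n in auto)
  qed auto
  then show ?thesis by (simp add: graded_total_def)
qed

lemma C_gr_subset: "P \<in> Cg n \<Longrightarrow> P \<in> Ctot"
  unfolding graded_total_def by (rule cochains.span_base) auto

lemma subspace_W: "cochains.subspace Ctot"
  unfolding graded_total_def by (rule cochains.subspace_span)

text \<open>
The indices that occur in the definition of \<^const>\<open>bilin_ext\<close>.
\<close>

abbreviation arity_support where "arity_support P \<equiv> {n. arity_part n P \<noteq> 0}"

lemma total_D:
  assumes "P \<in> Ctot"
  shows "finite (arity_support P)" "arity_part n P \<in> Cg n"
proof -
  have "finite (arity_support P) \<and> (\<forall>n. arity_part n P \<in> Cg n)"
    using assms unfolding graded_total_def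
  proof (induction rule: cochains.span_induct_alt)
    case base
    have "finite (arity_support 0)" unfolding arity_part_zero by simp
    then show ?case unfolding arity_part_zero using C_gr_zero by blast
  next
    case (step c P Q)
    then obtain m where m: "P \<in> Cg m" by auto
    have p: "arity_part n (cs c P + Q) = cs c (if n = m then P else 0) + arity_part n Q" for n
      by (simp add: arity_part_add arity_part_scale[OF vector_space_axioms]
          arity_part_homogeneous[OF C_gr_D(1)[OF m]])
    have "arity_support (cs c P + Q) \<subseteq> insert m (arity_support Q)"
      by (auto simp: p split: if_splits)
    moreover have "finite (insert m (arity_support Q))" using step by blast
    ultimately have "finite (arity_support (cs c P + Q))" by (rule finite_subset)
    moreover have "arity_part n (cs c P + Q) \<in> Cg n" for n
      unfolding p using step m by (intro C_gr_add C_gr_scale) (auto simp: C_gr_zero)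
    ultimately show ?case by blast
  qed
  then show "finite (arity_support P)" "arity_part n P \<in> Cg n" by auto
qed

text \<open>
The operations are only required to be bilinear on cochains of the arities for which they are
meant; this suffices for their extension to be bilinear on all sums of cochains.
\<close>

abbreviation bilinear_operation where
  "bilinear_operation f \<equiv> \<forall>m n. bilinear_on cs cs cs (Cg m) (Cg n) (f m n)"

lemma bilinear_operation_zero:
  assumes "bilinear_operation f" "P \<in> Cg m" "Q \<in> Cg n"
  shows "f m n 0 Q = 0" "f m n P 0 = 0"
proof -
  have b: "bilinear_on cs cs cs (Cg m) (Cg n) (f m n)" using assms(1) by blast
  show "f m n 0 Q = 0"
    using bilinear_onD(3)[OF b assms(2,3), of 0] by simp
  show "f m n P 0 = 0"
    using bilinear_onD(4)[OF b assms(2,3), of 0] by simp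
qed

lemma bilin_ext_eq_sum:
  assumes f: "bilinear_operation f" and P: "P \<in> Ctot" and Q: "Q \<in> Ctot"
    and A: "finite A" "arity_support P \<subseteq> A" and B: "finite B" "arity_support Q \<subseteq> B"
  shows "bilin_ext f P Q = (\<Sum>m\<in>A. \<Sum>n\<in>B. f m n (arity_part m P) (arity_part n Q))"
proof -
  have z: "f m n (arity_part m P) (arity_part n Q) = 0" if "arity_part m P = 0 \<or> arity_part n Q
      = 0" for m n
    using that bilinear_operation_zero(2)[OF f total_D(2)[OF P] C_gr_zero]
      bilinear_operation_zero(1)[OF f C_gr_zero total_D(2)[OF Q]] by metis
  have "(\<Sum>n\<in>arity_support Q. f m n (arity_part m P) (arity_part n Q)) =
      (\<Sum>n\<in>B. f m n (arity_part m P) (arity_part n Q))" for m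
    by (rule sum.mono_neutral_left[OF B]) (use z in blast)
  then have "bilin_ext f P Q = (\<Sum>m\<in>arity_support P. \<Sum>n\<in>B. f m n (arity_part m P) (arity_part n Q))"
    unfolding bilin_ext_def by (rule sum.cong[OF refl])
  also have "\<dots> = (\<Sum>m\<in>A. \<Sum>n\<in>B. f m n (arity_part m P) (arity_part n Q))"
  proof (rule sum.mono_neutral_left[OF A], rule ballI)
    fix m assume "m \<in> A - arity_support P"
    then show "(\<Sum>n\<in>B. f m n (arity_part m P) (arity_part n Q)) = 0"
      by (intro sum.neutral ballI z) blast
  qed
  finally show ?thesis .
qed

lemma bilin_ext_homogeneous:
  assumes f: "bilinear_operation f" and P: "P \<in> Cg m" and Q: "Q \<in> Cg n"
  shows "bilin_ext f P Q = f m n P Q"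
proof -
  note p = arity_part_homogeneous[OF C_gr_D(1)[OF P]] and q
      = arity_part_homogeneous[OF C_gr_D(1)[OF Q]]
  have "bilin_ext f P Q = (\<Sum>m\<in>{m}. \<Sum>n\<in>{n}. f m n (arity_part m P) (arity_part n Q))"
    by (rule bilin_ext_eq_sum[OF f C_gr_subset[OF P] C_gr_subset[OF Q]]) (auto simp: p q split:
        if_splits)
  then show ?thesis by (simp add: p q)
qed

lemma bilinear_bilin_ext:
  assumes f: "bilinear_operation f"
  shows "bilinear_on cs cs cs Ctot Ctot (bilin_ext f)"
proof -
  have b: "bilinear_on cs cs cs (Cg m) (Cg n) (f m n)" for m n using f by blast
  note D = bilinear_onD[OF b]
  have add: "P + Q \<in> Ctot" "cs c P \<in> Ctot" if "P \<in> Ctot" "Q \<in> Ctot" for P Q c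
    using that subspace_W unfolding cochains.subspace_def by blast+
  have ar: "arity_support (P + Q) \<subseteq> arity_support P \<union> arity_support Q" "arity_support (cs c P) \<subseteq>
      arity_support P" for P Q c
    by (auto simp: arity_part_add arity_part_scale[OF vector_space_axioms])
  have 1: "bilin_ext f (P + P') Q = bilin_ext f P Q + bilin_ext f P' Q"
    if "P \<in> Ctot" "P' \<in> Ctot" "Q \<in> Ctot" for P P' Q
  proof -
    have fin: "finite (arity_support P \<union> arity_support P')" "finite (arity_support Q)"
      using that total_D(1) by auto
    show ?thesis
      using that ar
      by (simp add: bilin_ext_eq_sum[OF f _ _ fin(1) _ fin(2)] add arity_part_add D total_D
          sum.distrib)
  qed
  have 2: "bilin_ext f Q (P + P') = bilin_ext f Q P + bilin_ext f Q P'"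
    if "P \<in> Ctot" "P' \<in> Ctot" "Q \<in> Ctot" for P P' Q
  proof -
    have fin: "finite (arity_support P \<union> arity_support P')" "finite (arity_support Q)"
      using that total_D(1) by auto
    show ?thesis
      using that ar
      by (simp add: bilin_ext_eq_sum[OF f _ _ fin(2) _ fin(1)] add arity_part_add D total_D
          sum.distrib)
  qed
  have 3: "bilin_ext f (cs c P) Q = cs c (bilin_ext f P Q)" "bilin_ext f P (cs c Q)
      = cs c (bilin_ext f P Q)"
    if "P \<in> Ctot" "Q \<in> Ctot" for P Q c
  proof -
    have fin: "finite (arity_support P)" "finite (arity_support Q)"
      using that total_D(1) by auto
    show "bilin_ext f (cs c P) Q = cs c (bilin_ext f P Q)" "bilin_ext f P (cs c Q)
        = cs c (bilin_ext f P Q)"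
      using that ar
      by (simp_all add: bilin_ext_eq_sum[OF f _ _ fin(1) _ fin(2)] add arity_part_scale[OF
          vector_space_axioms]
        D total_D cochains.scale_sum_right)
  qed
  show ?thesis
    unfolding bilinear_on_def using 1 2 3 by blast
qed

lemma bilin_ext_in_total:
  assumes f: "bilinear_operation f"
    and cl: "\<And>m n P Q. P \<in> Cg m \<Longrightarrow> Q \<in> Cg n \<Longrightarrow> f m n P Q \<in> Ctot"
    and P: "P \<in> Ctot" and Q: "Q \<in> Ctot"
  shows "bilin_ext f P Q \<in> Ctot"
  unfolding bilin_ext_def
  by (intro cochains.subspace_sum[OF subspace_W] cl total_D P Q)

lemma bilinear_ins: "bilinear_operation (ins scale \<alpha>)"
  unfolding bilinear_on_def
  by (auto simp: ins_def fun_eq_iff cscale_def C_gr_D(2) alternating_head_add alternating_head_scale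
      scale_right_distrib sum.distrib scale_sum_right mult.commute)

lemma bilinear_cup: "bilinear_operation (cup scale br \<alpha>)"
  unfolding bilinear_on_def
  by (auto simp: cup_def fun_eq_iff cscale_def alpha_pow_add alpha_pow_scale br_add_left
      br_add_right
      br_scale_left br_scale_right scale_right_distrib sum.distrib scale_sum_right mult.commute)

lemma hom_delta_add:
  "hom_delta scale br \<alpha> m (P + Q) = hom_delta scale br \<alpha> m P + hom_delta scale br \<alpha> m Q"
  by (auto simp: hom_delta_def fun_eq_iff br_add_right scale_right_distrib sum.distrib add_ac)

lemma hom_delta_scale:
  "hom_delta scale br \<alpha> m (cs c P) = cs c (hom_delta scale br \<alpha> m P)"
  by (auto simp: hom_delta_def fun_eq_iff cscale_def br_scale_right scale_right_distrib
      scale_sum_right mult.commute)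

lemma ins_add_left: "alternating R \<Longrightarrow> ins scale \<alpha> m n (P + Q) R = ins scale \<alpha> m n P R
    + ins scale \<alpha> m n Q R"
  by (simp add: ins_def fun_eq_iff alternating_head_add scale_right_distrib sum.distrib)
lemma ins_scale_left: "alternating R \<Longrightarrow> ins scale \<alpha> m n (cs c P) R = cs c (ins scale \<alpha> m n P R)"
  by (simp add: ins_def fun_eq_iff cscale_def alternating_head_scale scale_sum_right mult.commute)
lemma ins_add_right: "ins scale \<alpha> m n R (P + Q) = ins scale \<alpha> m n R P + ins scale \<alpha> m n R Q"
  by (simp add: ins_def fun_eq_iff scale_right_distrib sum.distrib)
lemma ins_scale_right: "ins scale \<alpha> m n R (cs c P) = cs c (ins scale \<alpha> m n R P)"
  by (simp add: ins_def fun_eq_iff cscale_def scale_sum_right mult.commute)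

lemma bilinear_ins_delta:
  "bilinear_on cs cs cs (Cg m) (Cg n) (\<lambda>P Q. ins scale \<alpha> (m + 1) n (hom_delta scale br \<alpha> m P) Q)"
  unfolding bilinear_on_def
  by (simp add: hom_delta_add hom_delta_scale C_gr_D(2) ins_add_left ins_scale_left ins_add_right
      ins_scale_right)

lemma bilinear_NR: "bilinear_operation (NR scale \<alpha>)"
proof (intro allI)
  fix m n
  have i: "bilinear_on cs cs cs (Cg k) (Cg l) (ins scale \<alpha> k l)" for k l using bilinear_ins by blast
  show "bilinear_on cs cs cs (Cg m) (Cg n) (NR scale \<alpha> m n)"
    using bilinear_on_diff[OF vs_cs i bilinear_on_scale[OF vs_cs bilinear_on_swap[OF i]]]
    unfolding NR_def .
qed

lemma bilinear_FN: "bilinear_operation (FN scale br \<alpha>)"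
proof (intro allI)
  fix m n
  have c: "bilinear_on cs cs cs (Cg m) (Cg n) (cup scale br \<alpha> m n)" using bilinear_cup by blast
  show "bilinear_on cs cs cs (Cg m) (Cg n) (FN scale br \<alpha> m n)"
    using bilinear_on_diff[OF vs_cs bilinear_on_add[OF vs_cs c bilinear_on_scale[OF vs_cs
        bilinear_ins_delta]]
       bilinear_on_scale[OF vs_cs bilinear_on_swap[OF bilinear_ins_delta]]]
    unfolding FN_def .
qed

section \<open>Cochains form a calculus of cup product and insertion\<close>

lemma alternating_alpha_pow: "alternating P \<Longrightarrow> alternating (\<lambda>xs. (\<alpha> ^^ k) (P xs))"
  by (rule alternating_comp[of P "\<alpha> ^^ k"]) (simp_all add: alpha_pow_add alpha_pow_scale)

lemma equivariant_pow: "equivariant P \<Longrightarrow> (\<alpha> ^^ k) (P xs) = P (map (\<alpha> ^^ k) xs)"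
proof (induction k)
  case (Suc k)
  then have "(\<alpha> ^^ Suc k) (P xs) = P (map \<alpha> (map (\<alpha> ^^ k) xs))"
    by (simp add: equivariant_def del: map_map)
  then show ?case by (simp add: comp_def)
qed (simp flip: id_def)

lemma alpha_pow_alpha: "(\<alpha> ^^ k) (\<alpha> x) = \<alpha> ((\<alpha> ^^ k) x)"
  by (simp add: funpow_swap1)

lemma insert_sum_comp:
  assumes "\<And>u v. h (u + v) = h u + h v"
  shows "h (insert_sum f P Q xs) = insert_sum f P (\<lambda>xs. h (Q xs)) xs"
  unfolding insert_sum_def by (rule additive_shuffle_sum[OF assms])

lemma alpha_pow_cup_sum:
  "(\<alpha> ^^ k) (cup_sum P Q xs) = cup_sum (\<lambda>xs. (\<alpha> ^^ k) (P xs)) (\<lambda>xs. (\<alpha> ^^ k) (Q xs)) xs"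
  unfolding cup_sum_def additive_shuffle_sum[of "\<alpha> ^^ k", OF alpha_pow_add] alpha_pow_br ..

lemma equivariant_alpha_pow: "equivariant P \<Longrightarrow> equivariant (\<lambda>xs. (\<alpha> ^^ k) (P xs))"
  unfolding equivariant_def by (metis alpha_pow_alpha)

lemma equivariant_insert_sum:
  assumes "equivariant P" "equivariant Q"
  shows "equivariant (insert_sum (\<alpha> ^^ k) P Q)"
proof -
  have e: "\<alpha> (P xs) = P (map \<alpha> xs)" "\<alpha> (Q xs) = Q (map \<alpha> xs)" for xs
    using assms by (simp_all add: equivariant_def)
  have "\<alpha> \<circ> \<alpha> ^^ k = \<alpha> ^^ k \<circ> \<alpha>" by (simp add: fun_eq_iff alpha_pow_alpha)
  then show ?thesis
    unfolding equivariant_def insert_sum_def shuffle_sum_map additive_shuffle_sum[OF alpha_add] e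
        list.map map_map
    by simp
qed

lemma equivariant_cup_sum:
  assumes "equivariant P" "equivariant Q"
  shows "equivariant (cup_sum P Q)"
proof -
  have e: "\<alpha> (P xs) = P (map \<alpha> xs)" "\<alpha> (Q xs) = Q (map \<alpha> xs)" for xs
    using assms by (simp_all add: equivariant_def)
  show ?thesis
    unfolding equivariant_def cup_sum_def shuffle_sum_map additive_shuffle_sum[OF alpha_add] e
        multiplicative by simp
qed

lemma insert_sum_in_C_gr:
  assumes P: "P \<in> Cg (Suc p)" and Q: "Q \<in> Cg n"
  shows "insert_sum (\<alpha> ^^ p) P Q \<in> Cg (p + n)"
  unfolding C_gr_iff
proof (intro conjI)
  show "has_arity (p + n) (insert_sum (\<alpha> ^^ p) P Q)"
    by (rule has_arity_insert_sum) (rule C_gr_D[OF P] C_gr_D[OF Q])+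
  show "alternating (insert_sum (\<alpha> ^^ p) P Q)"
    by (rule alternating_insert_sum) (rule C_gr_D[OF P] C_gr_D[OF Q] alpha_pow_add alpha_pow_scale)+
  show "equivariant (insert_sum (\<alpha> ^^ p) P Q)"
    by (rule equivariant_insert_sum) (rule C_gr_D[OF P] C_gr_D[OF Q])+
  show "insert_sum (\<alpha> ^^ p) P Q [] = 0"
    by (simp add: insert_sum_def C_gr_D(4)[OF P] alternating_head_zero[OF C_gr_D(2)[OF Q]])
qed

lemma alpha_pow_in_C_gr: "P \<in> Cg n \<Longrightarrow> (\<lambda>xs. (\<alpha> ^^ k) (P xs)) \<in> Cg n"
  by (simp add: C_gr_iff has_arity_comp alternating_alpha_pow equivariant_alpha_pow)

lemma cup_sum_in_C_gr:
  assumes P: "P \<in> Cg m" and Q: "Q \<in> Cg n"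
  shows "cup_sum P Q \<in> Cg (m + n)"
  unfolding C_gr_iff
proof (intro conjI)
  show "has_arity (m + n) (cup_sum P Q)"
    by (rule has_arity_cup_sum) (rule C_gr_D[OF P] C_gr_D[OF Q])+
  show "alternating (cup_sum P Q)"
    by (rule alternating_cup_sum) (rule C_gr_D[OF P] C_gr_D[OF Q])+
  show "equivariant (cup_sum P Q)"
    by (rule equivariant_cup_sum) (rule C_gr_D[OF P] C_gr_D[OF Q])+
  show "cup_sum P Q [] = 0"
    by (simp add: cup_sum_def C_gr_D(4)[OF P])
qed

abbreviation insertion where "insertion \<equiv> bilin_ext (ins scale \<alpha>)"
abbreviation cup_product where "cup_product \<equiv> bilin_ext (cup scale br \<alpha>)"

lemma insertion_eq:
  assumes P: "P \<in> Cg (Suc p)" and Q: "Q \<in> Cg n"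
  shows "insertion P Q = insert_sum (\<alpha> ^^ p) P Q"
proof (cases "n = 0")
  case True
  then have "Q = 0" using Q C_gr_0 by blast
  moreover have "insert_sum (\<alpha> ^^ p) P 0 = 0"
    by (simp add: insert_sum_def shuffle_sum_zero fun_eq_iff)
  ultimately show ?thesis
    using bilinear_operation_zero(2)[OF bilinear_ins P C_gr_zero[of n]]
      bilin_ext_homogeneous[OF bilinear_ins P Q] by simp
next
  case False
  then show ?thesis
    using bilin_ext_homogeneous[OF bilinear_ins P Q]
      ins_eq_insert_sum[OF C_gr_D(1)[OF P] C_gr_D(1,2)[OF Q]] by simp
qed

lemma cup_product_eq:
  assumes P: "P \<in> Cg m" and Q: "Q \<in> Cg n"
  shows "cup_product P Q = cup_sum (\<lambda>xs. (\<alpha> ^^ (n - 1)) (P xs)) (\<lambda>xs. (\<alpha> ^^ (m - 1)) (Q xs))"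
  using bilin_ext_homogeneous[OF bilinear_cup P Q] cup_eq_cup_sum[OF C_gr_D(1)[OF P] C_gr_D(1)[OF
      Q]] by simp

lemma ins_in_total: "P \<in> Cg m \<Longrightarrow> Q \<in> Cg n \<Longrightarrow> ins scale \<alpha> m n P Q \<in> Ctot"
proof (cases m)
  case 0
  assume "P \<in> Cg m" "Q \<in> Cg n"
  then show ?thesis
    using bilinear_operation_zero(1)[OF bilinear_ins, of P m Q n] C_gr_0[of P] C_gr_subset[OF
        C_gr_zero] 0 by simp
next
  case (Suc p)
  assume "P \<in> Cg m" "Q \<in> Cg n"
  then show ?thesis
    using bilin_ext_homogeneous[OF bilinear_ins, of P m Q n] insertion_eq[of P p Q n]
        insert_sum_in_C_gr[of P p Q n] C_gr_subset Suc
    by metis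
qed

lemma cup_in_total: "P \<in> Cg m \<Longrightarrow> Q \<in> Cg n \<Longrightarrow> cup scale br \<alpha> m n P Q \<in> Ctot"
  using cup_eq_cup_sum[OF C_gr_D(1) C_gr_D(1), of P m Q n]
    C_gr_subset[OF cup_sum_in_C_gr[OF alpha_pow_in_C_gr alpha_pow_in_C_gr, of P m Q n]] by simp

lemma unit_in_C_gr: "unit_cochain \<in> Cg 1"
proof -
  have s: "(unit_cochain :: 'v list \<Rightarrow> 'v) (us @ u # v # ws) = 0" for us u v ws
    by (simp add: unit_cochain_def)
  have h: "length (us @ u # ws) = 1 \<Longrightarrow> us = [] \<and> ws = []" for us u and ws :: "'v list" by simp
  have "alternating unit_cochain"
    unfolding alternating_def s by (auto simp: unit_cochain_def)
  then show ?thesis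
    by (auto simp: C_gr_iff has_arity_def unit_cochain_def equivariant_def hd_map length_Suc_conv)
qed

lemma bracket_in_C_gr: "bracket_cochain \<in> Cg 2"
proof -
  have "bracket_cochain (us @ u # v # ws) = - bracket_cochain (us @ v # u # ws)" for us u v ws
    using skew_br[of u v] by (cases us; cases ws) (auto simp: bracket_cochain_def)
  moreover have "bracket_cochain (us @ (u + v) # ws) = bracket_cochain (us @ u # ws)
      + bracket_cochain (us @ v # ws)" for us u v ws
    by (cases us; cases ws) (auto simp: bracket_cochain_def br_add_left br_add_right nth_append)
  moreover have "bracket_cochain (us @ scale c u # ws)
      = scale c (bracket_cochain (us @ u # ws))" for us u c ws
    by (cases us; cases ws) (auto simp: bracket_cochain_def br_scale_left br_scale_right nth_append)
  ultimately have "alternating bracket_cochain"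
    unfolding alternating_def by blast
  then show ?thesis
    by (auto simp: C_gr_iff has_arity_def bracket_cochain_def equivariant_def multiplicative)
qed

lemma insertion_zero: "P \<in> Cg m \<Longrightarrow> insertion P 0 = 0" "Q \<in> Cg n \<Longrightarrow> insertion 0 Q = 0"
  using bilinear_operation_zero[OF bilinear_ins, of P m 0 0] bilin_ext_homogeneous[OF
      bilinear_ins, of P m 0 0]
    bilinear_operation_zero[OF bilinear_ins, of 0 0 Q n] bilin_ext_homogeneous[OF bilinear_ins, of
        0 0 Q n]
  by (simp_all add: C_gr_zero)

lemma cup_product_zero: "P \<in> Cg m \<Longrightarrow> cup_product P 0 = 0" "Q \<in> Cg n \<Longrightarrow> cup_product 0 Q = 0"
  using bilinear_operation_zero[OF bilinear_cup, of P m 0 0] bilin_ext_homogeneous[OF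
      bilinear_cup, of P m 0 0]
    bilinear_operation_zero[OF bilinear_cup, of 0 0 Q n] bilin_ext_homogeneous[OF bilinear_cup, of
        0 0 Q n]
  by (simp_all add: C_gr_zero)

lemma insertion_in_C_gr: "P \<in> Cg (Suc p) \<Longrightarrow> Q \<in> Cg n \<Longrightarrow> insertion P Q \<in> Cg (p + n)"
  by (simp add: insertion_eq insert_sum_in_C_gr)

lemma cup_product_in_C_gr: "P \<in> Cg m \<Longrightarrow> Q \<in> Cg n \<Longrightarrow> cup_product P Q \<in> Cg (m + n)"
  by (simp only: cup_product_eq cup_sum_in_C_gr alpha_pow_in_C_gr)

lemma C_gr_parity: "P \<in> Cg n \<Longrightarrow> has_parity n P"
  by (intro arity_parity C_gr_D)

lemma C_gr_sg: "P \<in> Cg n \<Longrightarrow> sg k P \<in> Cg n"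
  by (simp add: sg_def C_gr_uminus)

lemma C_gr_diff: "P \<in> Cg n \<Longrightarrow> Q \<in> Cg n \<Longrightarrow> P - Q \<in> Cg n"
  using C_gr_add[of P n "- Q"] C_gr_uminus by simp

text \<open>
The associators \<open>i\<^sub>P i\<^sub>Q R - i\<^bsub>i\<^sub>P Q\<^esub> R\<close> and \<open>i\<^sub>Q i\<^sub>P R - i\<^bsub>i\<^sub>Q P\<^esub> R\<close> agree up to the sign by which \<open>P\<close> and \<open>Q\<close>
are exchanged.
\<close>

lemma insertion_action:
  assumes P: "P \<in> Cg (Suc p)" and Q: "Q \<in> Cg (Suc q)" and R: "R \<in> Cg n"
  shows "insertion (insertion P Q - sg (p * q) (insertion Q P)) R =
    insertion P (insertion Q R) - sg (p * q) (insertion Q (insertion P R))"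
proof
  fix xs
  let ?f = "\<alpha> ^^ p" and ?g = "\<alpha> ^^ q"
  let ?D = "double_insert (\<alpha> ^^ (p + q)) (?g \<circ> P) (?f \<circ> Q) R xs"
  let ?E = "double_insert (\<alpha> ^^ (p + q)) (?f \<circ> Q) (?g \<circ> P) R xs"
  note c = C_gr_D(2)[OF Q] C_gr_D(2)[OF P] C_gr_D(2)[OF R]
  have fg: "?g \<circ> ?f = \<alpha> ^^ (p + q)" "?f \<circ> ?g = \<alpha> ^^ (p + q)"
    by (simp_all add: funpow_add[symmetric] add.commute)
  have m: "Q \<circ> map ?f = ?f \<circ> Q" "P \<circ> map ?g = ?g \<circ> P"
    using equivariant_pow[OF C_gr_D(3)[OF P]] equivariant_pow[OF C_gr_D(3)[OF Q]]
        by (auto simp: fun_eq_iff)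
  have X: "insert_sum ?f P Q \<in> Cg (Suc (p + q))" "insert_sum ?g Q P \<in> Cg (Suc (p + q))"
    using insert_sum_in_C_gr[OF P Q] insert_sum_in_C_gr[OF Q P] by (simp_all add: add.commute)
  have 1: "insert_sum ?f P (insert_sum ?g Q R) xs = insert_sum (\<alpha> ^^ (p
      + q)) (insert_sum ?f P Q) R xs - sg (Suc q) ?D"
    using insert_sum_insert_sum[where f = ?f and g = ?g and xs
        = xs, OF C_gr_parity[OF P] C_gr_parity[OF Q] c(1,3)
        alpha_pow_add alpha_pow_scale alpha_pow_add alpha_pow_scale]
    unfolding m fg .
  have 2: "insert_sum ?g Q (insert_sum ?f P R) xs = insert_sum (\<alpha> ^^ (p
      + q)) (insert_sum ?g Q P) R xs - sg (Suc p) ?E"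
    using insert_sum_insert_sum[where f = ?g and g = ?f and xs
        = xs, OF C_gr_parity[OF Q] C_gr_parity[OF P] c(2,3)
        alpha_pow_add alpha_pow_scale alpha_pow_add alpha_pow_scale]
    unfolding m fg .
  have par: "has_parity (Suc p) (?g \<circ> P)" "has_parity (Suc q) (?f \<circ> Q)"
    by (rule parity_comp[OF C_gr_parity[OF P]], simp) (rule parity_comp[OF C_gr_parity[OF Q]], simp)
  have 3: "?D = - sg (Suc p * Suc q) ?E"
    by (rule double_insert_skew[OF par c(3)])
  \<comment> \<open>the difference is homogeneous, so that its insertion is given by a single shuffle sum\<close>
  have 4: "insertion (insertion P Q - sg (p * q) (insertion Q P)) R xs =
      insert_sum (\<alpha> ^^ (p + q)) (insert_sum ?f P Q) R xs - sg (p * q) (insert_sum (\<alpha> ^^ (p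
          + q)) (insert_sum ?g Q P) R xs)"
    unfolding insertion_eq[OF P Q] insertion_eq[OF Q P] insertion_eq[OF C_gr_diff[OF X(1)
        C_gr_sg[OF X(2)]] R]
    by (simp add: insert_sum_diff_left[OF c(3)] insert_sum_sg_left[OF c(3)] sg_apply)
  have 5: "insertion P (insertion Q R) = insert_sum ?f P (insert_sum ?g Q R)"
    "insertion Q (insertion P R) = insert_sum ?g Q (insert_sum ?f P R)"
    unfolding insertion_eq[OF Q R] insertion_eq[OF P R]
    by (rule insertion_eq[OF P insert_sum_in_C_gr[OF Q R]]) (rule insertion_eq[OF Q
        insert_sum_in_C_gr[OF P R]])
  have "insertion (insertion P Q - sg (p * q) (insertion Q P)) R xs =
    insert_sum ?f P (insert_sum ?g Q R) xs - sg (p * q) (insert_sum ?g Q (insert_sum ?f P R) xs)"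
    unfolding 4 1 2 3 by (cases "even p"; cases "even q") (simp_all add: sg_def)
  then show "insertion (insertion P Q - sg (p * q) (insertion Q P)) R xs =
    (insertion P (insertion Q R) - sg (p * q) (insertion Q (insertion P R))) xs"
    unfolding 5 by (simp add: sg_apply)
qed

text \<open>
Powers of \<open>\<alpha>\<close> outside an insertion are moved to the inserted-into cochain, and powers on the arguments of the
factor that does not receive \<open>P\<close> become powers on its values by equivariance.  Together they are the powers
prescribed by the arities of the cup products on the right-hand side.
\<close>

lemma insertion_derivation:
  assumes P: "P \<in> Cg (Suc p)" and E: "E \<in> Cg m" and F: "F \<in> Cg n"
  shows "insertion P (cup_product E F) =
    cup_product (insertion P E) F + sg (p * m) (cup_product E (insertion P F))"
proof -
  consider "m = 0" | "n = 0" | a b where "m = Suc a" "n = Suc b"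
    by (metis not0_implies_Suc)
  then show ?thesis
  proof cases
    case 1
    then have "E = 0" using E C_gr_0 by blast
    then show ?thesis
      using P F by (simp add: insertion_zero cup_product_zero(2)[OF F] cup_product_zero(2)[OF
          insertion_in_C_gr[OF P F]])
  next
    case 2
    then have "F = 0" using F C_gr_0 by blast
    then show ?thesis
      using P E by (simp add: insertion_zero cup_product_zero(1)[OF E] cup_product_zero(1)[OF
          insertion_in_C_gr[OF P E]])
  next
    case 3
    note EF = E[unfolded 3] F[unfolded 3]
    let ?E = "\<lambda>xs. (\<alpha> ^^ b) (E xs)" and ?F = "\<lambda>xs. (\<alpha> ^^ a) (F xs)"
    have Em: "?E \<circ> map (\<alpha> ^^ p) = (\<lambda>xs. (\<alpha> ^^ (p + b)) (E xs))"
      and Fm: "?F \<circ> map (\<alpha> ^^ p) = (\<lambda>xs. (\<alpha> ^^ (p + a)) (F xs))"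
      using equivariant_pow[OF C_gr_D(3)[OF E], of p] equivariant_pow[OF C_gr_D(3)[OF F], of p]
      by (simp_all add: fun_eq_iff funpow_add add.commute[of p] flip: equivariant_pow)
    have EF': "?E \<in> Cg (Suc a)" "?F \<in> Cg (Suc b)" using EF by (simp_all only: alpha_pow_in_C_gr)
    have "insertion P (cup_product E F) = insert_sum (\<alpha> ^^ p) P (cup_sum ?E ?F)"
      using insertion_eq[OF P cup_sum_in_C_gr[OF EF']] cup_product_eq[OF EF] by simp
    moreover have "cup_product (insertion P E) F = cup_sum (insert_sum (\<alpha> ^^ p) P ?E) (\<lambda>xs. (\<alpha> ^^
        (p + a)) (F xs))"
      unfolding cup_product_eq[OF insertion_in_C_gr[OF P EF(1)] EF(2)] unfolding insertion_eq[OF P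
          EF(1)]
      by (simp add: insert_sum_comp[of "\<alpha> ^^ b", OF alpha_pow_add])
    moreover have "cup_product E (insertion P F) = cup_sum (\<lambda>xs. (\<alpha> ^^ (p
        + b)) (E xs)) (insert_sum (\<alpha> ^^ p) P ?F)"
      unfolding cup_product_eq[OF EF(1) insertion_in_C_gr[OF P EF(2)]] unfolding insertion_eq[OF P
          EF(2)]
      by (simp add: insert_sum_comp[of "\<alpha> ^^ a", OF alpha_pow_add])
    moreover have "insert_sum (\<alpha> ^^ p) P (cup_sum ?E ?F) xs =
        (cup_sum (insert_sum (\<alpha> ^^ p) P ?E) (\<lambda>xs. (\<alpha> ^^ (p + a)) (F xs)) +
         sg (p * m) (cup_sum (\<lambda>xs. (\<alpha> ^^ (p + b)) (E xs)) (insert_sum (\<alpha> ^^ p) P ?F))) xs" for xs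
      using insert_sum_cup_sum[OF C_gr_parity[OF P] C_gr_parity[OF EF'(1)] C_gr_parity[OF EF'(2)]
        C_gr_D(2)[OF EF'(1)] C_gr_D(2)[OF EF'(2)], of "\<alpha> ^^ p" xs]
      unfolding Em Fm 3 by (cases "even p"; cases "even a") (simp_all add: sg_def)
    then have "insert_sum (\<alpha> ^^ p) P (cup_sum ?E ?F) =
        cup_sum (insert_sum (\<alpha> ^^ p) P ?E) (\<lambda>xs. (\<alpha> ^^ (p + a)) (F xs)) +
         sg (p * m) (cup_sum (\<lambda>xs. (\<alpha> ^^ (p + b)) (E xs)) (insert_sum (\<alpha> ^^ p) P ?F))"
      by (rule ext)
    ultimately show ?thesis by (simp only:)
  qed
qed

lemma cup_product_skew:
  assumes E: "E \<in> Cg m" and F: "F \<in> Cg n"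
  shows "cup_product E F = - sg (m * n) (cup_product F E)"
proof -
  have "cup_product E F xs = - sg (m * n) (cup_product F E xs)" for xs
    unfolding cup_product_eq[OF E F] cup_product_eq[OF F E]
    by (rule cup_sum_skew) (rule C_gr_parity alpha_pow_in_C_gr E F)+
  then show ?thesis by (simp add: fun_eq_iff sg_apply)
qed

lemma cup_product_jacobi:
  assumes E: "E \<in> Cg m" and F: "F \<in> Cg n" and G: "G \<in> Cg p"
  shows "cup_product E (cup_product F G) =
    cup_product (cup_product E F) G + sg (m * n) (cup_product F (cup_product E G))"
proof -
  note EF = cup_product_in_C_gr[OF E F] and FG = cup_product_in_C_gr[OF F G] and EG
      = cup_product_in_C_gr[OF E G]
  consider "m = 0" | "n = 0" | "p = 0" | a b c where "m = Suc a" "n = Suc b" "p = Suc c"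
    by (metis not0_implies_Suc)
  then show ?thesis
  proof cases
    case 1
    then have "E = 0" using E C_gr_0 by blast
    then show ?thesis
      by (simp add: cup_product_zero(2)[OF F] cup_product_zero(2)[OF G] cup_product_zero(2)[OF FG]
          cup_product_zero(1)[OF F])
  next
    case 2
    then have "F = 0" using F C_gr_0 by blast
    then show ?thesis
      by (simp add: cup_product_zero(2)[OF G] cup_product_zero(2)[OF EG] cup_product_zero(1)[OF E])
  next
    case 3
    then have "G = 0" using G C_gr_0 by blast
    then show ?thesis
      by (simp add: cup_product_zero(1)[OF F] cup_product_zero(1)[OF E] cup_product_zero(1)[OF EF])
  next
    case 4
    let ?E = "\<lambda>xs. (\<alpha> ^^ (b + c)) (E xs)" and ?F = "\<lambda>xs. (\<alpha> ^^ (a + c)) (F xs)" and ?G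
        = "\<lambda>xs. (\<alpha> ^^ (a + b)) (G xs)"
    have pw: "(\<alpha> ^^ i) ((\<alpha> ^^ j) x) = (\<alpha> ^^ (i + j)) x" for i j x by (simp add: funpow_add)
    have al: "\<alpha> ((\<alpha> ^^ j) x) = (\<alpha> ^^ Suc j) x" for j x by simp
    have 1: "cup_product E (cup_product F G) = cup_sum (\<alpha> \<circ> ?E) (cup_sum ?F ?G)"
      unfolding cup_product_eq[OF E FG] unfolding cup_product_eq[OF F G] alpha_pow_cup_sum 4
          comp_def pw al
      by (simp add: add_ac)
    have 2: "cup_product (cup_product E F) G = cup_sum (cup_sum ?E ?F) (\<alpha> \<circ> ?G)"
      unfolding cup_product_eq[OF EF G] unfolding cup_product_eq[OF E F] alpha_pow_cup_sum 4
          comp_def pw al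
      by (simp add: add_ac)
    have 3: "cup_product F (cup_product E G) = cup_sum (\<alpha> \<circ> ?F) (cup_sum ?E ?G)"
      unfolding cup_product_eq[OF F EG] unfolding cup_product_eq[OF E G] alpha_pow_cup_sum 4
          comp_def pw al
      by (simp add: add_ac)
    have "cup_sum (\<alpha> \<circ> ?E) (cup_sum ?F ?G) xs =
        cup_sum (cup_sum ?E ?F) (\<alpha> \<circ> ?G) xs + sg (m * n) (cup_sum (\<alpha> \<circ> ?F) (cup_sum ?E ?G) xs)"
            for xs
      by (rule cup_sum_jacobi) (rule C_gr_parity alpha_pow_in_C_gr E F G)+
    then show ?thesis unfolding 1 2 3 by (simp add: fun_eq_iff sg_apply)
  qed
qed

lemma insertion_unit:
  assumes P: "P \<in> Cg n" shows "insertion P unit_cochain = P"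
proof (cases n)
  case 0
  then show ?thesis using C_gr_0[of P] P insertion_zero(2)[OF unit_in_C_gr] by simp
next
  case (Suc p)
  have "insert_sum (\<alpha> ^^ p) P unit_cochain xs = P xs" for xs
  proof -
    have "insert_sum (\<alpha> ^^ p) P unit_cochain xs = shuffle_sum (\<lambda>ys zs. if zs
        = [] then P ys else 0) xs"
      unfolding insert_sum_def by (rule shuffle_sum_cong) (simp add: unit_cochain_def)
    then show ?thesis by (simp only: shuffle_sum_second_empty)
  qed
  then show ?thesis using insertion_eq[OF P[unfolded Suc] unit_in_C_gr] by (simp add: fun_eq_iff)
qed

text \<open>
On a pair of arguments the two shuffles contribute \<open>[x, y]\<close> and \<open>- [y, x]\<close>.
\<close>

lemma cup_product_unit_unit: "cup_product unit_cochain unit_cochain = bracket_cochain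
    + bracket_cochain"
proof
  fix xs :: "'v list"
  have c: "cup_product unit_cochain unit_cochain = cup_sum unit_cochain unit_cochain"
    using cup_product_eq[OF unit_in_C_gr unit_in_C_gr] by simp
  show "cup_product unit_cochain unit_cochain xs = (bracket_cochain + bracket_cochain) xs"
  proof (cases "length xs = 2")
    case True
    then obtain x y where xs: "xs = [x, y]" by (auto simp: length_Suc_conv numeral_2_eq_2)
    have "cup_sum unit_cochain unit_cochain xs = br x y - br y x"
      by (simp add: xs cup_sum_def unit_cochain_def sg_def)
    then show ?thesis using skew_br[of y x] by (simp add: c xs bracket_cochain_def)
  next
    case False
    then show ?thesis
      using has_arityD[OF C_gr_D(1)[OF cup_product_in_C_gr[OF unit_in_C_gr unit_in_C_gr]], of xs]
      by (simp add: bracket_cochain_def)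
  qed
qed

lemma torsion_free_cochain:
  fixes P :: "'v cochain"
  assumes "(\<Sum>i<Suc n. P) = 0" shows "P = 0"
proof -
  have "cs (of_nat (Suc n)) P = 0"
    using assms cochains.sum_constant_scale[of P "{..<Suc n}"]
        by (simp del: sum.lessThan_Suc of_nat_Suc)
  then show ?thesis using of_nat_neq_0 cochains.scale_eq_0_iff by blast
qed

lemma add_total: "P \<in> Ctot \<Longrightarrow> Q \<in> Ctot \<Longrightarrow> P + Q \<in> Ctot"
  by (rule cochains.subspace_add[OF subspace_W])

lemma uminus_total: "P \<in> Ctot \<Longrightarrow> - P \<in> Ctot"
  by (rule cochains.subspace_neg[OF subspace_W])

sublocale calculus: cup_insertion_algebra Cg Ctot insertion cup_product unit_cochain bracket_cochain
proof (unfold_locales)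
  note I = bilinear_bilin_ext[OF bilinear_ins] and C = bilinear_bilin_ext[OF bilinear_cup]
  show "x \<in> Ctot" if "x \<in> Cg n" for x n using that by (rule C_gr_subset)
  show "x + y \<in> Cg n" if "x \<in> Cg n" "y \<in> Cg n" for x y n using that by (rule C_gr_add)
  show "- x \<in> Cg n" if "x \<in> Cg n" for x n using that by (rule C_gr_uminus)
  show "x + y \<in> Ctot" if "x \<in> Ctot" "y \<in> Ctot" for x y using that by (rule add_total)
  show "- x \<in> Ctot" if "x \<in> Ctot" for x using that by (rule uminus_total)
  show "insertion x y \<in> Ctot" if "x \<in> Ctot" "y \<in> Ctot" for x y
    using bilinear_ins ins_in_total that by (rule bilin_ext_in_total)
  show "cup_product x y \<in> Ctot" if "x \<in> Ctot" "y \<in> Ctot" for x y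
    using bilinear_cup cup_in_total that by (rule bilin_ext_in_total)
  show "x = 0" if "x \<in> Ctot" "(\<Sum>i<Suc n. x) = 0" for x n using that(2)
      by (rule torsion_free_cochain)
  show "insertion (x + y) z = insertion x z + insertion y z" "insertion x (y + z) = insertion x y
      + insertion x z"
    "cup_product (x + y) z = cup_product x z + cup_product y z" "cup_product x (y + z)
        = cup_product x y + cup_product x z"
    if "x \<in> Ctot" "y \<in> Ctot" "z \<in> Ctot" for x y z
    using bilinear_onD(1,2)[OF I] bilinear_onD(1,2)[OF C] that by blast+
  show "unit_cochain \<in> Cg 1" "bracket_cochain \<in> Cg 2" by (rule unit_in_C_gr bracket_in_C_gr)+
  show "cup_product unit_cochain unit_cochain = bracket_cochain + bracket_cochain"
    by (rule cup_product_unit_unit)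
qed (rule insertion_in_C_gr cup_product_in_C_gr insertion_action insertion_derivation
    cup_product_skew cup_product_jacobi insertion_unit; assumption)+

lemma hom_delta_eq_delta:
  assumes "P \<in> Cg m" shows "hom_delta scale br \<alpha> m P = calculus.\<delta> P"
proof -
  have 2: "bracket_cochain \<in> Cg (Suc 1)" using bracket_in_C_gr by (simp add: numeral_2_eq_2)
  have "cup_product unit_cochain P = cup_sum (\<lambda>xs. (\<alpha> ^^ (m - 1)) (unit_cochain xs)) P"
    using cup_product_eq[OF unit_in_C_gr assms] by simp
  moreover have "insertion bracket_cochain P = insert_sum \<alpha> bracket_cochain P"
    using insertion_eq[OF 2 assms] by simp
  ultimately show ?thesis
    using hom_delta_eq[OF C_gr_D(1,2)[OF assms]] by (simp add: calculus.\<delta>_def)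
qed

text \<open>
The signs agree because \<open>(- 1)\<^bsup>(m + 1) n\<^esup> = (- 1)\<^bsup>m n\<^esup> (- 1)\<^sup>n\<close>, and the last factor is absorbed in \<open>\<theta> F\<close>.
\<close>

lemma FN_eq_fn_bracket:
  assumes E: "E \<in> Cg m" and F: "F \<in> Cg n"
  shows "FN scale br \<alpha> m n E F = calculus.fn_bracket m n E F"
proof -
  note d = calculus.delta_degree[OF E] calculus.delta_degree[OF F]
  note V = C_gr_subset[OF E] C_gr_subset[OF F]
  have 1: "cup scale br \<alpha> m n E F = cup_product E F"
    by (rule bilin_ext_homogeneous[OF bilinear_cup E F, symmetric])
  have 2: "ins scale \<alpha> (Suc m) n (calculus.\<delta> E) F = insertion (calculus.\<delta> E) F"
    "ins scale \<alpha> (Suc n) m (calculus.\<delta> F) E = insertion (calculus.\<delta> F) E"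
    by (rule bilin_ext_homogeneous[OF bilinear_ins d(1) F, symmetric])
       (rule bilin_ext_homogeneous[OF bilinear_ins d(2) E, symmetric])
  show ?thesis
    unfolding FN_def calculus.fn_bracket_def calculus.\<theta>_def hom_delta_eq_delta[OF E]
        hom_delta_eq_delta[OF F]
      cs_sg 1 add_Suc_right add_0_right One_nat_def 2
    by (cases "even m"; cases "even n")
      (simp_all add: sg_def calculus.bilinear calculus.V_intros V)
qed

lemma NR_eq_nr_bracket:
  assumes P: "P \<in> Cg (Suc p)" and Q: "Q \<in> Cg (Suc q)"
  shows "NR scale \<alpha> (Suc p) (Suc q) P Q = calculus.nr_bracket p q P Q"
  using bilin_ext_homogeneous[OF bilinear_ins P Q] bilin_ext_homogeneous[OF bilinear_ins Q P]
  by (simp add: NR_def calculus.nr_bracket_def cs_sg)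

lemma bilin_ext_FN: "E \<in> Cg m \<Longrightarrow> F \<in> Cg n \<Longrightarrow> bilin_ext (FN scale br \<alpha>) E F
    = calculus.fn_bracket m n E F"
  by (simp add: bilin_ext_homogeneous[OF bilinear_FN] FN_eq_fn_bracket)

lemma bilin_ext_NR:
  "P \<in> Cg (Suc p) \<Longrightarrow> Q \<in> Cg (Suc q) \<Longrightarrow> bilin_ext (NR scale \<alpha>) P Q = calculus.nr_bracket p q P Q"
  by (simp add: bilin_ext_homogeneous[OF bilinear_NR] NR_eq_nr_bracket)

lemma arity_part_sum: "arity_part n (\<Sum>i\<in>I. f i) = (\<Sum>i\<in>I. arity_part n (f i))"
  by (induction I rule: infinite_finite_induct)
    (simp_all only: sum.infinite sum.empty sum.insert not_False_eq_True arity_part_zero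
        arity_part_add)

section \<open>The matched pair\<close>

text \<open>
The injection \<open>d\<close> covers both gradings: arity \<open>n\<close> or arity \<open>n + 1\<close> in degree \<open>n\<close>.
\<close>

lemma graded_vector_space_C_gr: "inj d \<Longrightarrow> graded_vector_space cs (\<lambda>n. Cg (d n))"
proof unfold_locales
  assume d: "inj d"
  show "cochains.subspace (Cg (d n))" for n by (rule subspace_C_gr)
  fix I :: "nat set" and x :: "nat \<Rightarrow> 'v cochain" and i
  assume I: "finite I" "\<And>i. i \<in> I \<Longrightarrow> x i \<in> Cg (d i)" "(\<Sum>i\<in>I. x i) = 0" "i \<in> I"
  have "arity_part (d i) (x j) = (if j = i then x i else 0)" if "j \<in> I" for j
    using arity_part_homogeneous[OF C_gr_D(1)[OF I(2)[OF that]], of "d i"] injD[OF d, of i j]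
        by auto
  then have "arity_part (d i) (\<Sum>i\<in>I. x i) = (\<Sum>j\<in>I. if j = i then x i else 0)"
    unfolding arity_part_sum by (intro sum.cong) auto
  then show "x i = 0"
    using I by (simp add: arity_part_zero)
qed

text \<open>
The projection to lists of a fixed length vanishes on the span of the other degrees, which makes the component
unique.
\<close>

lemma hom_component_C_gr:
  assumes d: "inj d" and P: "P \<in> Cg (d m)"
  shows "hom_component cs (\<lambda>n. Cg (d n)) n P = (if n = m then P else 0)"
  unfolding hom_component_def
proof (rule the_equality)
  let ?S = "\<lambda>n. cochains.span (\<Union>i\<in>- {n}. Cg (d i))"
  show "(if n = m then P else 0) \<in> Cg (d n) \<and> P - (if n = m then P else 0) \<in> ?S n"
  proof (cases "n = m")
    case True
    then show ?thesis using P cochains.span_zero by simp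
  next
    case False
    then have "P \<in> ?S n" by (intro cochains.span_base) (use P in auto)
    then show ?thesis using False C_gr_zero by simp
  qed
  have S: "arity_part (d n) Q = 0" if "Q \<in> ?S n" for Q
    using that
  proof (induction rule: cochains.span_induct_alt)
    case base
    then show ?case by (rule arity_part_zero)
  next
    case (step c R Q)
    then obtain i where i: "i \<noteq> n" "R \<in> Cg (d i)" by auto
    then have "arity_part (d n) R = 0"
      using arity_part_homogeneous[OF C_gr_D(1)[OF i(2)], of "d n"] injD[OF d, of n i] by auto
    then show ?case using step by (simp only: arity_part_add arity_part_scale[OF
        vector_space_axioms] cochains.scale_zero_right add_0)
  qed
  fix Q assume Q: "Q \<in> Cg (d n) \<and> P - Q \<in> ?S n"
  have "arity_part (d n) P = arity_part (d n) (P - Q) + arity_part (d n) Q"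
    unfolding arity_part_add[symmetric] by simp
  also have "\<dots> = Q"
    using S[of "P - Q"] Q arity_part_homogeneous[OF C_gr_D(1), of Q "d n" "d n"] by simp
  finally show "Q = (if n = m then P else 0)"
    using arity_part_homogeneous[OF C_gr_D(1)[OF P], of "d n"] injD[OF d, of n m] by auto
qed

lemma NR_graded_lie_algebra: "graded_lie_algebra cs (C_gr_shift scale \<alpha>) (bilin_ext (NR scale \<alpha>))"
proof -
  interpret graded_vector_space cs "C_gr_shift scale \<alpha>"
    using graded_vector_space_C_gr[of Suc] by (simp add: C_gr_shift_eq[abs_def])
  show ?thesis
  proof unfold_locales
    show "bilinear_on cs cs cs (graded_total cs (C_gr_shift scale \<alpha>)) (graded_total cs (C_gr_shift
        scale \<alpha>)) (bilin_ext (NR scale \<alpha>))"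
      unfolding total_shift_eq by (rule bilinear_bilin_ext[OF bilinear_NR])
    fix x y z m n p
    assume x: "x \<in> C_gr_shift scale \<alpha> m" and y: "y \<in> C_gr_shift scale \<alpha> n"
    note xy = x[unfolded C_gr_shift_eq] y[unfolded C_gr_shift_eq]
    show "bilin_ext (NR scale \<alpha>) x y \<in> C_gr_shift scale \<alpha> (m + n)"
      unfolding C_gr_shift_eq bilin_ext_NR[OF xy] by (rule calculus.nr_degree[OF xy])
    show "bilin_ext (NR scale \<alpha>) x y = - cs ((- 1) ^ (m * n)) (bilin_ext (NR scale \<alpha>) y x)"
      unfolding cs_sg bilin_ext_NR[OF xy] bilin_ext_NR[OF xy(2,1)] by (rule calculus.nr_skew)
    assume z: "z \<in> C_gr_shift scale \<alpha> p"
    note z = z[unfolded C_gr_shift_eq]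
    note d = calculus.nr_degree[OF xy] calculus.nr_degree[OF xy(2) z] calculus.nr_degree[OF xy(1) z]
    show "bilin_ext (NR scale \<alpha>) x (bilin_ext (NR scale \<alpha>) y z) =
       bilin_ext (NR scale \<alpha>) (bilin_ext (NR scale \<alpha>) x y) z +
       cs ((- 1) ^ (m * n)) (bilin_ext (NR scale \<alpha>) y (bilin_ext (NR scale \<alpha>) x z))"
      unfolding cs_sg bilin_ext_NR[OF xy] bilin_ext_NR[OF xy(2) z] bilin_ext_NR[OF xy(1) z]
        bilin_ext_NR[OF xy(1) d(2)] bilin_ext_NR[OF d(1) z] bilin_ext_NR[OF xy(2) d(3)]
      by (rule calculus.nr_jacobi[OF xy z])
  qed
qed

lemma FN_graded_lie_algebra: "graded_lie_algebra cs Cg (bilin_ext (FN scale br \<alpha>))"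
proof -
  interpret graded_vector_space cs Cg
    using graded_vector_space_C_gr[of "\<lambda>n. n"] by simp
  show ?thesis
  proof unfold_locales
    show "bilinear_on cs cs cs Ctot Ctot (bilin_ext (FN scale br \<alpha>))"
      by (rule bilinear_bilin_ext[OF bilinear_FN])
    fix x y z m n p
    assume xy: "x \<in> Cg m" "y \<in> Cg n"
    show "bilin_ext (FN scale br \<alpha>) x y \<in> Cg (m + n)"
      unfolding bilin_ext_FN[OF xy] by (rule calculus.fn_degree[OF xy])
    show "bilin_ext (FN scale br \<alpha>) x y = - cs ((- 1) ^ (m * n)) (bilin_ext (FN scale br \<alpha>) y x)"
      unfolding cs_sg bilin_ext_FN[OF xy] bilin_ext_FN[OF xy(2,1)] by (rule calculus.fn_skew[OF xy])
    assume z: "z \<in> Cg p"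
    note d = calculus.fn_degree[OF xy] calculus.fn_degree[OF xy(2) z] calculus.fn_degree[OF xy(1) z]
    show "bilin_ext (FN scale br \<alpha>) x (bilin_ext (FN scale br \<alpha>) y z) =
       bilin_ext (FN scale br \<alpha>) (bilin_ext (FN scale br \<alpha>) x y) z +
       cs ((- 1) ^ (m * n)) (bilin_ext (FN scale br \<alpha>) y (bilin_ext (FN scale br \<alpha>) x z))"
      unfolding cs_sg bilin_ext_FN[OF xy] bilin_ext_FN[OF xy(2) z] bilin_ext_FN[OF xy(1) z]
        bilin_ext_FN[OF xy(1) d(2)] bilin_ext_FN[OF d(1) z] bilin_ext_FN[OF xy(2) d(3)]
      by (rule calculus.fn_jacobi[OF xy z])
  qed
qed

theorem NR_FN_matched_pair:
  "matched_pair cs (C_gr_shift scale \<alpha>) (bilin_ext (NR scale \<alpha>)) cs Cg (bilin_ext (FN scale br \<alpha>))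
    insertion (bilin_ext (FN scale br \<alpha>))"
proof -
  interpret A: graded_lie_algebra cs "C_gr_shift scale \<alpha>" "bilin_ext (NR scale \<alpha>)"
    by (rule NR_graded_lie_algebra)
  interpret B: graded_lie_algebra cs Cg "bilin_ext (FN scale br \<alpha>)"
    by (rule FN_graded_lie_algebra)
  let ?NR = "bilin_ext (NR scale \<alpha>)" and ?FN = "bilin_ext (FN scale br \<alpha>)"
  show ?thesis
  proof unfold_locales
    show "bilinear_on cs cs cs (graded_total cs (C_gr_shift scale \<alpha>)) Ctot insertion"
      unfolding total_shift_eq by (rule bilinear_bilin_ext[OF bilinear_ins])
    show "bilinear_on cs cs cs Ctot (graded_total cs (C_gr_shift scale \<alpha>)) ?FN"
      unfolding total_shift_eq by (rule bilinear_bilin_ext[OF bilinear_FN])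
  next
    fix a b m n assume a: "a \<in> C_gr_shift scale \<alpha> m" and b: "b \<in> Cg n"
    then show "insertion a b \<in> Cg (m + n)"
      by (simp add: C_gr_shift_eq insertion_in_C_gr)
  next
    fix b a m n assume b: "b \<in> Cg m" and a: "a \<in> C_gr_shift scale \<alpha> n"
    then show "?FN b a \<in> C_gr_shift scale \<alpha> (m + n)"
      using calculus.fn_degree[of b m a "Suc n"] by (simp add: C_gr_shift_eq bilin_ext_FN)
  next
    fix a a' b m m' n
    assume "a \<in> C_gr_shift scale \<alpha> m" "a' \<in> C_gr_shift scale \<alpha> m'" and b: "b \<in> Cg n"
    then have a: "a \<in> Cg (Suc m)" "a' \<in> Cg (Suc m')" by (simp_all add: C_gr_shift_eq)
    show "insertion (?NR a a') b = insertion a (insertion a' b)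
        - cs ((- 1) ^ (m * m')) (insertion a' (insertion a b))"
      unfolding cs_sg bilin_ext_NR[OF a] by (rule calculus.I_nr[OF a b])
  next
    fix a b b' m n n'
    assume "a \<in> C_gr_shift scale \<alpha> m" and b: "b \<in> Cg n" and b': "b' \<in> Cg n'"
    then have a: "a \<in> Cg (Suc m)" by (simp add: C_gr_shift_eq)
    show "insertion a (?FN b b') = ?FN (insertion a b) b'
        + cs ((- 1) ^ (m * n)) (?FN b (insertion a b'))
        + cs ((- 1) ^ ((m + n) * n')) (insertion (?FN b' a) b)
            - cs ((- 1) ^ (m * n)) (insertion (?FN b a) b')"
      unfolding cs_sg bilin_ext_FN[OF b b'] bilin_ext_FN[OF b a] bilin_ext_FN[OF b' a]
        bilin_ext_FN[OF insertion_in_C_gr[OF a b] b'] bilin_ext_FN[OF b insertion_in_C_gr[OF a b']]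
      by (rule calculus.I_fn[OF a b b'])
  next
    fix b b' a n n' m
    assume b: "b \<in> Cg n" and b': "b' \<in> Cg n'" and "a \<in> C_gr_shift scale \<alpha> m"
    then have a: "a \<in> Cg (Suc m)" by (simp add: C_gr_shift_eq)
    show "?FN (?FN b b') a = ?FN b (?FN b' a) - cs ((- 1) ^ (n * n')) (?FN b' (?FN b a))"
      \<comment> \<open>\<open>\<psi>\<close> is the adjoint action, and \<open>a\<close> is also an element of the Froelicher-Nijenhuis algebra\<close>
      using B.jacobi_br[OF b b' a] by simp
  next
    fix b a a' n m m'
    assume b: "b \<in> Cg n" and "a \<in> C_gr_shift scale \<alpha> m" "a' \<in> C_gr_shift scale \<alpha> m'"
    then have a: "a \<in> Cg (Suc m)" and a': "a' \<in> Cg (Suc m')" by (simp_all add: C_gr_shift_eq)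
    have f: "calculus.fn_bracket n (Suc m) b a \<in> Cg (Suc (n
        + m))" "calculus.fn_bracket n (Suc m') b a' \<in> Cg (Suc (n + m'))"
      using calculus.fn_degree[OF b a] calculus.fn_degree[OF b a'] by simp_all
    show "?FN b (?NR a a') = ?NR (?FN b a) a' + cs ((- 1) ^ (n * m)) (?NR a (?FN b a'))
        + cs ((- 1) ^ ((n + m) * m')) (?FN (insertion a' b) a)
            - cs ((- 1) ^ (n * m)) (?FN (insertion a b) a')"
      unfolding cs_sg bilin_ext_FN[OF b a] bilin_ext_FN[OF b a'] bilin_ext_NR[OF a a']
        bilin_ext_FN[OF b calculus.nr_degree[OF a a']] bilin_ext_NR[OF f(1) a'] bilin_ext_NR[OF a
            f(2)]
        bilin_ext_FN[OF insertion_in_C_gr[OF a' b] a] bilin_ext_FN[OF insertion_in_C_gr[OF a b] a']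
      by (rule calculus.fn_nr[OF b a a'])
  qed
qed

text \<open>
A homogeneous pair has at most one nonzero component, so that the defining double sum has at most one
term; if one of the pairs vanishes the sum is empty, and the right-hand side vanishes too.
\<close>

lemma bicrossed_bracket_homogeneous:
  assumes P: "P \<in> C_gr_shift scale \<alpha> m" and E: "E \<in> Cg m"
    and Q: "Q \<in> C_gr_shift scale \<alpha> n" and F: "F \<in> Cg n"
  shows "bicrossed_bracket cs (C_gr_shift scale \<alpha>) (bilin_ext (NR scale \<alpha>)) cs Cg (bilin_ext (FN
      scale br \<alpha>))
         insertion (bilin_ext (FN scale br \<alpha>)) (P, E) (Q, F) =
       (NR scale \<alpha> (m + 1) (n + 1) P Q + FN scale br \<alpha> m (n + 1) E Q
          - cs ((- 1) ^ (m * n)) (FN scale br \<alpha> n (m + 1) F P),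
        FN scale br \<alpha> m n E F + ins scale \<alpha> (m + 1) n P F
          - cs ((- 1) ^ (m * n)) (ins scale \<alpha> (n + 1) m Q E))"
proof -
  let ?H = "bicrossed_bracket_hom cs (bilin_ext (NR scale \<alpha>)) cs (bilin_ext (FN scale br \<alpha>))
         insertion (bilin_ext (FN scale br \<alpha>))"
  let ?part = "\<lambda>w n. (hom_component cs (C_gr_shift scale \<alpha>) n (fst w), hom_component cs Cg n (snd
      w))"
  note P' = P[unfolded C_gr_shift_eq] and Q' = Q[unfolded C_gr_shift_eq]
  have sh: "C_gr_shift scale \<alpha> = (\<lambda>n. Cg (Suc n))" by (simp add: fun_eq_iff C_gr_shift_eq)
  have part: "?part (R, G) k = (if k = l then (R, G) else 0)"
      if "R \<in> Cg (Suc l)" "G \<in> Cg l" for R G k l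
    using hom_component_C_gr[of Suc R l k] hom_component_C_gr[of "\<lambda>n. n" G l k] that by (simp
        add: sh zero_prod_def)
  have H: "?H m n (P, E) (Q, F) =
       (NR scale \<alpha> (m + 1) (n + 1) P Q + FN scale br \<alpha> m (n + 1) E Q
          - cs ((- 1) ^ (m * n)) (FN scale br \<alpha> n (m + 1) F P),
        FN scale br \<alpha> m n E F + ins scale \<alpha> (m + 1) n P F
          - cs ((- 1) ^ (m * n)) (ins scale \<alpha> (n + 1) m Q E))"
    by (simp add: bicrossed_bracket_hom_def bilin_ext_homogeneous[OF bilinear_NR P' Q']
      bilin_ext_homogeneous[OF bilinear_FN E Q'] bilin_ext_homogeneous[OF bilinear_FN F P']
      bilin_ext_homogeneous[OF bilinear_FN E F] bilin_ext_homogeneous[OF bilinear_ins P' F]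
      bilin_ext_homogeneous[OF bilinear_ins Q' E])
  have supp: "{k. (if k = l then w else 0) \<noteq> 0} = (if w = 0 then {} else {l})" for l :: nat
      and w :: "'v cochain \<times> 'v cochain"
    by auto
  have "bicrossed_bracket cs (C_gr_shift scale \<alpha>) (bilin_ext (NR scale \<alpha>)) cs Cg (bilin_ext (FN
      scale br \<alpha>))
         insertion (bilin_ext (FN scale br \<alpha>)) (P, E) (Q, F) =
      (if (P, E) = 0 \<or> (Q, F) = 0 then 0 else ?H m n (P, E) (Q, F))"
    unfolding bicrossed_bracket_def Let_def part[OF P' E] part[OF Q' F] supp by simp
  also have "\<dots> = ?H m n (P, E) (Q, F)"
  proof -
    have z: "?H m n (P, E) (Q, F) = 0" if "(P, E) = 0 \<or> (Q, F) = 0"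
      using that P' E Q' F
      by (auto simp: H zero_prod_def bilinear_operation_zero[OF bilinear_NR]
          bilinear_operation_zero[OF bilinear_FN]
        bilinear_operation_zero[OF bilinear_ins])
    then show ?thesis by auto
  qed
  finally show ?thesis unfolding H .
qed

end

theorem theorem4p14:
  fixes scale :: "'k::field_char_0 \<Rightarrow> 'v::ab_group_add \<Rightarrow> 'v"
    and br :: "'v \<Rightarrow> 'v \<Rightarrow> 'v" and \<alpha> :: "'v \<Rightarrow> 'v"
  assumes "hom_lie_algebra scale br \<alpha>"
  shows
    "matched_pair
       (cscale scale) (C_gr_shift scale \<alpha>) (bilin_ext (NR scale \<alpha>))
       (cscale scale) (C_gr scale \<alpha>) (bilin_ext (FN scale br \<alpha>))
       (bilin_ext (ins scale \<alpha>)) (bilin_ext (FN scale br \<alpha>)) \<and>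
     (\<forall>m n. \<forall>P \<in> C_gr_shift scale \<alpha> m. \<forall>E \<in> C_gr scale \<alpha> m.
            \<forall>Q \<in> C_gr_shift scale \<alpha> n. \<forall>F \<in> C_gr scale \<alpha> n.
       bicrossed_bracket
         (cscale scale) (C_gr_shift scale \<alpha>) (bilin_ext (NR scale \<alpha>))
         (cscale scale) (C_gr scale \<alpha>) (bilin_ext (FN scale br \<alpha>))
         (bilin_ext (ins scale \<alpha>)) (bilin_ext (FN scale br \<alpha>)) (P, E) (Q, F) =
       (NR scale \<alpha> (m + 1) (n + 1) P Q + FN scale br \<alpha> m (n + 1) E Q
          - cscale scale ((- 1) ^ (m * n)) (FN scale br \<alpha> n (m + 1) F P),
        FN scale br \<alpha> m n E F + ins scale \<alpha> (m + 1) n P F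
          - cscale scale ((- 1) ^ (m * n)) (ins scale \<alpha> (n + 1) m Q E)))"
proof -
  interpret hom_lie_algebra scale br \<alpha> by fact
  show ?thesis
    using NR_FN_matched_pair bicrossed_bracket_homogeneous by blast
qed

end
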